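(* For $n=1,2$ let $\Psi_n$ be an $\mathcal{A}_n$-localised frame for a separable Hilbert space $\mathcal{H}_n$, and let $w_n$ be an $\mathcal{A}_n$-admissible weight. Let $\mathcal{B}$ be the space of all $O\in B\big(\mathcal{H}^\infty_{1/w_1}(\Psi_1),\mathcal{H}^1_{w_2}(\Psi_2)\big)$ for which there exist a countable index set $R$ and $f_r\in\mathcal{H}^1_{w_1}(\Psi_1)$, $g_r\in\mathcal{H}^1_{w_2}(\Psi_2)$ $(r\in R)$ such that $$O=\sum_{r\in R}\langle\,\cdot\,,f_r\rangle_{\mathcal{H}^\infty_{1/w_1}(\Psi_1),\mathcal{H}^1_{w_1}(\Psi_1)}\,g_r\quad\text{and}\quad\sum_{r\in R}\|f_r\|_{\mathcal{H}^1_{w_1}(\Psi_1)}\|g_r\|_{\mathcal{H}^1_{w_2}(\Psi_2)}<\infty.$$ Then there is an isomorphism between $\mathcal{H}^{1,1}_{w_1\otimes w_2}(\Psi_1\otimes\Psi_2)$ and $\mathcal{B}$. In particular, if either of $K\in\mathcal{H}^{1,1}_{w_1\otimes w_2}(\Psi_1\otimes\Psi_2)$ or $O\in\mathcal{B}$ is given, the other is uniquely determined by means of $$\langle K,f_1\otimes f_2\rangle_{\mathcal{H}^{1,1}_{w_1\otimes w_2}(\Psi_1\otimes\Psi_2),\,\mathcal{H}^{\infty,\infty}_{1/(w_1\otimes w_2)}(\Psi_1\otimes\Psi_2)}=\langle Of_1,f_2\rangle_{\mathcal{H}^1_{w_2}(\Psi_2),\,\mathcal{H}^\infty_{1/w_2}(\Psi_2)}$$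 for all $f_1\in\mathcal{H}^\infty_{1/w_1}(\Psi_1)$ and all $f_2\in\mathcal{H}^\infty_{1/w_2}(\Psi_2)$.
   Context: Conventions. Hilbert spaces are separable, with inner products linear in the first argument. $B(X,Y)$ denotes the bounded linear operators between normed spaces $X,Y$. Frames. A countable family $\Psi=\{\psi_i\}_{i\in I}\subset\mathcal{H}$ is a frame if $A\|f\|^2\le\sum_i|\langle f,\psi_i\rangle|^2\le B\|f\|^2$ for all $f\in\mathcal{H}$ and some $A,B>0$. $C_\Psi f=\{\langle f,\psi_i\rangle\}_{i}$, $D_\Psi c=\sum_i c_i\psi_i$, $S_\Psi=D_\Psi C_\Psi$; the canonical dual frame is $\widetilde\Psi=\{\widetilde\psi_i\}=\{S_\Psi^{-1}\psi_i\}$. The Gram matrix is $G_\Psi=(\langle\psi_{i'},\psi_i\rangle)_{(i,i')\in I^2}$. Localisation. A spectral matrix algebra $\mathcal{A}$ is an involutive Banach algebra of infinite matrices indexed by $I\times I$ (involution: conjugate transpose) such that (a) every $A\in\mathcal{A}$ defines a bounded operator on $\ell^2(I)$; (b) if $A\in\mathcal{A}$ is invertible in $B(\ell^2(I))$ then $A^{-1}\in\mathcal{A}$; (c) $\mathcal{A}$ is solid: $A\in\mathcal{A}$ and $|b_{i,j}|\le|a_{i,j}|$ for all $i,j$ imply $B\in\mathcal{A}$ and $\|B\|_{\mathcal{A}}\le\|A\|_{\mathcal{A}}$. A frame $\Psi$ is $\mathcal{A}$-localised if $G_\Psi\in\mathcal{A}$. For a weight $w=\{w_i\}$, $w_i>0$,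 put $\|c\|_{\ell^p_w(I)}=\|c\cdot w\|_{\ell^p(I)}$; $w$ is $\mathcal{A}$-admissible if every $A\in\mathcal{A}$ defines a bounded operator on $\ell^p_w(I)$ for every $1\le p\le\infty$. Here $\mathcal{A}_1,\mathcal{A}_2$ are spectral matrix algebras over the index sets $I$ and $J$ of $\Psi_1=\{\psi_{1,i}\}_{i\in I}$ and $\Psi_2=\{\psi_{2,j}\}_{j\in J}$. Co-orbit spaces. $\mathcal{H}_{00}(\Psi)$ is the space of finite linear combinations of the $\psi_i$. For $1\le p<\infty$, $\mathcal{H}^p_w(\Psi)$ is the completion of $\mathcal{H}_{00}(\Psi)$ in the norm $\|f\|_{\mathcal{H}^p_w(\Psi)}=\|C_{\widetilde\Psi}f\|_{\ell^p_w}$. $\mathcal{H}^\infty_w(\Psi)$ is the space of equivalence classes of sequences $\{f_n\}\subset\mathcal{H}$ such that $(C_{\widetilde\Psi}f)_i:=\lim_n\langle f_n,\widetilde\psi_i\rangle$ exists for all $i$ and $\sup_n\|C_{\widetilde\Psi}f_n\|_{\ell^\infty_w}<\infty$, where $\{f_n\}\sim\{f_n'\}$ iff $\lim_n\langle f_n-f'_n,\widetilde\psi_i\rangle=0$ for all $i$, with norm $\|C_{\widetilde\Psi}f\|_{\ell^\infty_w}$. $C_{\widetilde\Psi}$ and $C_\Psi$ are extended to these spaces by continuity (respectively limits), so $(C_\Psi g)_i=\sum_j\langle\psi_j,\psi_i\rangle(C_{\widetilde\Psi}g)_j$. The pairing of $\mathcal{H}^p_w(\Psi)$ and $\mathcal{H}^q_{1/w}(\Psi)$,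 $1/p+1/q=1$, is $\langle f,g\rangle=\sum_i(C_{\widetilde\Psi}f)_i\overline{(C_\Psi g)_i}$. Tensor products. $f_1\otimes f_2$ is the rank-one operator $f\mapsto\langle f,f_1\rangle f_2$ (antilinear in $f_1$); $\mathcal{H}_1\otimes\mathcal{H}_2$ is the Hilbert space completion of the span of simple tensors under $\langle f_1\otimes f_2,g_1\otimes g_2\rangle=\overline{\langle f_1,g_1\rangle}\langle f_2,g_2\rangle$. $\Psi_1\otimes\Psi_2=\{\psi_{1,i}\otimes\psi_{2,j}\}_{(i,j)\in I\times J}$ is a frame for it with canonical dual $\widetilde{\Psi_1\otimes\Psi_2}=\widetilde\Psi_1\otimes\widetilde\Psi_2$. $(w_1\otimes w_2)_{i,j}=w_{1,i}w_{2,j}$. $\ell^{p,p}_w(I\times J)$ is the weighted $\ell^p$ space on $I\times J$. $\mathcal{H}^{1,1}_w(\Psi_1\otimes\Psi_2)$ is the completion of the span $\mathcal{H}_{00}(\Psi_1\otimes\Psi_2)$ of $\Psi_1\otimes\Psi_2$ in the norm $\|C_{\widetilde{\Psi_1\otimes\Psi_2}}F\|_{\ell^{1,1}_w}$. $\mathcal{H}^{\infty,\infty}_w(\Psi_1\otimes\Psi_2)$ is the space of equivalence classes of sequences $\{F_n\}\subset\mathcal{H}_1\otimes\mathcal{H}_2$ such that $(C_{\widetilde{\Psi_1\otimes\Psi_2}}F)_{i,j}:=\lim_n\langle F_n,\widetilde\psi_{1,i}\otimes\widetilde\psi_{2,j}\rangle$ exists for all $(i,j)$ and $\sup_n\|C_{\widetilde{\Psi_1\otimes\Psi_2}}F_n\|_{\ell^{\infty,\infty}_w}<\infty$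 (two sequences being equivalent iff $\lim_n\langle F_n-F'_n,\widetilde\psi_{1,i}\otimes\widetilde\psi_{2,j}\rangle=0$ for all $(i,j)$), with norm $\|C_{\widetilde{\Psi_1\otimes\Psi_2}}F\|_{\ell^{\infty,\infty}_w}$. The pairing is $\langle F,G\rangle=\sum_{i,j}(C_{\widetilde{\Psi_1\otimes\Psi_2}}F)_{i,j}\overline{(C_{\Psi_1\otimes\Psi_2}G)_{i,j}}$, with $C_{\Psi_1\otimes\Psi_2}$ extended in the same way as $C_\Psi$. For $f_n$ in co-orbit spaces, $f_1\otimes f_2$ is the element with coefficients $(C_{\widetilde{\Psi_1\otimes\Psi_2}}(f_1\otimes f_2))_{i,j}=\overline{(C_{\widetilde\Psi_1}f_1)_i}\,(C_{\widetilde\Psi_2}f_2)_j$. The paper specifies no norm on $\mathcal{B}$; "isomorphism" is an isomorphism of vector spaces, given by the stated correspondence $K\leftrightarrow O$.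
   Formalization: The spectral matrix algebras are assumed to be unital (to contain the identity matrix); without this, property (b) can be vacuous and the norm of H^1_w can be infinite on frame elements, so the spaces need not be defined. *)

theory Defs
  imports "HOL-Analysis.Analysis"
begin

section \<open>Complex Hilbert spaces\<close>

class cinner_space = real_normed_vector +
  fixes scaleC :: "complex \<Rightarrow> 'a \<Rightarrow> 'a" (infixr "*\<^sub>C" 75)
    and cinner :: "'a \<Rightarrow> 'a \<Rightarrow> complex"
  assumes scaleC_add_right: "c *\<^sub>C (x + y) = c *\<^sub>C x + c *\<^sub>C y"
    and scaleC_add_left: "(c + d) *\<^sub>C x = c *\<^sub>C x + d *\<^sub>C x"
    and scaleC_scaleC: "c *\<^sub>C d *\<^sub>C x = (c * d) *\<^sub>C x"
    and scaleR_scaleC: "r *\<^sub>R x = complex_of_real r *\<^sub>C x"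
    and cinner_commute: "cinner x y = cnj (cinner y x)"
    and cinner_add_left: "cinner (x + y) z = cinner x z + cinner y z"
    and cinner_scaleC_left: "cinner (c *\<^sub>C x) y = c * cinner x y"
    and cinner_self: "cinner x x = complex_of_real ((norm x)\<^sup>2)"

text \<open>The inner product is linear in the first argument. Separable Hilbert spaces are types of sort
  \<open>{chilbert_space, second_countable_topology}\<close>.\<close>

class chilbert_space = cinner_space + complete_space

lemma pre_cauchy_schwarz:
  fixes ip :: "'v::ab_group_add \<Rightarrow> 'v \<Rightarrow> complex" and s :: "complex \<Rightarrow> 'v \<Rightarrow> 'v"
  assumes add: "\<And>x y z. ip (x + y) z = ip x z + ip y z"
    and scale: "\<And>c x y. ip (s c x) y = c * ip x y"
    and comm: "\<And>x y. ip x y = cnj (ip y x)"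
    and pos: "\<And>x. 0 \<le> Re (ip x x)"
  shows "(cmod (ip x y))\<^sup>2 \<le> Re (ip x x) * Re (ip y y)"
proof -
  have addr: "ip x (y + z) = ip x y + ip x z" for x y z
    by (metis add comm complex_cnj_add)
  have scaler: "ip x (s c y) = cnj c * ip x y" for x y c
    by (metis scale comm complex_cnj_mult)
  have real: "Im (ip x x) = 0" for x
    by (metis comm complex_cnj_cancel_iff Reals_cnj_iff complex_is_Real_iff)
  have key: "0 \<le> Re (ip x x) * t\<^sup>2 + 2 * t * (cmod (ip x y))\<^sup>2
      + (cmod (ip x y))\<^sup>2 * Re (ip y y)" for t :: real
  proof -
    define c where "c = ip x y"
    define v where "v = s (of_real t) x + s c y"
    have cy: "ip y x = cnj c" unfolding c_def by (rule comm)
    have "ip v v = of_real t * of_real t * ip x x + of_real t * (cnj c * c)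
        + of_real t * (c * cnj c) + (c * cnj c) * ip y y"
      unfolding v_def by (simp add: add addr scale scaler cy c_def[symmetric] algebra_simps)
    moreover have "c * cnj c = of_real ((cmod c)\<^sup>2)"
      by (rule complex_norm_square[symmetric])
    ultimately have "ip v v = of_real (t\<^sup>2) * ip x x + of_real (2 * t * (cmod c)\<^sup>2)
        + of_real ((cmod c)\<^sup>2) * ip y y"
      by (simp add: power2_eq_square algebra_simps)
    then have "Re (ip v v) = t\<^sup>2 * Re (ip x x) + 2 * t * (cmod c)\<^sup>2 + (cmod c)\<^sup>2 * Re (ip y y)"
      by (simp del: of_real_mult of_real_power add: Re_complex_of_real)
    with pos[of v] show ?thesis by (simp add: c_def mult.commute)
  qed
  define a where "a = Re (ip x x)"
  define b where "b = Re (ip y y)"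
  define m where "m = (cmod (ip x y))\<^sup>2"
  have k: "0 \<le> a * t\<^sup>2 + 2 * t * m + m * b" for t
    using key[of t] by (simp add: a_def b_def m_def)
  have ab: "a \<ge> 0" "b \<ge> 0" "m \<ge> 0" using pos by (auto simp: a_def b_def m_def)
  have "m \<le> a * b"
  proof (cases "m = 0")
    case True
    then show ?thesis using ab by simp
  next
    case False
    then have m: "m > 0" using ab by simp
    show ?thesis
    proof (cases "a = 0")
      case True
      have "0 \<le> 2 * (- (b + 1)) * m + m * b" using k[of "-(b+1)"] True by simp
      then have "0 \<le> m * (- b - 2)" by (simp add: algebra_simps)
      then show ?thesis using m ab by (simp add: zero_le_mult_iff)
    next
      case False
      then have a: "a > 0" using ab by simp
      have "0 \<le> a * (m/a)\<^sup>2 - 2 * (m/a) * m + m * b" using k[of "-(m/a)"] by simp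
      also have "\<dots> = m * (b - m / a)" using a by (simp add: field_simps power2_eq_square)
      finally have "m / a \<le> b" using m by (simp add: zero_le_mult_iff)
      then show ?thesis using a by (simp add: field_simps)
    qed
  qed
  then show ?thesis by (simp add: a_def b_def m_def)
qed

lemma pre_triangle:
  fixes ip :: "'v::ab_group_add \<Rightarrow> 'v \<Rightarrow> complex" and s :: "complex \<Rightarrow> 'v \<Rightarrow> 'v"
  assumes add: "\<And>x y z. ip (x + y) z = ip x z + ip y z"
    and scale: "\<And>c x y. ip (s c x) y = c * ip x y"
    and comm: "\<And>x y. ip x y = cnj (ip y x)"
    and pos: "\<And>x. 0 \<le> Re (ip x x)"
  shows "sqrt (Re (ip (x + y) (x + y))) \<le> sqrt (Re (ip x x)) + sqrt (Re (ip y y))"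
proof (rule real_le_lsqrt)
  have addr: "ip x (y + z) = ip x y + ip x z" for x y z
    by (metis add comm complex_cnj_add)
  have "Re (ip x y) \<le> cmod (ip x y)" by (rule complex_Re_le_cmod)
  also have "\<dots> \<le> sqrt (Re (ip x x) * Re (ip y y))"
    using pre_cauchy_schwarz[of ip s x y, OF assms] by (simp add: real_le_rsqrt)
  finally have "Re (ip x y) \<le> sqrt (Re (ip x x)) * sqrt (Re (ip y y))"
    by (simp add: real_sqrt_mult)
  moreover have "Re (ip y x) = Re (ip x y)" by (subst comm) simp
  ultimately show "Re (ip (x + y) (x + y)) \<le> (sqrt (Re (ip x x)) + sqrt (Re (ip y y)))\<^sup>2"
    using pos[of x] pos[of y] by (simp add: add addr power2_sum)
qed (use pos in auto)

lemma cinner_add_right: "cinner x (y + z) = cinner x y + cinner x z"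
  by (metis cinner_commute cinner_add_left complex_cnj_add)

lemma cinner_scaleC_right: "cinner x (c *\<^sub>C y) = cnj c * cinner x y"
  by (metis cinner_commute cinner_scaleC_left complex_cnj_mult)

lemma cinner_zero_left [simp]: "cinner 0 x = 0"
  using cinner_add_left[of 0 0 x] by simp

lemma cinner_zero_right [simp]: "cinner x 0 = 0"
  using cinner_add_right[of x 0 0] by simp

lemma cinner_minus_left: "cinner (- x) y = - cinner x y"
  using cinner_add_left[of x "- x" y] by (simp add: eq_neg_iff_add_eq_0 add.commute)

lemma cinner_minus_right: "cinner x (- y) = - cinner x y"
  using cinner_add_right[of x y "- y"] by (simp add: eq_neg_iff_add_eq_0 add.commute)

lemma cinner_diff_left: "cinner (x - y) z = cinner x z - cinner y z"
  using cinner_add_left[of x "- y" z] by (simp add: cinner_minus_left)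

lemma cinner_diff_right: "cinner x (y - z) = cinner x y - cinner x z"
  using cinner_add_right[of x y "- z"] by (simp add: cinner_minus_right)

lemma scaleC_zero_right [simp]: "c *\<^sub>C 0 = 0"
  using scaleC_add_right[of c 0 0] by simp

lemma scaleC_zero_left [simp]: "0 *\<^sub>C x = 0"
  using scaleC_add_left[of 0 0 x] by simp

lemma scaleC_one [simp]: "1 *\<^sub>C x = x"
  using scaleR_scaleC[of 1 x] by simp

lemma scaleC_minus_left: "(- c) *\<^sub>C x = - (c *\<^sub>C x)"
  using scaleC_add_left[of c "- c" x] by (simp add: eq_neg_iff_add_eq_0 add.commute)

lemma scaleC_minus_one: "(- 1) *\<^sub>C x = - x"
  by (simp add: scaleC_minus_left)

lemma scaleC_diff_right: "c *\<^sub>C (x - y) = c *\<^sub>C x - c *\<^sub>C y"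
  by (metis scaleC_add_right add_diff_cancel diff_add_cancel)

lemma norm_eq_sqrt_cinner: "norm x = sqrt (Re (cinner x x))"
  by (simp add: cinner_self)

lemma norm_scaleC: "norm (c *\<^sub>C x) = cmod c * norm x"
proof -
  have "cinner (c *\<^sub>C x) (c *\<^sub>C x) = (c * cnj c) * cinner x x"
    by (simp add: cinner_scaleC_left cinner_scaleC_right)
  also have "\<dots> = complex_of_real ((cmod c * norm x)\<^sup>2)"
    by (simp add: cinner_self power_mult_distrib complex_norm_square[symmetric])
  finally have "(norm (c *\<^sub>C x))\<^sup>2 = (cmod c * norm x)\<^sup>2"
    by (simp only: cinner_self of_real_eq_iff)
  then show ?thesis by (simp add: power2_eq_iff_nonneg)
qed

lemma cauchy_schwarz: "cmod (cinner x y) \<le> norm x * norm y"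
proof -
  have "(cmod (cinner x y))\<^sup>2 \<le> Re (cinner x x) * Re (cinner y y)"
    by (rule pre_cauchy_schwarz[of cinner scaleC])
      (auto simp: cinner_add_left cinner_scaleC_left cinner_self intro: cinner_commute)
  also have "\<dots> = (norm x * norm y)\<^sup>2" by (simp add: cinner_self power_mult_distrib)
  finally show ?thesis by (rule power2_le_imp_le) simp
qed

lemma cinner_sum_left: "cinner (\<Sum>i\<in>A. f i) y = (\<Sum>i\<in>A. cinner (f i) y)"
  by (induction A rule: infinite_finite_induct) (auto simp: cinner_add_left)

lemma cinner_sum_right: "cinner y (\<Sum>i\<in>A. f i) = (\<Sum>i\<in>A. cinner y (f i))"
  by (induction A rule: infinite_finite_induct) (auto simp: cinner_add_right)

lemma scaleC_sum_right: "c *\<^sub>C (\<Sum>i\<in>A. f i) = (\<Sum>i\<in>A. c *\<^sub>C f i)"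
  by (induction A rule: infinite_finite_induct) (auto simp: scaleC_add_right)

lemma cinner_sum_list_left: "cinner (\<Sum>i\<leftarrow>l. f i) y = (\<Sum>i\<leftarrow>l. cinner (f i) y)"
  by (induction l) (auto simp: cinner_add_left)

lemma cinner_sum_list_right: "cinner y (\<Sum>i\<leftarrow>l. f i) = (\<Sum>i\<leftarrow>l. cinner y (f i))"
  by (induction l) (auto simp: cinner_add_right)

lemma bounded_bilinear_cinner: "bounded_bilinear (cinner :: 'a::cinner_space \<Rightarrow> 'a \<Rightarrow> complex)"
proof
  show "\<exists>K. \<forall>a b::'a. norm (cinner a b) \<le> norm a * norm b * K"
    by (rule exI[of _ 1]) (simp add: cauchy_schwarz)
qed (auto simp: cinner_add_left cinner_add_right scaleR_scaleC cinner_scaleC_left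
    cinner_scaleC_right scaleR_conv_of_real)

lemmas tendsto_cinner = bounded_bilinear.tendsto[OF bounded_bilinear_cinner]

lemma bounded_linear_scaleC: "bounded_linear (\<lambda>x::'a::cinner_space. c *\<^sub>C x)"
  by (rule bounded_linear_intro[where K="cmod c"])
    (auto simp: scaleC_add_right scaleR_scaleC scaleC_scaleC norm_scaleC mult.commute)

section \<open>The Hilbert space tensor product\<close>

definition finrank_op :: "('a::cinner_space \<times> 'b::cinner_space) list \<Rightarrow> 'a \<Rightarrow> 'b"
  where "finrank_op l f = (\<Sum>(x, y)\<leftarrow>l. cinner f x *\<^sub>C y)"

text \<open>The type of pre-completed tensors is the span of the simple tensors, where \<open>x \<otimes> y\<close> is the operator
  \<open>f \<mapsto> \<langle>f, x\<rangle> y\<close>; scalars can be absorbed into the second factor.\<close>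

typedef (overloaded) ('a, 'b) finrank = "range (finrank_op :: ('a::cinner_space \<times> 'b::cinner_space) list \<Rightarrow> _)"
  by auto

setup_lifting type_definition_finrank

lemma finrank_op_append: "finrank_op (l @ l') f = finrank_op l f + finrank_op l' f"
  by (simp add: finrank_op_def)

lemma finrank_op_scale:
  "finrank_op (map (\<lambda>(x, y). (x, c *\<^sub>C y)) l) f = c *\<^sub>C finrank_op l f"
  by (induction l) (auto simp: finrank_op_def scaleC_add_right scaleC_scaleC mult.commute)

lemma finrank_op_range_add:
  "S \<in> range finrank_op \<Longrightarrow> T \<in> range finrank_op \<Longrightarrow> (\<lambda>f. S f + T f) \<in> range finrank_op"
  by (auto simp: finrank_op_append[symmetric])

lemma finrank_op_range_scale:
  "T \<in> range finrank_op \<Longrightarrow> (\<lambda>f. c *\<^sub>C T f) \<in> range finrank_op"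
  by (auto simp: finrank_op_scale[symmetric])

lemma finrank_op_range_zero: "(\<lambda>f. 0) \<in> range finrank_op"
  by (rule range_eqI[of _ _ "[]"]) (simp add: finrank_op_def fun_eq_iff)

lift_definition rank_one :: "'a::cinner_space \<Rightarrow> 'b::cinner_space \<Rightarrow> ('a, 'b) finrank"
  is "\<lambda>x y f. cinner f x *\<^sub>C y"
proof -
  fix x :: 'a and y :: 'b
  show "(\<lambda>f. cinner f x *\<^sub>C y) \<in> range finrank_op"
    by (rule range_eqI[of _ _ "[(x, y)]"]) (simp add: finrank_op_def fun_eq_iff)
qed

text \<open>The inner product determined by
  \<open>\<langle>f\<^sub>1 \<otimes> f\<^sub>2, g\<^sub>1 \<otimes> g\<^sub>2\<rangle> = cnj \<langle>f\<^sub>1, g\<^sub>1\<rangle> \<langle>f\<^sub>2, g\<^sub>2\<rangle> = \<langle>(f\<^sub>1 \<otimes> f\<^sub>2) g\<^sub>1, g\<^sub>2\<rangle>\<close>.\<close>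

definition finrank_inner :: "('a::cinner_space \<Rightarrow> 'b::cinner_space) \<Rightarrow> ('a \<Rightarrow> 'b) \<Rightarrow> complex"
  where "finrank_inner T U = (\<Sum>(x, y)\<leftarrow>(SOME l. U = finrank_op l). cinner (T x) y)"

lemma finrank_inner_swap:
  "(\<Sum>(x, y)\<leftarrow>l'. cinner (finrank_op l x) y) = cnj (\<Sum>(x, y)\<leftarrow>l. cinner (finrank_op l' x) y)"
proof -
  have *: "(\<Sum>(x, y)\<leftarrow>l'. cinner (cinner x u *\<^sub>C v) y) = cnj (cinner (finrank_op l' u) v)" for u v
    by (induction l')
      (auto simp: finrank_op_def cinner_add_left cinner_scaleC_left cinner_commute[of v]
        cinner_commute[of _ u])
  show ?thesis
  proof (induction l)
    case Nil
    then show ?case by (auto simp: finrank_op_def sum_list_0)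
  next
    case (Cons p l)
    obtain u v where p: "p = (u, v)" by (cases p)
    have "(\<Sum>(x, y)\<leftarrow>l'. cinner (finrank_op (p # l) x) y)
        = (\<Sum>(x, y)\<leftarrow>l'. cinner (cinner x u *\<^sub>C v) y) + (\<Sum>(x, y)\<leftarrow>l'. cinner (finrank_op l x) y)"
      by (induction l') (auto simp: p finrank_op_def cinner_add_left)
    then show ?case using Cons by (simp add: * p)
  qed
qed

lemma finrank_inner_eq:
  assumes "T \<in> range finrank_op" "U = finrank_op l"
  shows "finrank_inner T U = (\<Sum>(x, y)\<leftarrow>l. cinner (T x) y)"
proof -
  obtain k where k: "T = finrank_op k" using assms(1) by blast
  define m where "m = (SOME l. U = finrank_op l)"
  have m: "U = finrank_op m" unfolding m_def using assms(2) by (rule someI)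
  have "finrank_inner T U = cnj (\<Sum>(x, y)\<leftarrow>k. cinner (U x) y)"
    unfolding finrank_inner_def m_def[symmetric] k finrank_inner_swap[of k m] m[symmetric] ..
  also have "\<dots> = (\<Sum>(x, y)\<leftarrow>l. cinner (T x) y)"
    unfolding k finrank_inner_swap[of k l] assms(2)[symmetric] ..
  finally show ?thesis .
qed

lemma finrank_inner_comm:
  assumes "T \<in> range finrank_op" "U \<in> range finrank_op"
  shows "finrank_inner T U = cnj (finrank_inner U T)"
proof -
  obtain k l where k: "T = finrank_op k" and l: "U = finrank_op l" using assms by blast
  show ?thesis
    unfolding finrank_inner_eq[OF assms(1) l] finrank_inner_eq[OF assms(2) k]
    unfolding k l by (rule finrank_inner_swap)
qed

lemma finrank_orthonormal:
  fixes l :: "('a::cinner_space \<times> 'b::cinner_space) list"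
  shows "\<exists>E g. finite E \<and> (\<forall>e\<in>E. \<forall>e'\<in>E. cinner e e' = (if e = e' then 1 else 0))
    \<and> finrank_op l = (\<lambda>f. \<Sum>e\<in>E. cinner f e *\<^sub>C g e)"
proof (induction l)
  case Nil
  show ?case by (rule exI[of _ "{}"]) (auto simp: finrank_op_def)
next
  case (Cons p l)
  obtain x y where p: "p = (x, y)" by (cases p)
  obtain E g where E: "finite E" and on: "\<And>e e'. e \<in> E \<Longrightarrow> e' \<in> E \<Longrightarrow> cinner e e' = (if e = e' then 1 else 0)"
    and l: "finrank_op l = (\<lambda>f. \<Sum>e\<in>E. cinner f e *\<^sub>C g e)" using Cons by auto
  define z where "z = x - (\<Sum>e\<in>E. cinner x e *\<^sub>C e)"
  have zE: "cinner z e = 0" if "e \<in> E" for e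
  proof -
    have "cinner (\<Sum>e\<in>E. cinner x e *\<^sub>C e) e = (\<Sum>e'\<in>E. if e' = e then cinner x e' else 0)"
      unfolding cinner_sum_left by (rule sum.cong) (auto simp: cinner_scaleC_left on that)
    also have "\<dots> = cinner x e" using E that by simp
    finally show ?thesis by (simp add: z_def cinner_diff_left)
  qed
  have x: "x = (\<Sum>e\<in>E. cinner x e *\<^sub>C e) + z" by (simp add: z_def)
  have fx: "cinner f x = (\<Sum>e\<in>E. cnj (cinner x e) * cinner f e) + cinner f z" for f
    by (subst x) (simp add: cinner_add_right cinner_sum_right cinner_scaleC_right)
  have op: "finrank_op (p # l) f = (\<Sum>e\<in>E. cinner f e *\<^sub>C (g e + cnj (cinner x e) *\<^sub>C y)) + cinner f z *\<^sub>C y" for f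
  proof -
    have sl: "(\<Sum>e\<in>E. a e) *\<^sub>C y = (\<Sum>e\<in>E. a e *\<^sub>C y)" for a :: "'a \<Rightarrow> complex"
      by (induction E rule: infinite_finite_induct) (auto simp: scaleC_add_left)
    have "finrank_op (p # l) f = cinner f x *\<^sub>C y + (\<Sum>e\<in>E. cinner f e *\<^sub>C g e)"
      using fun_cong[OF l, of f] by (simp add: p finrank_op_def)
    also have "cinner f x *\<^sub>C y = (\<Sum>e\<in>E. cinner f e *\<^sub>C cnj (cinner x e) *\<^sub>C y) + cinner f z *\<^sub>C y"
      by (simp add: fx scaleC_add_left sl scaleC_scaleC mult.commute)
    finally show ?thesis by (simp add: scaleC_add_right sum.distrib)
  qed
  show ?case
  proof (cases "z = 0")
    case True
    show ?thesis
    proof (intro exI[of _ E] exI[of _ "\<lambda>e. g e + cnj (cinner x e) *\<^sub>C y"] conjI ballI ext)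
      show "finrank_op (p # l) f = (\<Sum>e\<in>E. cinner f e *\<^sub>C (g e + cnj (cinner x e) *\<^sub>C y))" for f
        using op[of f] True by simp
    qed (fact E on)+
  next
    case False
    define u where "u = (1 / norm z) *\<^sub>R z"
    have zu: "z = complex_of_real (norm z) *\<^sub>C u"
      unfolding u_def scaleR_scaleC[symmetric] using False by simp
    have uu: "cinner u u = 1" using False by (simp add: cinner_self u_def)
    have uE: "cinner u e = 0" "cinner e u = 0" if "e \<in> E" for e
    proof -
      show "cinner u e = 0" using zE[OF that] by (simp add: u_def scaleR_scaleC cinner_scaleC_left)
      then show "cinner e u = 0" by (subst cinner_commute) simp
    qed
    have uE': "u \<notin> E" using uE uu by force
    define h where "h e = (if e = u then complex_of_real (norm z) *\<^sub>C y
        else g e + cnj (cinner x e) *\<^sub>C y)" for e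
    have fz: "cinner f z = complex_of_real (norm z) * cinner f u" for f
      by (subst zu) (simp add: cinner_scaleC_right)
    have rep: "finrank_op (p # l) f = (\<Sum>e\<in>insert u E. cinner f e *\<^sub>C h e)" for f
    proof -
      have "(\<Sum>e\<in>E. cinner f e *\<^sub>C h e) = (\<Sum>e\<in>E. cinner f e *\<^sub>C (g e + cnj (cinner x e) *\<^sub>C y))"
        using uE' by (intro sum.cong) (auto simp: h_def)
      moreover have "cinner f z *\<^sub>C y = cinner f u *\<^sub>C h u"
        by (simp only: fz h_def refl if_True scaleC_scaleC mult.commute)
      ultimately show ?thesis
        by (simp only: op sum.insert[OF E uE'] add.commute)
    qed
    have orth: "cinner e e' = (if e = e' then 1 else 0)"
      if "e \<in> insert u E" "e' \<in> insert u E" for e e'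
    proof (cases "e = u"; cases "e' = u")
      assume "e \<noteq> u" "e' \<noteq> u"
      then show ?thesis using on[of e e'] that by blast
    qed (use that uE uu in auto)
    show ?thesis
    proof (intro exI[of _ "insert u E"] exI[of _ h] conjI ballI ext)
      show "finite (insert u E)" using E by simp
    qed (fact orth rep)+
  qed
qed

lemma finrank_inner_self:
  assumes "T \<in> range finrank_op"
  shows "0 \<le> Re (finrank_inner T T)" "Im (finrank_inner T T) = 0"
    and "Re (finrank_inner T T) = 0 \<Longrightarrow> T = (\<lambda>f. 0)"
proof -
  obtain l where l: "T = finrank_op l" using assms by blast
  obtain E g where E: "finite E" and on: "\<And>e e'. e \<in> E \<Longrightarrow> e' \<in> E \<Longrightarrow> cinner e e' = (if e = e' then 1 else 0)"
    and T: "T = (\<lambda>f. \<Sum>e\<in>E. cinner f e *\<^sub>C g e)" using finrank_orthonormal[of l] l by auto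
  have Te: "T e = g e" if "e \<in> E" for e
  proof -
    have "T e = (\<Sum>e'\<in>E. if e' = e then g e' else 0)"
      unfolding T by (rule sum.cong) (auto simp: on that)
    then show ?thesis using E that by simp
  qed
  have lst: "(\<Sum>(x, y)\<leftarrow>k. \<Sum>e\<in>E. F e x y) = (\<Sum>e\<in>E. \<Sum>(x, y)\<leftarrow>k. F e x y)"
    for F :: "'a \<Rightarrow> 'a \<Rightarrow> 'b \<Rightarrow> complex" and k
    by (induction k) (auto simp: sum.distrib)
  have ge: "(\<Sum>(x, y)\<leftarrow>k. cinner x e * cinner (g e) y) = cinner (g e) (finrank_op k e)" for e k
    by (induction k) (auto simp: finrank_op_def cinner_add_right cinner_scaleC_right
        cinner_commute[of _ e])
  have "finrank_inner T T = (\<Sum>(x, y)\<leftarrow>l. \<Sum>e\<in>E. cinner x e * cinner (g e) y)"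
    unfolding finrank_inner_eq[OF assms l] unfolding T
    by (rule arg_cong[where f = sum_list]) (auto simp: cinner_sum_left cinner_scaleC_left)
  also have "\<dots> = (\<Sum>e\<in>E. cinner (g e) (T e))" by (simp add: lst ge l)
  also have "\<dots> = (\<Sum>e\<in>E. complex_of_real ((norm (g e))\<^sup>2))"
    by (intro sum.cong refl) (simp add: Te cinner_self)
  finally have ip: "finrank_inner T T = complex_of_real (\<Sum>e\<in>E. (norm (g e))\<^sup>2)" by simp
  show "0 \<le> Re (finrank_inner T T)" "Im (finrank_inner T T) = 0"
    by (auto simp: ip intro: sum_nonneg)
  assume "Re (finrank_inner T T) = 0"
  then have "\<forall>e\<in>E. (norm (g e))\<^sup>2 = 0"
    using sum_nonneg_eq_0_iff[OF E, of "\<lambda>e. (norm (g e))\<^sup>2"] by (simp add: ip)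
  then show "T = (\<lambda>f. 0)" by (simp add: T)
qed

lemma finrank_inner_add:
  assumes "S \<in> range finrank_op" "T \<in> range finrank_op" "U \<in> range finrank_op"
  shows "finrank_inner (\<lambda>f. S f + T f) U = finrank_inner S U + finrank_inner T U"
proof -
  obtain l where l: "U = finrank_op l" using assms by blast
  show ?thesis
    unfolding finrank_inner_eq[OF assms(1) l] finrank_inner_eq[OF assms(2) l]
      finrank_inner_eq[OF finrank_op_range_add[OF assms(1,2)] l]
    by (induction l) (auto simp: cinner_add_left)
qed

lemma finrank_inner_scale:
  assumes "T \<in> range finrank_op" "U \<in> range finrank_op"
  shows "finrank_inner (\<lambda>f. c *\<^sub>C T f) U = c * finrank_inner T U"
proof -
  obtain l where l: "U = finrank_op l" using assms by blast
  show ?thesis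
    unfolding finrank_inner_eq[OF assms(1) l] finrank_inner_eq[OF finrank_op_range_scale[OF assms(1)] l]
    by (induction l) (auto simp: cinner_scaleC_left algebra_simps)
qed

instantiation finrank :: (cinner_space, cinner_space) ab_group_add
begin

lift_definition zero_finrank :: "('a, 'b) finrank" is "\<lambda>f. 0"
  by (rule finrank_op_range_zero)

lift_definition plus_finrank :: "('a, 'b) finrank \<Rightarrow> ('a, 'b) finrank \<Rightarrow> ('a, 'b) finrank"
  is "\<lambda>S T f. S f + T f"
  by (rule finrank_op_range_add)

lift_definition uminus_finrank :: "('a, 'b) finrank \<Rightarrow> ('a, 'b) finrank"
  is "\<lambda>T f. - T f"
  using finrank_op_range_scale[of _ "-1"] by (simp only: scaleC_minus_one)

definition minus_finrank :: "('a, 'b) finrank \<Rightarrow> ('a, 'b) finrank \<Rightarrow> ('a, 'b) finrank"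
  where "minus_finrank S T = S + - T"

instance
  by standard (unfold minus_finrank_def, (transfer, auto simp: algebra_simps)+)

end

instantiation finrank :: (cinner_space, cinner_space) cinner_space
begin

lift_definition scaleC_finrank :: "complex \<Rightarrow> ('a, 'b) finrank \<Rightarrow> ('a, 'b) finrank"
  is "\<lambda>c T f. c *\<^sub>C T f"
  by (rule finrank_op_range_scale)

lift_definition cinner_finrank :: "('a, 'b) finrank \<Rightarrow> ('a, 'b) finrank \<Rightarrow> complex"
  is finrank_inner .

definition scaleR_finrank :: "real \<Rightarrow> ('a, 'b) finrank \<Rightarrow> ('a, 'b) finrank"
  where "scaleR_finrank r T = complex_of_real r *\<^sub>C T"

definition norm_finrank :: "('a, 'b) finrank \<Rightarrow> real"
  where "norm_finrank T = sqrt (Re (cinner T T))"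

definition sgn_finrank :: "('a, 'b) finrank \<Rightarrow> ('a, 'b) finrank"
  where "sgn_finrank T = inverse (norm T) *\<^sub>R T"

definition dist_finrank :: "('a, 'b) finrank \<Rightarrow> ('a, 'b) finrank \<Rightarrow> real"
  where "dist_finrank S T = norm (S - T)"

definition uniformity_finrank :: "(('a, 'b) finrank \<times> ('a, 'b) finrank) filter"
  where "uniformity_finrank = (INF e\<in>{0<..}. principal {(S, T). dist S T < e})"

definition open_finrank :: "('a, 'b) finrank set \<Rightarrow> bool"
  where "open_finrank U = (\<forall>S\<in>U. eventually (\<lambda>(S', T). S' = S \<longrightarrow> T \<in> U) uniformity)"

instance
proof
  fix r s :: real and c d :: complex and S T U :: "('a, 'b) finrank"
  show add: "cinner (S + T) U = cinner S U + cinner T U" for S T U :: "('a, 'b) finrank"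
    by transfer (rule finrank_inner_add)
  show scl: "cinner (c *\<^sub>C S) T = c * cinner S T" for c and S T :: "('a, 'b) finrank"
    by transfer (rule finrank_inner_scale)
  show com: "cinner S T = cnj (cinner T S)" for S T :: "('a, 'b) finrank"
    by transfer (rule finrank_inner_comm)
  have pos: "0 \<le> Re (cinner T T)" for T :: "('a, 'b) finrank"
    by transfer (rule finrank_inner_self)
  have real: "Im (cinner T T) = 0" for T :: "('a, 'b) finrank"
    by transfer (rule finrank_inner_self)
  show self: "cinner T T = complex_of_real ((norm T)\<^sup>2)" for T :: "('a, 'b) finrank"
    using pos[of T] real[of T] by (simp add: norm_finrank_def complex_eq_iff)
  show sadd: "c *\<^sub>C (S + T) = c *\<^sub>C S + c *\<^sub>C T" for c and S T :: "('a, 'b) finrank"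
    by transfer (simp add: scaleC_add_right)
  show saddl: "(c + d) *\<^sub>C S = c *\<^sub>C S + d *\<^sub>C S" for c d and S :: "('a, 'b) finrank"
    by transfer (simp add: scaleC_add_left)
  show ss: "c *\<^sub>C d *\<^sub>C S = (c * d) *\<^sub>C S" for c d and S :: "('a, 'b) finrank"
    by transfer (simp add: scaleC_scaleC)
  have one: "1 *\<^sub>C S = S" for S :: "('a, 'b) finrank"
    by transfer simp
  show "r *\<^sub>R S = complex_of_real r *\<^sub>C S" by (rule scaleR_finrank_def)
  show "r *\<^sub>R (S + T) = r *\<^sub>R S + r *\<^sub>R T" "(r + s) *\<^sub>R S = r *\<^sub>R S + s *\<^sub>R S"
    "r *\<^sub>R s *\<^sub>R S = (r * s) *\<^sub>R S" "1 *\<^sub>R S = S"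
    by (simp_all add: scaleR_finrank_def sadd saddl ss one)
  show "(norm S = 0) = (S = 0)"
  proof
    assume "norm S = 0"
    then have "Re (cinner S S) = 0" by (simp add: self)
    then show "S = 0" by transfer (rule finrank_inner_self)
  next
    assume "S = 0"
    then show "norm S = 0" using scl[of 0 S S] scl[of 0 0 0] add[of 0 0 0] by (simp add: norm_finrank_def)
  qed
  show "norm (S + T) \<le> norm S + norm T"
    unfolding norm_finrank_def
    by (rule pre_triangle[where ip = "cinner :: ('a, 'b) finrank \<Rightarrow> _ \<Rightarrow> complex" and s = scaleC]) (fact add scl com pos)+
  show "norm (r *\<^sub>R S) = \<bar>r\<bar> * norm S"
  proof -
    have "cinner S (complex_of_real r *\<^sub>C S) = r * cinner S S"
      by (metis com complex_cnj_complex_of_real complex_cnj_mult scl)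
    then have "cinner (r *\<^sub>R S) (r *\<^sub>R S) = complex_of_real (r * r) * cinner S S"
      by (simp add: scaleR_finrank_def scl)
    then have "Re (cinner (r *\<^sub>R S) (r *\<^sub>R S)) = r\<^sup>2 * Re (cinner S S)"
      by (simp add: power2_eq_square)
    then show ?thesis by (simp add: norm_finrank_def real_sqrt_mult)
  qed
qed (rule sgn_finrank_def dist_finrank_def uniformity_finrank_def open_finrank_def)+

end

lemma cinner_rank_one: "cinner (rank_one f1 f2) (rank_one g1 g2) = cnj (cinner f1 g1) * cinner f2 g2"
proof transfer
  fix f1 g1 :: 'a and f2 g2 :: 'b
  have f: "(\<lambda>f. cinner f f1 *\<^sub>C f2) = finrank_op [(f1, f2)]"
    and g: "(\<lambda>f. cinner f g1 *\<^sub>C g2) = finrank_op [(g1, g2)]"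
    by (simp_all add: finrank_op_def fun_eq_iff)
  show "finrank_inner (\<lambda>f. cinner f f1 *\<^sub>C f2) (\<lambda>f. cinner f g1 *\<^sub>C g2) = cnj (cinner f1 g1) * cinner f2 g2"
    using finrank_inner_eq[OF _ g, of "\<lambda>f. cinner f f1 *\<^sub>C f2"] cinner_commute[of g1 f1]
    by (simp add: f cinner_scaleC_left finrank_op_def[of "[(f1, f2)]"])
qed

text \<open>The completion of an inner product space: Cauchy sequences modulo null sequences.\<close>

definition cauchy_equiv :: "(nat \<Rightarrow> 'a::cinner_space) \<Rightarrow> (nat \<Rightarrow> 'a) \<Rightarrow> bool"
  where "cauchy_equiv X Y \<longleftrightarrow> Cauchy X \<and> Cauchy Y \<and> (\<lambda>n. X n - Y n) \<longlonglongrightarrow> 0"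

lemma Cauchy_const: "Cauchy (\<lambda>n. x::'a::cinner_space)"
  by (rule convergent_Cauchy) (rule convergent_const)

quotient_type (overloaded) 'a completion = "nat \<Rightarrow> 'a::cinner_space" / partial: cauchy_equiv
proof (rule part_equivpI)
  show "\<exists>X::nat \<Rightarrow> 'a. cauchy_equiv X X"
    by (rule exI[of _ "\<lambda>n. 0"]) (simp add: cauchy_equiv_def Cauchy_const)
  show "symp (cauchy_equiv :: (nat \<Rightarrow> 'a) \<Rightarrow> _)"
  proof (rule sympI)
    fix X Y :: "nat \<Rightarrow> 'a" assume "cauchy_equiv X Y"
    then show "cauchy_equiv Y X"
      using tendsto_minus[of "\<lambda>n. X n - Y n" 0 sequentially] by (simp add: cauchy_equiv_def)
  qed
  show "transp (cauchy_equiv :: (nat \<Rightarrow> 'a) \<Rightarrow> _)"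
  proof (rule transpI)
    fix X Y Z :: "nat \<Rightarrow> 'a" assume "cauchy_equiv X Y" "cauchy_equiv Y Z"
    then show "cauchy_equiv X Z"
      using tendsto_add[of "\<lambda>n. X n - Y n" 0 sequentially "\<lambda>n. Y n - Z n" 0]
      by (simp add: cauchy_equiv_def)
  qed
qed

lemma Cauchy_add_seq:
  fixes X Y :: "nat \<Rightarrow> 'a::cinner_space"
  assumes "Cauchy X" "Cauchy Y"
  shows "Cauchy (\<lambda>n. X n + Y n)"
proof (rule metric_CauchyI)
  fix e :: real assume "e > 0"
  then have e: "e / 2 > 0" by simp
  obtain M where M: "\<And>m n. m \<ge> M \<Longrightarrow> n \<ge> M \<Longrightarrow> dist (X m) (X n) < e / 2"
    using metric_CauchyD[OF assms(1) e] by blast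
  obtain N where N: "\<And>m n. m \<ge> N \<Longrightarrow> n \<ge> N \<Longrightarrow> dist (Y m) (Y n) < e / 2"
    using metric_CauchyD[OF assms(2) e] by blast
  have "dist (X m + Y m) (X n + Y n) < e" if "m \<ge> max M N" "n \<ge> max M N" for m n
    using M[of m n] N[of m n] that dist_triangle_add[of "X m" "Y m" "X n" "Y n"] by auto
  then show "\<exists>M. \<forall>m\<ge>M. \<forall>n\<ge>M. dist (X m + Y m) (X n + Y n) < e" by blast
qed

lemma Cauchy_scaleC_seq: "Cauchy X \<Longrightarrow> Cauchy (\<lambda>n. c *\<^sub>C X n)"
  by (rule bounded_linear.Cauchy[OF bounded_linear_scaleC])

lemma convergent_cinner:
  fixes X Y :: "nat \<Rightarrow> 'a::cinner_space"
  assumes X: "Cauchy X" and Y: "Cauchy Y"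
  shows "convergent (\<lambda>n. cinner (X n) (Y n))"
proof -
  obtain B where B: "B > 0" "\<And>n. norm (X n) \<le> B" using Cauchy_Bseq[OF X] by (auto simp: Bseq_def)
  obtain C where C: "C > 0" "\<And>n. norm (Y n) \<le> C" using Cauchy_Bseq[OF Y] by (auto simp: Bseq_def)
  have "Cauchy (\<lambda>n. cinner (X n) (Y n))"
  proof (rule CauchyI)
    fix e :: real assume e: "e > 0"
    obtain M where M: "\<And>m n. m \<ge> M \<Longrightarrow> n \<ge> M \<Longrightarrow> norm (X m - X n) < e / (2 * C)"
      using CauchyD[OF X, of "e / (2 * C)"] e C by auto
    obtain N where N: "\<And>m n. m \<ge> N \<Longrightarrow> n \<ge> N \<Longrightarrow> norm (Y m - Y n) < e / (2 * B)"
      using CauchyD[OF Y, of "e / (2 * B)"] e B by auto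
    have "norm (cinner (X m) (Y m) - cinner (X n) (Y n)) < e" if mn: "m \<ge> max M N" "n \<ge> max M N" for m n
    proof -
      have "cinner (X m) (Y m) - cinner (X n) (Y n) = cinner (X m - X n) (Y m) + cinner (X n) (Y m - Y n)"
        by (simp add: cinner_diff_left cinner_diff_right)
      then have "norm (cinner (X m) (Y m) - cinner (X n) (Y n))
          \<le> norm (X m - X n) * norm (Y m) + norm (X n) * norm (Y m - Y n)"
        using norm_triangle_le[OF add_mono[OF cauchy_schwarz cauchy_schwarz]] by metis
      also have "norm (X m - X n) * norm (Y m) \<le> norm (X m - X n) * C"
        by (rule mult_left_mono) (use C in auto)
      also have "norm (X m - X n) * C < e / (2 * C) * C"
        by (rule mult_strict_right_mono) (use M mn C in auto)
      also have "norm (X n) * norm (Y m - Y n) \<le> B * norm (Y m - Y n)"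
        by (rule mult_right_mono) (use B in auto)
      also have "B * norm (Y m - Y n) < B * (e / (2 * B))"
        by (rule mult_strict_left_mono) (use N mn B in auto)
      also have "e / (2 * C) * C + B * (e / (2 * B)) = e" using B C by simp
      finally show ?thesis by simp
    qed
    then show "\<exists>M. \<forall>m\<ge>M. \<forall>n\<ge>M. norm (cinner (X m) (Y m) - cinner (X n) (Y n)) < e" by blast
  qed
  then show ?thesis by (rule Cauchy_convergent)
qed

lemma cinner_null_left:
  fixes X Y :: "nat \<Rightarrow> 'a::cinner_space"
  assumes X: "X \<longlonglongrightarrow> 0" and Y: "Cauchy Y"
  shows "(\<lambda>n. cinner (X n) (Y n)) \<longlonglongrightarrow> 0"
proof -
  obtain C where C: "C > 0" "\<And>n. norm (Y n) \<le> C" using Cauchy_Bseq[OF Y] by (auto simp: Bseq_def)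
  have "norm (cinner (X n) (Y n)) \<le> norm (X n) * C" for n
    using cauchy_schwarz[of "X n" "Y n"] mult_left_mono[OF C(2)[of n], of "norm (X n)"] by simp
  moreover have "(\<lambda>n. norm (X n) * C) \<longlonglongrightarrow> 0"
    using tendsto_mult_left_zero[OF tendsto_norm_zero[OF X]] .
  ultimately show ?thesis
    using Lim_null_comparison[of "\<lambda>n. cinner (X n) (Y n)" "\<lambda>n. norm (X n) * C" sequentially] by simp
qed

lemma lim_cinner_equiv:
  assumes X: "cauchy_equiv X X'" and Y: "cauchy_equiv Y Y'"
  shows "lim (\<lambda>n. cinner (X n) (Y n)) = lim (\<lambda>n. cinner (X' n) (Y' n))"
proof -
  have *: "(\<lambda>n. cinner (X n - X' n) (Y n)) \<longlonglongrightarrow> 0"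
    using X Y by (intro cinner_null_left) (auto simp: cauchy_equiv_def)
  have "(\<lambda>n. cinner (Y n - Y' n) (X' n)) \<longlonglongrightarrow> 0"
    using X Y by (intro cinner_null_left) (auto simp: cauchy_equiv_def)
  then have "(\<lambda>n. cnj (cinner (Y n - Y' n) (X' n))) \<longlonglongrightarrow> cnj 0"
    by (rule tendsto_cnj)
  then have "(\<lambda>n. cinner (X' n) (Y n - Y' n)) \<longlonglongrightarrow> 0"
    by (subst cinner_commute) simp
  from tendsto_add[OF * this]
  have "(\<lambda>n. cinner (X n) (Y n) - cinner (X' n) (Y' n)) \<longlonglongrightarrow> 0"
    by (simp add: cinner_diff_left cinner_diff_right)
  moreover have "(\<lambda>n. cinner (X' n) (Y' n)) \<longlonglongrightarrow> lim (\<lambda>n. cinner (X' n) (Y' n))"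
    using convergent_cinner[of X' Y'] X Y by (simp add: convergent_LIMSEQ_iff cauchy_equiv_def)
  ultimately have "(\<lambda>n. cinner (X n) (Y n)) \<longlonglongrightarrow> lim (\<lambda>n. cinner (X' n) (Y' n))"
    using tendsto_add[of "\<lambda>n. cinner (X n) (Y n) - cinner (X' n) (Y' n)" 0 sequentially
        "\<lambda>n. cinner (X' n) (Y' n)"] by simp
  then show ?thesis by (rule limI)
qed

instantiation completion :: (cinner_space) ab_group_add
begin

lift_definition zero_completion :: "'a completion" is "\<lambda>n. 0"
  by (simp add: cauchy_equiv_def Cauchy_const)

lift_definition plus_completion :: "'a completion \<Rightarrow> 'a completion \<Rightarrow> 'a completion"
  is "\<lambda>X Y n. X n + Y n"
proof -
  fix X X' Y Y' :: "nat \<Rightarrow> 'a"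
  assume "cauchy_equiv X X'" "cauchy_equiv Y Y'"
  then show "cauchy_equiv (\<lambda>n. X n + Y n) (\<lambda>n. X' n + Y' n)"
    using tendsto_add[of "\<lambda>n. X n - X' n" 0 sequentially "\<lambda>n. Y n - Y' n" 0]
    by (simp add: cauchy_equiv_def Cauchy_add_seq algebra_simps)
qed

lift_definition uminus_completion :: "'a completion \<Rightarrow> 'a completion" is "\<lambda>X n. - X n"
proof -
  fix X X' :: "nat \<Rightarrow> 'a"
  assume "cauchy_equiv X X'"
  then show "cauchy_equiv (\<lambda>n. - X n) (\<lambda>n. - X' n)"
    using tendsto_minus[of "\<lambda>n. X n - X' n" 0 sequentially] Cauchy_scaleC_seq[of X "-1"]
      Cauchy_scaleC_seq[of X' "-1"]
    by (simp add: cauchy_equiv_def scaleC_minus_one)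
qed

definition minus_completion :: "'a completion \<Rightarrow> 'a completion \<Rightarrow> 'a completion"
  where "minus_completion x y = x + - y"

instance
proof
  fix a b c :: "'a completion"
  show "a + b + c = a + (b + c)"
    by transfer (simp add: cauchy_equiv_def Cauchy_add_seq add.assoc)
  show "a + b = b + a"
    by transfer (simp add: cauchy_equiv_def Cauchy_add_seq add.commute)
  show "0 + a = a"
    by transfer (simp add: cauchy_equiv_def)
  show "- a + a = 0"
    by transfer (simp add: cauchy_equiv_def Cauchy_const)
  show "a - b = a + - b" by (rule minus_completion_def)
qed

end

instantiation completion :: (cinner_space) cinner_space
begin

lift_definition scaleC_completion :: "complex \<Rightarrow> 'a completion \<Rightarrow> 'a completion"
  is "\<lambda>c X n. c *\<^sub>C X n"
proof -
  fix c and X X' :: "nat \<Rightarrow> 'a"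
  assume X: "cauchy_equiv X X'"
  have "(\<lambda>n. c *\<^sub>C (X n - X' n)) \<longlonglongrightarrow> c *\<^sub>C 0"
    using X by (intro bounded_linear.tendsto[OF bounded_linear_scaleC]) (simp add: cauchy_equiv_def)
  then show "cauchy_equiv (\<lambda>n. c *\<^sub>C X n) (\<lambda>n. c *\<^sub>C X' n)"
    using X by (simp add: cauchy_equiv_def Cauchy_scaleC_seq scaleC_diff_right)
qed

lift_definition cinner_completion :: "'a completion \<Rightarrow> 'a completion \<Rightarrow> complex"
  is "\<lambda>X Y. lim (\<lambda>n. cinner (X n) (Y n))"
  by (rule lim_cinner_equiv)

definition scaleR_completion :: "real \<Rightarrow> 'a completion \<Rightarrow> 'a completion"
  where "scaleR_completion r x = complex_of_real r *\<^sub>C x"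

definition norm_completion :: "'a completion \<Rightarrow> real"
  where "norm_completion x = sqrt (Re (cinner x x))"

definition sgn_completion :: "'a completion \<Rightarrow> 'a completion"
  where "sgn_completion x = inverse (norm x) *\<^sub>R x"

definition dist_completion :: "'a completion \<Rightarrow> 'a completion \<Rightarrow> real"
  where "dist_completion x y = norm (x - y)"

definition uniformity_completion :: "('a completion \<times> 'a completion) filter"
  where "uniformity_completion = (INF e\<in>{0<..}. principal {(x, y). dist x y < e})"

definition open_completion :: "'a completion set \<Rightarrow> bool"
  where "open_completion U = (\<forall>x\<in>U. eventually (\<lambda>(x', y). x' = x \<longrightarrow> y \<in> U) uniformity)"

instance
proof
  fix r s :: real and c d :: complex and S T U :: "'a completion"
  show add: "cinner (S + T) U = cinner S U + cinner T U" for S T U :: "'a completion"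
  proof transfer
    fix X Y Z :: "nat \<Rightarrow> 'a" assume "cauchy_equiv X X" "cauchy_equiv Y Y" "cauchy_equiv Z Z"
    then show "lim (\<lambda>n. cinner (X n + Y n) (Z n)) = lim (\<lambda>n. cinner (X n) (Z n)) + lim (\<lambda>n. cinner (Y n) (Z n))"
      by (intro limI) (auto simp: cinner_add_left cauchy_equiv_def convergent_LIMSEQ_iff[symmetric]
        intro!: tendsto_add convergent_cinner)
  qed
  show scl: "cinner (c *\<^sub>C S) T = c * cinner S T" for c and S T :: "'a completion"
  proof transfer
    fix c and X Y :: "nat \<Rightarrow> 'a" assume "cauchy_equiv X X" "cauchy_equiv Y Y"
    then show "lim (\<lambda>n. cinner (c *\<^sub>C X n) (Y n)) = c * lim (\<lambda>n. cinner (X n) (Y n))"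
      by (intro limI) (auto simp: cinner_scaleC_left cauchy_equiv_def convergent_LIMSEQ_iff[symmetric]
        intro!: tendsto_mult_left convergent_cinner)
  qed
  show com: "cinner S T = cnj (cinner T S)" for S T :: "'a completion"
  proof transfer
    fix X Y :: "nat \<Rightarrow> 'a" assume XY: "cauchy_equiv X X" "cauchy_equiv Y Y"
    then have "(\<lambda>n. cnj (cinner (Y n) (X n))) \<longlonglongrightarrow> cnj (lim (\<lambda>n. cinner (Y n) (X n)))"
      by (intro tendsto_cnj)
        (auto simp: cauchy_equiv_def convergent_LIMSEQ_iff[symmetric] intro!: convergent_cinner)
    moreover have "cnj (cinner (Y n) (X n)) = cinner (X n) (Y n)" for n
      by (rule cinner_commute[symmetric])
    ultimately show "lim (\<lambda>n. cinner (X n) (Y n)) = cnj (lim (\<lambda>n. cinner (Y n) (X n)))"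
      by (intro limI) simp
  qed
  have pos: "0 \<le> Re (cinner T T)" for T :: "'a completion"
  proof transfer
    fix X :: "nat \<Rightarrow> 'a" assume "cauchy_equiv X X"
    then have "(\<lambda>n. Re (cinner (X n) (X n))) \<longlonglongrightarrow> Re (lim (\<lambda>n. cinner (X n) (X n)))"
      by (intro tendsto_Re)
        (auto simp: cauchy_equiv_def convergent_LIMSEQ_iff[symmetric] intro!: convergent_cinner)
    then show "0 \<le> Re (lim (\<lambda>n. cinner (X n) (X n)))"
      by (rule LIMSEQ_le_const) (simp add: cinner_self)
  qed
  have real: "Im (cinner T T) = 0" for T :: "'a completion"
    using com[of T T] by (metis Reals_cnj_iff complex_is_Real_iff)
  show self: "cinner T T = complex_of_real ((norm T)\<^sup>2)" for T :: "'a completion"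
    using pos[of T] real[of T] by (simp add: norm_completion_def complex_eq_iff)
  show sadd: "c *\<^sub>C (S + T) = c *\<^sub>C S + c *\<^sub>C T" for c and S T :: "'a completion"
    by transfer (simp add: scaleC_add_right cauchy_equiv_def Cauchy_add_seq Cauchy_scaleC_seq)
  show saddl: "(c + d) *\<^sub>C S = c *\<^sub>C S + d *\<^sub>C S" for c d and S :: "'a completion"
    by transfer (simp add: scaleC_add_left cauchy_equiv_def Cauchy_add_seq Cauchy_scaleC_seq)
  show ss: "c *\<^sub>C d *\<^sub>C S = (c * d) *\<^sub>C S" for c d and S :: "'a completion"
    by transfer (simp add: scaleC_scaleC cauchy_equiv_def Cauchy_scaleC_seq)
  have one: "1 *\<^sub>C S = S" for S :: "'a completion"
    by transfer simp
  show "r *\<^sub>R S = complex_of_real r *\<^sub>C S" by (rule scaleR_completion_def)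
  show "r *\<^sub>R (S + T) = r *\<^sub>R S + r *\<^sub>R T" "(r + s) *\<^sub>R S = r *\<^sub>R S + s *\<^sub>R S"
    "r *\<^sub>R s *\<^sub>R S = (r * s) *\<^sub>R S" "1 *\<^sub>R S = S"
    by (simp_all add: scaleR_completion_def sadd saddl ss one)
  show "(norm S = 0) = (S = 0)"
  proof
    assume "norm S = 0"
    then have "cinner S S = 0" by (simp add: self)
    then show "S = 0"
    proof transfer
      fix X :: "nat \<Rightarrow> 'a" assume X: "cauchy_equiv X X" and l: "lim (\<lambda>n. cinner (X n) (X n)) = 0"
      then have "(\<lambda>n. cinner (X n) (X n)) \<longlonglongrightarrow> 0"
        using convergent_cinner[of X X] by (simp add: cauchy_equiv_def convergent_LIMSEQ_iff)
      then have "(\<lambda>n. sqrt (cmod (cinner (X n) (X n)))) \<longlonglongrightarrow> sqrt 0"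
        by (intro tendsto_real_sqrt tendsto_norm_zero)
      then have "X \<longlonglongrightarrow> 0" by (simp add: cinner_self norm_power tendsto_norm_zero_iff)
      then show "cauchy_equiv X (\<lambda>n. 0)" using X by (simp add: cauchy_equiv_def Cauchy_const)
    qed
  next
    assume "S = 0"
    then show "norm S = 0" using add[of 0 0 0] by (simp add: norm_completion_def)
  qed
  show "norm (S + T) \<le> norm S + norm T"
    unfolding norm_completion_def
    by (rule pre_triangle[where ip = "cinner :: 'a completion \<Rightarrow> _ \<Rightarrow> complex" and s = scaleC])
      (fact add scl com pos)+
  show "norm (r *\<^sub>R S) = \<bar>r\<bar> * norm S"
  proof -
    have "cinner S (complex_of_real r *\<^sub>C S) = r * cinner S S"
      by (metis com complex_cnj_complex_of_real complex_cnj_mult scl)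
    then have "cinner (r *\<^sub>R S) (r *\<^sub>R S) = complex_of_real (r * r) * cinner S S"
      by (simp add: scaleR_completion_def scl)
    then have "Re (cinner (r *\<^sub>R S) (r *\<^sub>R S)) = r\<^sup>2 * Re (cinner S S)"
      by (simp add: power2_eq_square)
    then show ?thesis by (simp add: norm_completion_def real_sqrt_mult)
  qed
qed (rule sgn_completion_def dist_completion_def uniformity_completion_def open_completion_def)+

end

lift_definition cembed :: "'a::cinner_space \<Rightarrow> 'a completion" is "\<lambda>x n. x"
  by (simp add: cauchy_equiv_def Cauchy_const)

lemma cembed_add: "cembed (x + y) = cembed x + cembed y"
  by transfer (simp add: cauchy_equiv_def Cauchy_const)

lemma cembed_scaleC: "cembed (c *\<^sub>C x) = c *\<^sub>C cembed x"
  by transfer (simp add: cauchy_equiv_def Cauchy_const)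

lemma cembed_diff: "cembed (x - y) = cembed x - cembed y"
  using cembed_add[of "x - y" y] by simp

lemma cinner_cembed: "cinner (cembed x) (cembed y) = cinner x y"
  by transfer simp

lemma norm_cembed: "norm (cembed x) = norm x"
  by (simp only: norm_eq_sqrt_cinner cinner_cembed)

lemma completion_limit:
  assumes X: "Cauchy X"
  shows "(\<lambda>n. cembed (X n)) \<longlonglongrightarrow> abs_completion X"
proof (rule metric_LIMSEQ_I)
  have nrm: "(\<lambda>k. norm (Y k)) \<longlonglongrightarrow> norm (abs_completion Y)" if Y: "Cauchy Y" for Y :: "nat \<Rightarrow> 'a"
  proof -
    have "(\<lambda>n. cinner (Y n) (Y n)) \<longlonglongrightarrow> cinner (abs_completion Y) (abs_completion Y)"
      using convergent_cinner[OF Y Y] Y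
      by (subst cinner_completion.abs_eq) (auto simp: cauchy_equiv_def convergent_LIMSEQ_iff)
    from tendsto_real_sqrt[OF tendsto_Re[OF this]] show ?thesis by (simp add: cinner_self)
  qed
  fix r :: real assume "r > 0"
  then obtain N where N: "\<And>m n. m \<ge> N \<Longrightarrow> n \<ge> N \<Longrightarrow> norm (X m - X n) < r / 2"
    using CauchyD[OF X, of "r / 2"] by auto
  have "dist (cembed (X n)) (abs_completion X) < r" if n: "n \<ge> N" for n
  proof -
    have c: "Cauchy (\<lambda>k. X n + (- 1) *\<^sub>C X k)"
      by (intro Cauchy_add_seq Cauchy_const Cauchy_scaleC_seq X)
    have "cembed (X n) - abs_completion X = cembed (X n) + (- 1) *\<^sub>C abs_completion X"
      by (simp add: scaleC_minus_one)
    also have "\<dots> = abs_completion (\<lambda>k. X n + (- 1) *\<^sub>C X k)"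
      using X by (simp add: cembed.abs_eq scaleC_completion.abs_eq plus_completion.abs_eq
          cauchy_equiv_def Cauchy_const Cauchy_scaleC_seq)
    finally have e: "cembed (X n) - abs_completion X = abs_completion (\<lambda>k. X n + (- 1) *\<^sub>C X k)" .
    have "(\<lambda>k. norm (X n + (- 1) *\<^sub>C X k)) \<longlonglongrightarrow> norm (cembed (X n) - abs_completion X)"
      unfolding e by (rule nrm[OF c])
    moreover have "norm (X n + (- 1) *\<^sub>C X k) \<le> r / 2" if "k \<ge> N" for k
      using N[OF n that] by (simp add: scaleC_minus_one)
    ultimately have "norm (cembed (X n) - abs_completion X) \<le> r / 2"
      by (intro LIMSEQ_le_const2) auto
    then show ?thesis using \<open>r > 0\<close> by (simp add: dist_norm)
  qed
  then show "\<exists>N. \<forall>n\<ge>N. dist (cembed (X n)) (abs_completion X) < r" by blast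
qed

lemma completion_cases: "\<exists>X. Cauchy X \<and> x = abs_completion X"
  by (rule completion.abs_induct[where x = x]) (auto simp: cauchy_equiv_def)

lemma closure_range_cembed: "closure (range cembed) = UNIV"
proof -
  have "x \<in> closure (range cembed)" for x :: "'a completion"
  proof -
    obtain X where X: "Cauchy X" "x = abs_completion X" using completion_cases by blast
    show ?thesis unfolding closure_sequential X(2)
      by (rule exI[of _ "\<lambda>n. cembed (X n)"]) (simp add: completion_limit[OF X(1)])
  qed
  then show ?thesis by blast
qed

instance completion :: (cinner_space) chilbert_space
proof
  fix A :: "nat \<Rightarrow> 'a completion" assume A: "Cauchy A"
  have "\<exists>x. dist (cembed x) (A n) < 1 / Suc n" for n
  proof -
    have "A n \<in> closure (range cembed)" by (simp add: closure_range_cembed)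
    then have "\<exists>y\<in>range cembed. dist y (A n) < 1 / Suc n"
      unfolding closure_approachable by simp
    then show ?thesis by blast
  qed
  then obtain x where x: "\<And>n. dist (cembed (x n)) (A n) < 1 / Suc n" by metis
  have dx: "(\<lambda>n. cembed (x n) - A n) \<longlonglongrightarrow> 0"
  proof (rule Lim_null_comparison)
    show "\<forall>\<^sub>F n in sequentially. norm (cembed (x n) - A n) \<le> 1 / Suc n"
      using x by (auto simp: dist_norm intro: less_imp_le always_eventually)
    show "(\<lambda>n. 1 / Suc n) \<longlonglongrightarrow> 0" by (rule lim_inverse_n'[THEN LIMSEQ_Suc])
  qed
  have "Cauchy (\<lambda>n. (cembed (x n) - A n) + A n)"
    by (intro Cauchy_add_seq A convergent_Cauchy) (use dx in \<open>auto simp: convergent_def\<close>)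
  then have "Cauchy x"
    by (simp add: Cauchy_def dist_norm cembed_diff[symmetric] norm_cembed)
  from tendsto_diff[OF completion_limit[OF this] dx]
  show "convergent A" by (auto simp: convergent_def)
qed

type_synonym ('a, 'b) htensor = "('a, 'b) finrank completion"

definition tensor :: "'a::cinner_space \<Rightarrow> 'b::cinner_space \<Rightarrow> ('a, 'b) htensor"
  where "tensor x y = cembed (rank_one x y)"

lemma cinner_tensor: "cinner (tensor f1 f2) (tensor g1 g2) = cnj (cinner f1 g1) * cinner f2 g2"
  by (simp add: tensor_def cinner_cembed cinner_rank_one)


section \<open>Frames\<close>

definition analysis :: "('i \<Rightarrow> 'h::cinner_space) \<Rightarrow> 'h \<Rightarrow> 'i \<Rightarrow> complex"
  where "analysis \<psi> f = (\<lambda>i. cinner f (\<psi> i))"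

definition synthesis :: "('i \<Rightarrow> 'h::cinner_space) \<Rightarrow> ('i \<Rightarrow> complex) \<Rightarrow> 'h"
  where "synthesis \<psi> c = (\<Sum>\<^sub>\<infinity>i. c i *\<^sub>C \<psi> i)"

definition frame :: "('i \<Rightarrow> 'h::cinner_space) \<Rightarrow> bool"
  where "frame \<psi> \<longleftrightarrow> (\<exists>A>0. \<exists>B>0. \<forall>f.
    (\<lambda>i. (cmod (analysis \<psi> f i))\<^sup>2) summable_on UNIV \<and>
    A * (norm f)\<^sup>2 \<le> (\<Sum>\<^sub>\<infinity>i. (cmod (analysis \<psi> f i))\<^sup>2) \<and>
    (\<Sum>\<^sub>\<infinity>i. (cmod (analysis \<psi> f i))\<^sup>2) \<le> B * (norm f)\<^sup>2)"

definition frame_op :: "('i \<Rightarrow> 'h::cinner_space) \<Rightarrow> 'h \<Rightarrow> 'h"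
  where "frame_op \<psi> = synthesis \<psi> \<circ> analysis \<psi>"

definition canonical_dual :: "('i \<Rightarrow> 'h::cinner_space) \<Rightarrow> 'i \<Rightarrow> 'h"
  where "canonical_dual \<psi> i = inv (frame_op \<psi>) (\<psi> i)"

definition gram :: "('i \<Rightarrow> 'h::cinner_space) \<Rightarrow> 'i \<Rightarrow> 'i \<Rightarrow> complex"
  where "gram \<psi> i i' = cinner (\<psi> i') (\<psi> i)"

definition tensor_frame ::
  "('i \<Rightarrow> 'a::cinner_space) \<Rightarrow> ('j \<Rightarrow> 'b::cinner_space) \<Rightarrow> 'i \<times> 'j \<Rightarrow> ('a, 'b) htensor"
  where "tensor_frame \<psi>1 \<psi>2 = (\<lambda>(i, j). tensor (\<psi>1 i) (\<psi>2 j))"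


section \<open>Weighted sequence spaces and localisation\<close>

definition lp :: "ereal \<Rightarrow> ('i \<Rightarrow> complex) set"
  where "lp p = {c. if p = \<infinity> then bdd_above (range (\<lambda>i. cmod (c i)))
    else (\<lambda>i. cmod (c i) powr real_of_ereal p) summable_on UNIV}"

definition lp_norm :: "ereal \<Rightarrow> ('i \<Rightarrow> complex) \<Rightarrow> real"
  where "lp_norm p c = (if p = \<infinity> then SUP i. cmod (c i)
    else (\<Sum>\<^sub>\<infinity>i. cmod (c i) powr real_of_ereal p) powr (1 / real_of_ereal p))"

definition lpw :: "ereal \<Rightarrow> ('i \<Rightarrow> real) \<Rightarrow> ('i \<Rightarrow> complex) set"
  where "lpw p w = {c. (\<lambda>i. c i * complex_of_real (w i)) \<in> lp p}"

definition lpw_norm :: "ereal \<Rightarrow> ('i \<Rightarrow> real) \<Rightarrow> ('i \<Rightarrow> complex) \<Rightarrow> real"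
  where "lpw_norm p w c = lp_norm p (\<lambda>i. c i * complex_of_real (w i))"

definition recip :: "('i \<Rightarrow> real) \<Rightarrow> 'i \<Rightarrow> real"
  where "recip w = (\<lambda>i. 1 / w i)"

definition tensor_weight :: "('i \<Rightarrow> real) \<Rightarrow> ('j \<Rightarrow> real) \<Rightarrow> 'i \<times> 'j \<Rightarrow> real"
  where "tensor_weight w1 w2 = (\<lambda>(i, j). w1 i * w2 j)"

type_synonym 'i matrix = "'i \<Rightarrow> 'i \<Rightarrow> complex"

definition mat_app :: "'i matrix \<Rightarrow> ('i \<Rightarrow> complex) \<Rightarrow> 'i \<Rightarrow> complex"
  where "mat_app A c i = (\<Sum>\<^sub>\<infinity>j. A i j * c j)"

definition mat_mult :: "'i matrix \<Rightarrow> 'i matrix \<Rightarrow> 'i matrix"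
  where "mat_mult A B i j = (\<Sum>\<^sub>\<infinity>k. A i k * B k j)"

definition mat_one :: "'i matrix"
  where "mat_one i j = (if i = j then 1 else 0)"

definition mat_adj :: "'i matrix \<Rightarrow> 'i matrix"
  where "mat_adj A i j = cnj (A j i)"

definition bounded_mat :: "ereal \<Rightarrow> ('i \<Rightarrow> real) \<Rightarrow> 'i matrix \<Rightarrow> bool"
  where "bounded_mat p w A \<longleftrightarrow>
    (\<forall>c\<in>lpw p w. \<forall>i. (\<lambda>j. A i j * c j) summable_on UNIV) \<and>
    (\<exists>M. \<forall>c\<in>lpw p w. mat_app A c \<in> lpw p w \<and> lpw_norm p w (mat_app A c) \<le> M * lpw_norm p w c)"

text \<open>Banach algebras are taken to be unital, with the identity matrix as unit. Otherwise
  inverse-closedness can be vacuous, the canonical dual of a localised frame need not be localised,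
  and the norm of a co-orbit space can be infinite on elements of the frame. In \<open>inverse_closed\<close> the inverse in \<open>B(\<ell>\<^sup>2)\<close> is given by
  its matrix, as every bounded operator on \<open>\<ell>\<^sup>2\<close> has one.\<close>

locale spectral_matrix_algebra =
  fixes \<A> :: "'i matrix set" and N :: "'i matrix \<Rightarrow> real"
  assumes one: "mat_one \<in> \<A>"
    and add: "\<lbrakk>A \<in> \<A>; B \<in> \<A>\<rbrakk> \<Longrightarrow> (\<lambda>i j. A i j + B i j) \<in> \<A>"
    and scale: "A \<in> \<A> \<Longrightarrow> (\<lambda>i j. c * A i j) \<in> \<A>"
    and mult: "\<lbrakk>A \<in> \<A>; B \<in> \<A>\<rbrakk> \<Longrightarrow> mat_mult A B \<in> \<A>"
    and adj: "A \<in> \<A> \<Longrightarrow> mat_adj A \<in> \<A>"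
    and norm_nonneg: "A \<in> \<A> \<Longrightarrow> 0 \<le> N A"
    and norm_eq_0: "A \<in> \<A> \<Longrightarrow> N A = 0 \<longleftrightarrow> A = (\<lambda>i j. 0)"
    and norm_add: "\<lbrakk>A \<in> \<A>; B \<in> \<A>\<rbrakk> \<Longrightarrow> N (\<lambda>i j. A i j + B i j) \<le> N A + N B"
    and norm_scale: "A \<in> \<A> \<Longrightarrow> N (\<lambda>i j. c * A i j) = cmod c * N A"
    and norm_mult: "\<lbrakk>A \<in> \<A>; B \<in> \<A>\<rbrakk> \<Longrightarrow> N (mat_mult A B) \<le> N A * N B"
    and norm_adj: "A \<in> \<A> \<Longrightarrow> N (mat_adj A) = N A"
    and complete: "\<lbrakk>\<And>n. X n \<in> \<A>; \<And>e. e > 0 \<Longrightarrow> \<exists>n0. \<forall>m\<ge>n0. \<forall>n\<ge>n0. N (\<lambda>i j. X m i j - X n i j) < e\<rbrakk>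
      \<Longrightarrow> \<exists>A\<in>\<A>. (\<lambda>n::nat. N (\<lambda>i j. X n i j - A i j)) \<longlonglongrightarrow> 0"
    and bounded_l2: "A \<in> \<A> \<Longrightarrow> bounded_mat 2 (\<lambda>i. 1) A"
    and inverse_closed: "\<lbrakk>A \<in> \<A>; bounded_mat 2 (\<lambda>i. 1) B;
      \<And>c. c \<in> lp 2 \<Longrightarrow> mat_app A (mat_app B c) = c \<and> mat_app B (mat_app A c) = c\<rbrakk> \<Longrightarrow> B \<in> \<A>"
    and solid: "\<lbrakk>A \<in> \<A>; \<And>i j. cmod (B i j) \<le> cmod (A i j)\<rbrakk> \<Longrightarrow> B \<in> \<A> \<and> N B \<le> N A"

definition localised_frame :: "'i matrix set \<Rightarrow> ('i \<Rightarrow> 'h::cinner_space) \<Rightarrow> bool"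
  where "localised_frame \<A> \<psi> \<longleftrightarrow> frame \<psi> \<and> gram \<psi> \<in> \<A>"

definition admissible_weight :: "'i matrix set \<Rightarrow> ('i \<Rightarrow> real) \<Rightarrow> bool"
  where "admissible_weight \<A> w \<longleftrightarrow>
    (\<forall>i. 0 < w i) \<and> (\<forall>A\<in>\<A>. \<forall>p\<ge>1. bounded_mat p w A)"


section \<open>Normed spaces on carrier sets\<close>

text \<open>The co-orbit spaces depend on a frame and a weight, so they are not types.\<close>

record 'v cnormed =
  carr :: "'v set"
  vzero :: 'v
  vadd :: "'v \<Rightarrow> 'v \<Rightarrow> 'v"
  vscale :: "complex \<Rightarrow> 'v \<Rightarrow> 'v"
  vnorm :: "'v \<Rightarrow> real"

definition lin_map :: "'u cnormed \<Rightarrow> 'v cnormed \<Rightarrow> ('u \<Rightarrow> 'v) \<Rightarrow> bool"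
  where "lin_map X Y T \<longleftrightarrow> T \<in> carr X \<rightarrow> carr Y \<and>
    (\<forall>x\<in>carr X. \<forall>y\<in>carr X. T (vadd X x y) = vadd Y (T x) (T y)) \<and>
    (\<forall>c. \<forall>x\<in>carr X. T (vscale X c x) = vscale Y c (T x))"

definition lin_iso :: "'u cnormed \<Rightarrow> 'v cnormed \<Rightarrow> ('u \<Rightarrow> 'v) \<Rightarrow> bool"
  where "lin_iso X Y T \<longleftrightarrow> lin_map X Y T \<and> bij_betw T (carr X) (carr Y)"

text \<open>The space \<open>B(X, Y)\<close> with the operator norm. Operators are extensional, that is, undefined
  outside the carrier of \<open>X\<close>, so that equal operators are equal functions.\<close>

definition bounded_ops :: "'u cnormed \<Rightarrow> 'v cnormed \<Rightarrow> ('u \<Rightarrow> 'v) cnormed"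
  where "bounded_ops X Y = \<lparr>
    carr = {T \<in> extensional (carr X). lin_map X Y T \<and>
      (\<exists>M. \<forall>x\<in>carr X. vnorm Y (T x) \<le> M * vnorm X x)},
    vzero = (\<lambda>x\<in>carr X. vzero Y),
    vadd = (\<lambda>S T. \<lambda>x\<in>carr X. vadd Y (S x) (T x)),
    vscale = (\<lambda>c T. \<lambda>x\<in>carr X. vscale Y c (T x)),
    vnorm = (\<lambda>T. Inf {M. 0 \<le> M \<and> (\<forall>x\<in>carr X. vnorm Y (T x) \<le> M * vnorm X x)})\<rparr>"

definition vsum :: "'v cnormed \<Rightarrow> (nat \<Rightarrow> 'v) \<Rightarrow> nat set \<Rightarrow> 'v"
  where "vsum X v F = foldr (\<lambda>r. vadd X (v r)) (sorted_list_of_set F) (vzero X)"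

text \<open>Unconditional convergence in norm of the series \<open>(v r)\<close> indexed by \<open>R\<close>.\<close>

definition has_vsum :: "'v cnormed \<Rightarrow> (nat \<Rightarrow> 'v) \<Rightarrow> nat set \<Rightarrow> 'v \<Rightarrow> bool"
  where "has_vsum X v R s \<longleftrightarrow> (\<forall>e>0. \<exists>F0. finite F0 \<and> F0 \<subseteq> R \<and>
    (\<forall>F. finite F \<and> F0 \<subseteq> F \<and> F \<subseteq> R \<longrightarrow> vnorm X (vadd X s (vscale X (- 1) (vsum X v F))) < e))"


section \<open>Co-orbit spaces\<close>

text \<open>The quotient of a space \<open>V\<close> of sequences by an equivalence relation \<open>r\<close> whose null class is a
  subspace. The image under \<open>r\<close> is taken because \<open>{c f | f \<in> F}\<close> is not a full class for \<open>c = 0\<close>.\<close>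

definition seq_quotient :: "(nat \<Rightarrow> 'h::cinner_space) set \<Rightarrow> (nat \<Rightarrow> 'h) rel
    \<Rightarrow> ((nat \<Rightarrow> 'h) set \<Rightarrow> real) \<Rightarrow> (nat \<Rightarrow> 'h) set cnormed"
  where "seq_quotient V r \<nu> = \<lparr>
    carr = V // r,
    vzero = r `` {\<lambda>n. 0},
    vadd = (\<lambda>F G. r `` {\<lambda>n. f n + g n | f g. f \<in> F \<and> g \<in> G}),
    vscale = (\<lambda>c F. r `` {\<lambda>n. c *\<^sub>C f n | f. f \<in> F}),
    vnorm = \<nu>\<rparr>"

definition rep_seq :: "(nat \<Rightarrow> 'h) set \<Rightarrow> nat \<Rightarrow> 'h"
  where "rep_seq F = (SOME f. f \<in> F)"

text \<open>The extension of \<open>analysis \<phi>\<close> to classes of sequences: by continuity on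
  \<open>\<H>\<^sup>p\<close> with \<open>p < \<infinity>\<close>, by limits on \<open>\<H>\<^sup>\<infinity>\<close>.\<close>

definition ext_analysis :: "('i \<Rightarrow> 'h::cinner_space) \<Rightarrow> (nat \<Rightarrow> 'h) set \<Rightarrow> 'i \<Rightarrow> complex"
  where "ext_analysis \<phi> F i = lim (\<lambda>n. analysis \<phi> (rep_seq F n) i)"

definition H00 :: "('i \<Rightarrow> 'h::cinner_space) \<Rightarrow> 'h set"
  where "H00 \<psi> = {\<Sum>i\<in>I. c i *\<^sub>C \<psi> i | I c. finite I}"

definition H00_norm :: "ereal \<Rightarrow> ('i \<Rightarrow> 'h::cinner_space) \<Rightarrow> ('i \<Rightarrow> real) \<Rightarrow> 'h \<Rightarrow> real"
  where "H00_norm p \<psi> w f = lpw_norm p w (analysis (canonical_dual \<psi>) f)"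

text \<open>For \<open>p < \<infinity>\<close>: the completion of \<open>H00 \<psi>\<close> by Cauchy sequences.\<close>

definition fin_seqs :: "ereal \<Rightarrow> ('i \<Rightarrow> 'h::cinner_space) \<Rightarrow> ('i \<Rightarrow> real) \<Rightarrow> (nat \<Rightarrow> 'h) set"
  where "fin_seqs p \<psi> w = {f. (\<forall>n. f n \<in> H00 \<psi>) \<and>
    (\<forall>e>0. \<exists>n0. \<forall>m\<ge>n0. \<forall>n\<ge>n0. H00_norm p \<psi> w (f m - f n) < e)}"

definition fin_rel :: "ereal \<Rightarrow> ('i \<Rightarrow> 'h::cinner_space) \<Rightarrow> ('i \<Rightarrow> real) \<Rightarrow> (nat \<Rightarrow> 'h) rel"
  where "fin_rel p \<psi> w = {(f, g). f \<in> fin_seqs p \<psi> w \<and> g \<in> fin_seqs p \<psi> w \<and>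
    (\<lambda>n. H00_norm p \<psi> w (f n - g n)) \<longlonglongrightarrow> 0}"

definition inf_seqs :: "('i \<Rightarrow> 'h::cinner_space) \<Rightarrow> ('i \<Rightarrow> real) \<Rightarrow> (nat \<Rightarrow> 'h) set"
  where "inf_seqs \<psi> w = {f.
    (\<forall>i. convergent (\<lambda>n. analysis (canonical_dual \<psi>) (f n) i)) \<and>
    (\<forall>n. analysis (canonical_dual \<psi>) (f n) \<in> lpw \<infinity> w) \<and>
    bdd_above (range (\<lambda>n. lpw_norm \<infinity> w (analysis (canonical_dual \<psi>) (f n))))}"

definition inf_rel :: "('i \<Rightarrow> 'h::cinner_space) \<Rightarrow> ('i \<Rightarrow> real) \<Rightarrow> (nat \<Rightarrow> 'h) rel"
  where "inf_rel \<psi> w = {(f, g). f \<in> inf_seqs \<psi> w \<and> g \<in> inf_seqs \<psi> w \<and>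
    (\<forall>i. (\<lambda>n. analysis (canonical_dual \<psi>) (f n - g n) i) \<longlonglongrightarrow> 0)}"

definition coorbit :: "ereal \<Rightarrow> ('i \<Rightarrow> 'h::cinner_space) \<Rightarrow> ('i \<Rightarrow> real) \<Rightarrow> (nat \<Rightarrow> 'h) set cnormed"
  where "coorbit p \<psi> w =
    (if p = \<infinity> then seq_quotient (inf_seqs \<psi> w) (inf_rel \<psi> w)
        (\<lambda>F. lpw_norm \<infinity> w (ext_analysis (canonical_dual \<psi>) F))
     else seq_quotient (fin_seqs p \<psi> w) (fin_rel p \<psi> w)
        (\<lambda>F. lim (\<lambda>n. H00_norm p \<psi> w (rep_seq F n))))"

definition pairing :: "('i \<Rightarrow> 'h::cinner_space) \<Rightarrow> (nat \<Rightarrow> 'h) set \<Rightarrow> (nat \<Rightarrow> 'h) set \<Rightarrow> complex"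
  where "pairing \<psi> F G = (\<Sum>\<^sub>\<infinity>i. ext_analysis (canonical_dual \<psi>) F i * cnj (ext_analysis \<psi> G i))"

definition coorbit_tensor :: "('i \<Rightarrow> 'a::cinner_space) \<Rightarrow> ('j \<Rightarrow> 'b::cinner_space) \<Rightarrow> ('i \<times> 'j \<Rightarrow> real)
    \<Rightarrow> (nat \<Rightarrow> 'a) set \<Rightarrow> (nat \<Rightarrow> 'b) set \<Rightarrow> (nat \<Rightarrow> ('a, 'b) htensor) set"
  where "coorbit_tensor \<psi>1 \<psi>2 w f1 f2 = (THE F.
    F \<in> carr (coorbit \<infinity> (tensor_frame \<psi>1 \<psi>2) w) \<and>
    (\<forall>i j. ext_analysis (canonical_dual (tensor_frame \<psi>1 \<psi>2)) F (i, j) =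
      cnj (ext_analysis (canonical_dual \<psi>1) f1 i) * ext_analysis (canonical_dual \<psi>2) f2 j))"


section \<open>Operators with a nuclear expansion\<close>

text \<open>Any countable index set is in bijection with a subset \<open>R\<close> of the natural numbers.\<close>

definition expandable :: "('i \<Rightarrow> 'a::cinner_space) \<Rightarrow> ('i \<Rightarrow> real) \<Rightarrow> ('j \<Rightarrow> 'b::cinner_space) \<Rightarrow> ('j \<Rightarrow> real)
    \<Rightarrow> ((nat \<Rightarrow> 'a) set \<Rightarrow> (nat \<Rightarrow> 'b) set) \<Rightarrow> bool"
  where "expandable \<psi>1 w1 \<psi>2 w2 T \<longleftrightarrow> (\<exists>(R::nat set) f g.
    (\<forall>r\<in>R. f r \<in> carr (coorbit 1 \<psi>1 w1) \<and> g r \<in> carr (coorbit 1 \<psi>2 w2)) \<and>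
    has_vsum (bounded_ops (coorbit \<infinity> \<psi>1 (recip w1)) (coorbit 1 \<psi>2 w2))
      (\<lambda>r. \<lambda>h\<in>carr (coorbit \<infinity> \<psi>1 (recip w1)). vscale (coorbit 1 \<psi>2 w2) (pairing \<psi>1 h (f r)) (g r)) R T \<and>
    (\<lambda>r. vnorm (coorbit 1 \<psi>1 w1) (f r) * vnorm (coorbit 1 \<psi>2 w2) (g r)) summable_on R)"

definition nuclear_ops :: "('i \<Rightarrow> 'a::cinner_space) \<Rightarrow> ('i \<Rightarrow> real) \<Rightarrow> ('j \<Rightarrow> 'b::cinner_space) \<Rightarrow> ('j \<Rightarrow> real)
    \<Rightarrow> ((nat \<Rightarrow> 'a) set \<Rightarrow> (nat \<Rightarrow> 'b) set) cnormed"
  where "nuclear_ops \<psi>1 w1 \<psi>2 w2 =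
    (let B = bounded_ops (coorbit \<infinity> \<psi>1 (recip w1)) (coorbit 1 \<psi>2 w2)
     in B\<lparr>carr := {T \<in> carr B. expandable \<psi>1 w1 \<psi>2 w2 T}\<rparr>)"

definition kernel_of :: "('i \<Rightarrow> 'a::cinner_space) \<Rightarrow> ('i \<Rightarrow> real) \<Rightarrow> ('j \<Rightarrow> 'b::cinner_space) \<Rightarrow> ('j \<Rightarrow> real)
    \<Rightarrow> (nat \<Rightarrow> ('a, 'b) htensor) set \<Rightarrow> ((nat \<Rightarrow> 'a) set \<Rightarrow> (nat \<Rightarrow> 'b) set) \<Rightarrow> bool"
  where "kernel_of \<psi>1 w1 \<psi>2 w2 K T \<longleftrightarrow>
    (\<forall>f1\<in>carr (coorbit \<infinity> \<psi>1 (recip w1)). \<forall>f2\<in>carr (coorbit \<infinity> \<psi>2 (recip w2)).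
      pairing (tensor_frame \<psi>1 \<psi>2) K
        (coorbit_tensor \<psi>1 \<psi>2 (recip (tensor_weight w1 w2)) f1 f2) =
      pairing \<psi>2 (T f1) f2)"

end

theory Submission
  imports Defs
begin

text \<open>Everything is decided on sequences of coefficients. Let \<open>\<phi>\<close> be the canonical dual of \<open>\<psi>\<close>, \<open>G\<close> the
Gram matrix of \<open>\<psi>\<close> and \<open>P\<close> the matrix of all \<open>\<langle>\<psi> j, \<phi> i\<rangle>\<close>, which is the orthogonal projection of
\<open>\<ell>\<^sup>2\<close> onto the range of the analysis operator. Taking coefficients with respect to \<open>\<phi>\<close> identifies
\<open>\<H>\<^sup>1\<^sub>w\<close> with the weighted \<open>\<ell>\<^sup>1\<close>-sequences fixed by \<open>P\<close>, and \<open>\<H>\<^sup>\<infinity>\<close> with weight \<open>1/w\<close> with the sequences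
\<open>d\<close> fixed by \<open>P\<close> that satisfy \<open>|d i| \<le> K w i\<close> (\<open>coorbit1\<close>, \<open>coorbit_inf\<close>); the pairing becomes
\<open>\<Sum>i. c i * cnj ((G d) i)\<close>. An element of the tensor co-orbit space is an array \<open>k\<close> that is summable
against \<open>w1 \<otimes> w2\<close> and is fixed by \<open>cnj P1 \<otimes> P2\<close>. The identity that ties \<open>K\<close> to \<open>O\<close> then leaves only
\<open>(O h) j = (\<Sum>i. k (i, j) * (G1 h) i)\<close>, the map \<open>\<Phi>\<close> below.

Read row by row, this formula is the expansion \<open>O = (\<Sum>i. \<langle>\<cdot>, \<psi>1 i\<rangle> k (i, \<cdot>))\<close>. It is nuclear because the norm
of \<open>\<psi>1 i\<close> is at most \<open>C * w1 i\<close> and \<open>k\<close> is summable (\<open>expandable_\<Phi>\<close>). Conversely an expansion with \<open>f r\<close> and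
\<open>g r\<close> is produced by the array \<open>\<Sum>r. cnj (f r i) * g r j\<close> (\<open>\<Phi>_surjective\<close>). Uniqueness on both sides follows
by testing with the elements of the dual frames, for \<open>G\<close> maps the coefficients of \<open>\<phi> k\<close> to column \<open>k\<close> of
\<open>P\<close>, and pairing with that column evaluates a \<open>P\<close>-fixed sequence at \<open>k\<close>.

All this rests on Schur bounds \<open>(\<Sum>i. |A i j| * w i) \<le> C * w j\<close> for three matrices: \<open>P\<close>, \<open>G\<close> and the Gram
matrix of \<open>\<phi>\<close>. Such bounds multiply under tensor products, and an admissible weight gives them for
every member of the matrix algebra (\<open>admissible_schur\<close>). So the algebra has to contain \<open>P\<close> and the
dual Gram matrix. On \<open>\<ell>\<^sup>2\<close> the spectrum of \<open>G\<close> lies in \<open>{0} \<union> [a, b]\<close>, with the frame bounds \<open>a\<close> and \<open>b\<close>,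
and \<open>1 - P\<close> is the Riesz projection for the isolated point 0. The resolvents on the circle of radius
\<open>a/2\<close> belong to the algebra since it is inverse-closed, and they depend on the point of the circle in a
Lipschitz way for the norm of the algebra, by the resolvent identity and compactness. Their averages
over the roots of unity of order \<open>2^n\<close> therefore converge in the algebra; entrywise they converge to
\<open>1 - P\<close>, as one sees from a geometric series. Solidity makes the entries continuous, so the two limits
agree (\<open>range_projection_mem\<close>). Finally \<open>G + 1 - P\<close> is invertible, and its inverse is \<open>1 - P\<close> plus the dual
Gram matrix (\<open>dual_gram_mem\<close>).\<close>

section \<open>Bounded complex-linear maps\<close>

text \<open>The predicate \<open>bounded_linear\<close> only records linearity over the reals.\<close>

definition clin :: "('h::cinner_space \<Rightarrow> 'k::cinner_space) \<Rightarrow> bool"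
  where "clin U \<longleftrightarrow> bounded_linear U \<and> (\<forall>c x. U (c *\<^sub>C x) = c *\<^sub>C U x)"

lemma clin_bounded_linear: "clin U \<Longrightarrow> bounded_linear U"
  and clin_scaleC: "clin U \<Longrightarrow> U (c *\<^sub>C x) = c *\<^sub>C U x"
  by (auto simp: clin_def)

lemma clin_add: "clin U \<Longrightarrow> U (x + y) = U x + U y"
  and clin_diff: "clin U \<Longrightarrow> U (x - y) = U x - U y"
  and clin_zero: "clin U \<Longrightarrow> U 0 = 0"
  and clin_minus: "clin U \<Longrightarrow> U (- x) = - U x"
  by (simp_all add: clin_def linear_simps)

lemma clin_bound: "clin U \<Longrightarrow> \<exists>K\<ge>0. \<forall>x. norm (U x) \<le> K * norm x"
  using bounded_linear.nonneg_bounded[OF clin_bounded_linear, of U] by (metis mult.commute)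

lemma clinI:
  fixes U :: "'h::cinner_space \<Rightarrow> 'k::cinner_space"
  assumes "\<And>x y. U (x + y) = U x + U y" and "\<And>c x. U (c *\<^sub>C x) = c *\<^sub>C U x"
    and "\<And>x. norm (U x) \<le> K * norm x"
  shows "clin U"
  unfolding clin_def
  by (auto intro!: bounded_linear_intro[where K = K] simp: assms scaleR_scaleC mult.commute[of _ K])

lemma clin_id: "clin (\<lambda>x. x)"
  by (rule clinI[where K = 1]) auto

lemma clin_compose: "clin U \<Longrightarrow> clin V \<Longrightarrow> clin (\<lambda>x. U (V x))"
  by (auto simp: clin_def intro: bounded_linear_compose)

lemma clin_sub: "clin U \<Longrightarrow> clin V \<Longrightarrow> clin (\<lambda>x. U x - V x)"
  by (auto simp: clin_def scaleC_diff_right intro: bounded_linear_sub)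

lemma clin_scale: "clin U \<Longrightarrow> clin (\<lambda>x. c *\<^sub>C U x)"
  by (auto simp: clin_def scaleC_scaleC mult.commute
      intro: bounded_linear_compose[OF bounded_linear_scaleC])

lemma clin_uminus: "clin U \<Longrightarrow> clin (\<lambda>x. - U x)"
  using clin_scale[of U "- 1"] by (simp add: scaleC_minus_left)

lemma scaleC_diff_left: "(c - d) *\<^sub>C x = c *\<^sub>C x - d *\<^sub>C (x::'h::cinner_space)"
  using scaleC_add_left[of "c - d" d x] by simp

lemma scaleC_sum_left: "(\<Sum>i\<in>A. c i) *\<^sub>C x = (\<Sum>i\<in>A. c i *\<^sub>C (x::'h::cinner_space))"
  by (induction A rule: infinite_finite_induct) (auto simp: scaleC_add_left)

lemma scaleC_minus_right: "c *\<^sub>C (- x) = - (c *\<^sub>C (x::'h::cinner_space))"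
  using scaleC_diff_right[of c 0 x] by simp

lemma clin_sum: "clin U \<Longrightarrow> U (\<Sum>i\<in>A. f i) = (\<Sum>i\<in>A. U (f i))"
  by (induction A rule: infinite_finite_induct) (auto simp: clin_add clin_zero)

lemma bounded_linear_cinner_left: "bounded_linear (\<lambda>x. cinner x (y::'h::cinner_space))"
  by (rule bounded_bilinear.bounded_linear_left[OF bounded_bilinear_cinner])

text \<open>Solving \<open>x - T x = y\<close> is a fixed-point problem for the contraction \<open>x \<mapsto> y + T x\<close>.\<close>

lemma contraction_bij:
  fixes T :: "'h::chilbert_space \<Rightarrow> 'h"
  assumes T: "clin T" and q: "0 \<le> q" "q < 1" and bd: "\<And>x. norm (T x) \<le> q * norm x"
  shows "bij (\<lambda>x. x - T x)"
proof -
  have low: "(1 - q) * norm x \<le> norm (x - T x)" for x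
    using bd[of x] norm_triangle_ineq2[of x "T x"] by (simp add: algebra_simps)
  show ?thesis
  proof (rule bijI)
    show "inj (\<lambda>x. x - T x)"
    proof (rule injI)
      fix x y assume "x - T x = y - T y"
      then have "(x - y) - T (x - y) = 0" by (simp add: clin_diff[OF T] algebra_simps)
      then show "x = y" using low[of "x - y"] q by (simp add: mult_le_0_iff)
    qed
    have "\<exists>x. y = x - T x" for y
    proof -
      have "\<exists>!x. y + T x = x"
      proof (rule banach_fix_type[OF q], intro allI)
        show "dist (y + T u) (y + T v) \<le> q * dist u v" for u v
          using bd[of "u - v"] by (simp add: dist_norm clin_diff[OF T])
      qed
      then obtain x where "y + T x = x" by blast
      then show ?thesis by (metis add_diff_cancel_right')
    qed
    then show "surj (\<lambda>x. x - T x)" by (auto simp: surj_def)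
  qed
qed

lemma inv_clin:
  fixes S :: "'h::cinner_space \<Rightarrow> 'h"
  assumes S: "clin S" and bij: "bij S" and k: "k > 0" and low: "\<And>x. k * norm x \<le> norm (S x)"
  shows "clin (inv S)" and "norm (inv S x) \<le> norm x / k"
proof -
  have SI: "S (inv S x) = x" for x by (simp add: bij bij_is_surj surj_f_inv_f)
  have eqI: "inv S x = y" if "x = S y" for x y using that bij by (simp add: bij_is_inj)
  have *: "norm (inv S x) \<le> norm x / k" for x
    using low[of "inv S x"] k by (simp add: SI field_simps)
  then show "norm (inv S x) \<le> norm x / k" .
  show "clin (inv S)"
    by (rule clinI[where K = "1/k"])
      (auto intro!: eqI simp: clin_add[OF S] clin_scaleC[OF S] SI *)
qed

section \<open>Bessel families\<close>

text \<open>Only finite sums occur, so that the bound survives limits of vectors and passes to a completion.\<close>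

definition bessel :: "('i \<Rightarrow> 'h::cinner_space) \<Rightarrow> real \<Rightarrow> bool"
  where "bessel \<psi> B \<longleftrightarrow> 0 \<le> B \<and>
    (\<forall>f F. finite F \<longrightarrow> (\<Sum>i\<in>F. (cmod (cinner f (\<psi> i)))\<^sup>2) \<le> B * (norm f)\<^sup>2)"

abbreviation sq_summable :: "('i \<Rightarrow> complex) \<Rightarrow> bool"
  where "sq_summable c \<equiv> (\<lambda>i. (cmod (c i))\<^sup>2) summable_on UNIV"

text \<open>The synthesis operator is the adjoint of the analysis operator: pair the sum with itself and use
  the Cauchy-Schwarz inequality on the coefficients.\<close>

lemma bessel_synth_fin:
  assumes "bessel \<psi> B" "finite F"
  shows "(norm (\<Sum>i\<in>F. c i *\<^sub>C \<psi> i))\<^sup>2 \<le> B * (\<Sum>i\<in>F. (cmod (c i))\<^sup>2)"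
proof -
  define g where "g = (\<Sum>i\<in>F. c i *\<^sub>C \<psi> i)"
  define s where "s = (\<Sum>i\<in>F. (cmod (c i))\<^sup>2)"
  have s0: "s \<ge> 0" by (simp add: s_def sum_nonneg)
  have B: "B \<ge> 0" "(\<Sum>i\<in>F. (cmod (cinner g (\<psi> i)))\<^sup>2) \<le> B * (norm g)\<^sup>2"
    using assms by (auto simp: bessel_def)
  have "complex_of_real ((norm g)\<^sup>2) = (\<Sum>i\<in>F. c i * cinner (\<psi> i) g)"
    unfolding cinner_self[symmetric] by (subst g_def) (simp add: cinner_sum_left cinner_scaleC_left)
  then have "(norm g)\<^sup>2 = cmod (\<Sum>i\<in>F. c i * cinner (\<psi> i) g)"
    by (metis norm_of_real abs_of_nonneg zero_le_power2)
  also have "\<dots> \<le> (\<Sum>i\<in>F. cmod (c i) * cmod (cinner g (\<psi> i)))"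
    by (rule sum_norm_le) (simp add: norm_mult cinner_commute[of _ g])
  also have "\<dots> \<le> L2_set (\<lambda>i. cmod (c i)) F * L2_set (\<lambda>i. cmod (cinner g (\<psi> i))) F"
    using L2_set_mult_ineq[of "\<lambda>i. cmod (c i)" "\<lambda>i. cmod (cinner g (\<psi> i))" F] by simp
  also have "\<dots> \<le> sqrt s * sqrt (B * (norm g)\<^sup>2)"
    unfolding L2_set_def s_def[symmetric] using B s0 by (intro mult_left_mono) auto
  also have "\<dots> = sqrt (B * s) * norm g" by (simp add: real_sqrt_mult)
  finally have "norm g * norm g \<le> sqrt (B * s) * norm g" by (simp add: power2_eq_square)
  then have "norm g \<le> sqrt (B * s)"
    using B(1) s0 by (cases "norm g = 0") auto
  then have "(norm g)\<^sup>2 \<le> (sqrt (B * s))\<^sup>2" by (rule power_mono) simp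
  then show ?thesis using B s0 by (simp add: g_def s_def)
qed

text \<open>The finite estimate makes the partial sums a Cauchy net.\<close>

lemma bessel_summable:
  fixes \<psi> :: "'i \<Rightarrow> 'h::chilbert_space"
  assumes b: "bessel \<psi> B" and c: "sq_summable c"
  shows "(\<lambda>i. c i *\<^sub>C \<psi> i) summable_on UNIV"
proof -
  define s where "s = (\<lambda>i. (cmod (c i))\<^sup>2)"
  have B: "B \<ge> 0" using b by (simp add: bessel_def)
  define G where "G = filtermap (sum (\<lambda>i. c i *\<^sub>C \<psi> i)) (finite_subsets_at_top UNIV)"
  have *: "\<exists>P. eventually P (finite_subsets_at_top UNIV) \<and> (\<forall>F F'. P F \<and> P F' \<longrightarrow>
      dist (sum (\<lambda>i. c i *\<^sub>C \<psi> i) F) (sum (\<lambda>i. c i *\<^sub>C \<psi> i) F') < e)" if e: "e > 0" for e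
  proof -
    \<comment> \<open>A tail of the coefficients below \<open>d\<close> makes the tail of the sum smaller than \<open>e/2\<close>; \<open>B\<close> may be zero.\<close>
    define d where "d = (e / 2)\<^sup>2 / (B + 1)"
    have d: "d > 0" using e B by (simp add: d_def)
    have "(sum s \<longlongrightarrow> infsum s UNIV) (finite_subsets_at_top UNIV)"
      using c by (simp add: s_def infsum_tendsto)
    then have "eventually (\<lambda>F. dist (sum s F) (infsum s UNIV) < d) (finite_subsets_at_top UNIV)"
      using d by (auto simp: tendsto_iff)
    then obtain F0 where F0: "finite F0" "\<And>F. finite F \<Longrightarrow> F0 \<subseteq> F \<Longrightarrow> dist (sum s F) (infsum s UNIV) < d"
      by (auto simp: eventually_finite_subsets_at_top)
    have sm: "norm (sum (\<lambda>i. c i *\<^sub>C \<psi> i) F - sum (\<lambda>i. c i *\<^sub>C \<psi> i) F0) < e / 2"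
      if F: "finite F" "F0 \<subseteq> F" for F
    proof -
      have "sum s (F - F0) = sum s F - sum s F0" using F by (intro sum_diff)
      also have "\<dots> < d"
        using F0(2)[OF F0(1)] F0(2)[OF F]
          finite_sum_le_infsum[of s UNIV F] c F by (auto simp: dist_real_def s_def abs_less_iff)
      finally have "sum s (F - F0) < d" .
      have "(norm (\<Sum>i\<in>F - F0. c i *\<^sub>C \<psi> i))\<^sup>2 \<le> B * sum s (F - F0)"
        unfolding s_def using F by (intro bessel_synth_fin[OF b]) auto
      also have "\<dots> \<le> B * d" using \<open>sum s (F - F0) < d\<close> B by (intro mult_left_mono) auto
      also have "\<dots> < (B + 1) * d" using d by simp
      also have "\<dots> = (e / 2)\<^sup>2" using B by (simp add: d_def)
      finally have "norm (\<Sum>i\<in>F - F0. c i *\<^sub>C \<psi> i) < e / 2"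
        by (rule power2_less_imp_less) (use e in simp)
      then show ?thesis using F F0 by (simp add: sum_diff)
    qed
    show ?thesis
    proof (intro exI[of _ "\<lambda>F. finite F \<and> F0 \<subseteq> F"] conjI allI impI)
      show "eventually (\<lambda>F. finite F \<and> F0 \<subseteq> F) (finite_subsets_at_top UNIV)"
        using F0(1) by (auto simp: eventually_finite_subsets_at_top)
      fix F F' assume "(finite F \<and> F0 \<subseteq> F) \<and> (finite F' \<and> F0 \<subseteq> F')"
      then show "dist (sum (\<lambda>i. c i *\<^sub>C \<psi> i) F) (sum (\<lambda>i. c i *\<^sub>C \<psi> i) F') < e"
        using dist_triangle_half_r[of "sum (\<lambda>i. c i *\<^sub>C \<psi> i) F0" "sum (\<lambda>i. c i *\<^sub>C \<psi> i) F" e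
            "sum (\<lambda>i. c i *\<^sub>C \<psi> i) F'"] sm[of F] sm[of F']
        by (auto simp: dist_norm norm_minus_commute)
    qed
  qed
  have "cauchy_filter G"
    unfolding G_def cauchy_filter_metric_filtermap using * by blast
  moreover have "G \<noteq> bot" by (simp add: G_def filtermap_bot_iff)
  ultimately obtain L where "G \<le> nhds L"
    using cauchy_filter_complete_converges[of G UNIV] complete_UNIV by auto
  then have "((\<lambda>i. c i *\<^sub>C \<psi> i) has_sum L) UNIV"
    by (auto simp: has_sum_def G_def filterlim_def)
  then show ?thesis by (rule has_sum_imp_summable)
qed

lemma synthesis_has_sum:
  fixes \<psi> :: "'i \<Rightarrow> 'h::chilbert_space"
  assumes "bessel \<psi> B" "sq_summable c"
  shows "((\<lambda>i. c i *\<^sub>C \<psi> i) has_sum synthesis \<psi> c) UNIV"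
  unfolding synthesis_def using bessel_summable[OF assms] by simp

lemma synthesis_bound:
  fixes \<psi> :: "'i \<Rightarrow> 'h::chilbert_space"
  assumes b: "bessel \<psi> B" and c: "sq_summable c"
  shows "(norm (synthesis \<psi> c))\<^sup>2 \<le> B * (\<Sum>\<^sub>\<infinity>i. (cmod (c i))\<^sup>2)"
proof -
  have B: "B \<ge> 0" using b by (simp add: bessel_def)
  have "((\<lambda>F. (norm (\<Sum>i\<in>F. c i *\<^sub>C \<psi> i))\<^sup>2) \<longlongrightarrow> (norm (synthesis \<psi> c))\<^sup>2) (finite_subsets_at_top UNIV)"
    using synthesis_has_sum[OF b c] unfolding has_sum_def by (intro tendsto_intros)
  then show ?thesis
  proof (rule tendsto_upperbound)
    show "\<forall>\<^sub>F F in finite_subsets_at_top UNIV.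
        (norm (\<Sum>i\<in>F. c i *\<^sub>C \<psi> i))\<^sup>2 \<le> B * (\<Sum>\<^sub>\<infinity>i. (cmod (c i))\<^sup>2)"
    proof (rule eventually_finite_subsets_at_top_weakI)
      fix F :: "'i set" assume F: "finite F"
      have "(\<Sum>i\<in>F. (cmod (c i))\<^sup>2) \<le> (\<Sum>\<^sub>\<infinity>i. (cmod (c i))\<^sup>2)"
        using c F by (intro finite_sum_le_infsum) auto
      then show "(norm (\<Sum>i\<in>F. c i *\<^sub>C \<psi> i))\<^sup>2 \<le> B * (\<Sum>\<^sub>\<infinity>i. (cmod (c i))\<^sup>2)"
        using bessel_synth_fin[OF b F, of c] mult_left_mono[OF _ B] by (meson order_trans)
    qed
  qed simp
qed

lemma bessel_analysis:
  assumes "bessel \<psi> B"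
  shows "sq_summable (analysis \<psi> f)" "(\<Sum>\<^sub>\<infinity>i. (cmod (analysis \<psi> f i))\<^sup>2) \<le> B * (norm f)\<^sup>2"
proof -
  have *: "(\<Sum>i\<in>F. (cmod (analysis \<psi> f i))\<^sup>2) \<le> B * (norm f)\<^sup>2" if "finite F" for F
    using assms that by (auto simp: bessel_def analysis_def)
  show "sq_summable (analysis \<psi> f)"
    by (rule nonneg_bdd_above_summable_on) (auto intro!: bdd_aboveI[of _ "B * (norm f)\<^sup>2"] *)
  then show "(\<Sum>\<^sub>\<infinity>i. (cmod (analysis \<psi> f i))\<^sup>2) \<le> B * (norm f)\<^sup>2"
    by (rule infsum_le_finite_sums) (auto intro: *)
qed

lemma cinner_synthesis_left:
  fixes \<psi> :: "'i \<Rightarrow> 'h::chilbert_space"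
  assumes "bessel \<psi> B" "sq_summable c"
  shows "((\<lambda>i. c i * cinner (\<psi> i) g) has_sum cinner (synthesis \<psi> c) g) UNIV"
  using has_sum_bounded_linear[OF bounded_linear_cinner_left synthesis_has_sum[OF assms], of g]
  by (simp add: cinner_scaleC_left)

lemma sq_summable_add:
  assumes "sq_summable c" "sq_summable d"
  shows "sq_summable (\<lambda>i. c i + d i)"
    "(\<Sum>\<^sub>\<infinity>i. (cmod (c i + d i))\<^sup>2) \<le> 2 * (\<Sum>\<^sub>\<infinity>i. (cmod (c i))\<^sup>2) + 2 * (\<Sum>\<^sub>\<infinity>i. (cmod (d i))\<^sup>2)"
proof -
  have *: "(cmod (c i + d i))\<^sup>2 \<le> 2 * (cmod (c i))\<^sup>2 + 2 * (cmod (d i))\<^sup>2" for i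
  proof -
    have "(cmod (c i + d i))\<^sup>2 \<le> (cmod (c i) + cmod (d i))\<^sup>2"
      by (rule power_mono) (auto intro: norm_triangle_ineq)
    then show ?thesis
      using sum_squares_bound[of "cmod (c i)" "cmod (d i)"] by (simp add: power2_sum)
  qed
  have s: "(\<lambda>i. 2 * (cmod (c i))\<^sup>2 + 2 * (cmod (d i))\<^sup>2) summable_on UNIV"
    using assms by (intro summable_on_add summable_on_cmult_right)
  show 1: "sq_summable (\<lambda>i. c i + d i)"
    by (rule summable_on_comparison_test[OF s]) (use * in auto)
  have "(\<Sum>\<^sub>\<infinity>i. (cmod (c i + d i))\<^sup>2) \<le> (\<Sum>\<^sub>\<infinity>i. 2 * (cmod (c i))\<^sup>2 + 2 * (cmod (d i))\<^sup>2)"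
    by (rule infsum_mono[OF 1 s]) (rule *)
  also have "\<dots> = 2 * (\<Sum>\<^sub>\<infinity>i. (cmod (c i))\<^sup>2) + 2 * (\<Sum>\<^sub>\<infinity>i. (cmod (d i))\<^sup>2)"
    using assms by (simp add: infsum_add summable_on_cmult_right infsum_cmult_right)
  finally show "(\<Sum>\<^sub>\<infinity>i. (cmod (c i + d i))\<^sup>2) \<le> 2 * (\<Sum>\<^sub>\<infinity>i. (cmod (c i))\<^sup>2) + 2 * (\<Sum>\<^sub>\<infinity>i. (cmod (d i))\<^sup>2)" .
qed

lemma synthesis_add:
  fixes \<psi> :: "'i \<Rightarrow> 'h::chilbert_space"
  assumes "bessel \<psi> B" "sq_summable c" "sq_summable d"
  shows "synthesis \<psi> (\<lambda>i. c i + d i) = synthesis \<psi> c + synthesis \<psi> d"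
proof -
  have "((\<lambda>i. (c i + d i) *\<^sub>C \<psi> i) has_sum (synthesis \<psi> c + synthesis \<psi> d)) UNIV"
    using has_sum_add[OF synthesis_has_sum[OF assms(1,2)] synthesis_has_sum[OF assms(1,3)]]
    by (simp add: scaleC_add_left)
  then show ?thesis unfolding synthesis_def by (rule infsumI)
qed

lemma synthesis_scale:
  fixes \<psi> :: "'i \<Rightarrow> 'h::chilbert_space"
  assumes "bessel \<psi> B" "sq_summable c"
  shows "synthesis \<psi> (\<lambda>i. a * c i) = a *\<^sub>C synthesis \<psi> c"
proof -
  have "((\<lambda>i. (a * c i) *\<^sub>C \<psi> i) has_sum (a *\<^sub>C synthesis \<psi> c)) UNIV"
    using has_sum_bounded_linear[OF bounded_linear_scaleC synthesis_has_sum[OF assms], of a]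
    by (simp add: scaleC_scaleC)
  then show ?thesis unfolding synthesis_def by (rule infsumI)
qed

lemma analysis_add: "analysis \<psi> (f + g) = (\<lambda>i. analysis \<psi> f i + analysis \<psi> g i)"
  and analysis_diff: "analysis \<psi> (f - g) = (\<lambda>i. analysis \<psi> f i - analysis \<psi> g i)"
  and analysis_scale: "analysis \<psi> (a *\<^sub>C f) = (\<lambda>i. a * analysis \<psi> f i)"
  by (auto simp: analysis_def cinner_add_left cinner_diff_left cinner_scaleC_left)

lemma clin_synthesis_analysis:
  fixes \<phi> :: "'i \<Rightarrow> 'k::chilbert_space"
  assumes p: "bessel \<psi> B" and q: "bessel \<phi> C"
  shows "clin (\<lambda>f. synthesis \<phi> (analysis \<psi> f))"
proof (rule clinI[where K = "sqrt (C * B)"])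
  note s = bessel_analysis(1)[OF p]
  have BC: "B \<ge> 0" "C \<ge> 0" using p q by (auto simp: bessel_def)
  show "synthesis \<phi> (analysis \<psi> (x + y)) = synthesis \<phi> (analysis \<psi> x) + synthesis \<phi> (analysis \<psi> y)" for x y
    by (simp add: analysis_add synthesis_add[OF q s s])
  show "synthesis \<phi> (analysis \<psi> (c *\<^sub>C x)) = c *\<^sub>C synthesis \<phi> (analysis \<psi> x)" for c x
    by (simp add: analysis_scale synthesis_scale[OF q s])
  fix x
  have "(norm (synthesis \<phi> (analysis \<psi> x)))\<^sup>2 \<le> C * (B * (norm x)\<^sup>2)"
    using synthesis_bound[OF q s] mult_left_mono[OF bessel_analysis(2)[OF p, of x] BC(2)]
    by (rule order_trans)
  also have "\<dots> = (sqrt (C * B) * norm x)\<^sup>2"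
    using BC by (simp add: power_mult_distrib)
  finally show "norm (synthesis \<phi> (analysis \<psi> x)) \<le> sqrt (C * B) * norm x"
    by (rule power2_le_imp_le) (use BC in simp)
qed

section \<open>The frame operator\<close>

text \<open>The Cauchy-Schwarz inequality for the semi-inner product \<open>\<langle>T x, y\<rangle>\<close>, applied with \<open>y = T x\<close>, turns a
  bound on the quadratic form into a bound on the operator norm.\<close>

lemma positive_op_norm:
  fixes T :: "'h::cinner_space \<Rightarrow> 'h"
  assumes T: "clin T" and sa: "\<And>x y. cinner (T x) y = cinner x (T y)"
    and pos: "\<And>x. 0 \<le> Re (cinner (T x) x)" and up: "\<And>x. Re (cinner (T x) x) \<le> q * (norm x)\<^sup>2"
  shows "norm (T x) \<le> q * norm x"
proof (cases "norm (T x) = 0 \<or> norm x = 0")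
  case False
  then have n: "norm (T x) > 0" "norm x > 0" by auto
  have "q * (norm x)\<^sup>2 \<ge> 0" using pos[of x] up[of x] by linarith
  then have q: "q \<ge> 0" using n by (simp add: zero_le_mult_iff)
  have "(cmod (cinner (T x) (T x)))\<^sup>2 \<le> Re (cinner (T x) x) * Re (cinner (T (T x)) (T x))"
  proof (rule pre_cauchy_schwarz[of "\<lambda>x y. cinner (T x) y" scaleC])
    show "cinner (T x) y = cnj (cinner (T y) x)" for x y
      by (metis sa cinner_commute)
  qed (auto simp: clin_add[OF T] clin_scaleC[OF T] cinner_add_left cinner_scaleC_left pos)
  also have "\<dots> \<le> (q * (norm x)\<^sup>2) * (q * (norm (T x))\<^sup>2)"
    by (intro mult_mono up pos) (use q in auto)
  finally have "(norm (T x) * norm (T x))\<^sup>2 \<le> (q * norm x * norm (T x))\<^sup>2"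
    by (simp add: cinner_self norm_power norm_mult power_mult_distrib power2_eq_square ac_simps)
  then have "norm (T x) * norm (T x) \<le> q * norm x * norm (T x)"
    by (rule power2_le_imp_le) (use q in auto)
  then show ?thesis using n by simp
next
  case True
  then have "T x = 0" by (auto simp: clin_zero[OF T])
  moreover have "0 \<le> q * norm x"
  proof (cases "x = 0")
    case False
    have "q * (norm x)\<^sup>2 \<ge> 0" using pos[of x] up[of x] by linarith
    then have "q \<ge> 0" using False by (simp add: zero_le_mult_iff)
    then show ?thesis by simp
  qed simp
  ultimately show ?thesis by simp
qed

lemma frame_op_clin:
  fixes \<psi> :: "'i \<Rightarrow> 'h::chilbert_space"
  shows "bessel \<psi> B \<Longrightarrow> clin (frame_op \<psi>)"
  using clin_synthesis_analysis[of \<psi> B \<psi> B] by (simp add: frame_op_def o_def)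

lemma frame_op_has_sum:
  fixes \<psi> :: "'i \<Rightarrow> 'h::chilbert_space"
  assumes "bessel \<psi> B"
  shows "((\<lambda>i. cinner f (\<psi> i) * cinner (\<psi> i) g) has_sum cinner (frame_op \<psi> f) g) UNIV"
  using cinner_synthesis_left[OF assms bessel_analysis(1)[OF assms], of f g]
  by (simp add: frame_op_def analysis_def)

lemma frame_op_self_adjoint:
  fixes \<psi> :: "'i \<Rightarrow> 'h::chilbert_space"
  assumes "bessel \<psi> B"
  shows "cinner (frame_op \<psi> f) g = cinner f (frame_op \<psi> g)"
proof -
  have "((\<lambda>i. cnj (cinner g (\<psi> i) * cinner (\<psi> i) f)) has_sum cnj (cinner (frame_op \<psi> g) f)) UNIV"
    using frame_op_has_sum[OF assms, of g f] by (simp only: has_sum_cnj_iff)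
  then have "((\<lambda>i. cinner f (\<psi> i) * cinner (\<psi> i) g) has_sum cinner f (frame_op \<psi> g)) UNIV"
    by (simp add: cinner_commute[symmetric] mult.commute)
  then show ?thesis using frame_op_has_sum[OF assms, of f g] has_sum_unique by blast
qed

lemma frame_op_form:
  fixes \<psi> :: "'i \<Rightarrow> 'h::chilbert_space"
  assumes "bessel \<psi> B"
  shows "Re (cinner (frame_op \<psi> f) f) = (\<Sum>\<^sub>\<infinity>i. (cmod (analysis \<psi> f i))\<^sup>2)"
proof -
  have "((\<lambda>i. Re (cinner f (\<psi> i) * cinner (\<psi> i) f)) has_sum Re (cinner (frame_op \<psi> f) f)) UNIV"
    by (rule has_sum_Re[OF frame_op_has_sum[OF assms]])
  moreover have "Re (cinner f (\<psi> i) * cinner (\<psi> i) f) = (cmod (analysis \<psi> f i))\<^sup>2" for i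
    unfolding analysis_def cinner_commute[of "\<psi> i" f]
    by (metis Re_complex_of_real complex_norm_square)
  ultimately show ?thesis by (simp add: infsumI)
qed

text \<open>The two frame bounds are made explicit, and \<open>a \<le> b\<close> is demanded because it can fail in the trivial
  space.\<close>

locale frame_bounds =
  fixes \<psi> :: "'i \<Rightarrow> 'h::chilbert_space" and a b :: real
  assumes a_pos: "0 < a" and ab: "a \<le> b" and bessel: "bessel \<psi> b"
    and lower: "a * (norm f)\<^sup>2 \<le> (\<Sum>\<^sub>\<infinity>i. (cmod (analysis \<psi> f i))\<^sup>2)"

lemma frame_obtain_bounds:
  fixes \<psi> :: "'i \<Rightarrow> 'h::chilbert_space"
  assumes "frame \<psi>"
  shows "\<exists>a b. frame_bounds \<psi> a b"
proof -
  obtain A B where AB: "A > 0" "B > 0"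
    and s: "\<And>f. sq_summable (analysis \<psi> f)"
    and lo: "\<And>f. A * (norm f)\<^sup>2 \<le> (\<Sum>\<^sub>\<infinity>i. (cmod (analysis \<psi> f i))\<^sup>2)"
    and up: "\<And>f. (\<Sum>\<^sub>\<infinity>i. (cmod (analysis \<psi> f i))\<^sup>2) \<le> B * (norm f)\<^sup>2"
    using assms unfolding frame_def by blast
  have "(\<Sum>i\<in>F. (cmod (cinner f (\<psi> i)))\<^sup>2) \<le> max A B * (norm f)\<^sup>2" if "finite F" for f F
  proof -
    have "(\<Sum>i\<in>F. (cmod (analysis \<psi> f i))\<^sup>2) \<le> (\<Sum>\<^sub>\<infinity>i. (cmod (analysis \<psi> f i))\<^sup>2)"
      using s that by (intro finite_sum_le_infsum) auto
    also note up[of f]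
    also have "B * (norm f)\<^sup>2 \<le> max A B * (norm f)\<^sup>2" by (intro mult_right_mono) auto
    finally show ?thesis by (simp add: analysis_def)
  qed
  then have "frame_bounds \<psi> A (max A B)"
    using AB lo by (auto simp: frame_bounds_def bessel_def)
  then show ?thesis by blast
qed

context frame_bounds
begin

abbreviation "S \<equiv> frame_op \<psi>"

definition "Q = inv S"

lemma b_pos: "0 < b" using a_pos ab by linarith

lemma clin_S: "clin S" by (rule frame_op_clin[OF bessel])

lemma S_lower: "a * norm f \<le> norm (S f)"
proof (cases "f = 0")
  case False
  have "a * (norm f)\<^sup>2 \<le> Re (cinner (S f) f)" using lower[of f] by (simp add: frame_op_form[OF bessel])
  also have "\<dots> \<le> norm (S f) * norm f"
    using complex_Re_le_cmod cauchy_schwarz by (rule order_trans)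
  finally show ?thesis using False by (simp add: power2_eq_square)
qed (simp add: clin_zero[OF clin_S])

text \<open>The quadratic form of \<open>1 - S/b\<close> lies between \<open>0\<close> and \<open>1 - a/b\<close>, so this operator is a contraction.\<close>

lemma S_bij: "bij S"
proof -
  define T where "T x = x - complex_of_real (1 / b) *\<^sub>C S x" for x
  have T: "clin T" unfolding T_def by (intro clin_sub clin_id clin_scale clin_S)
  have form: "Re (cinner (T x) x) = (norm x)\<^sup>2 - Re (cinner (S x) x) / b" for x
    by (simp add: T_def cinner_diff_left cinner_scaleC_left cinner_self)
  have "bij (\<lambda>x. x - T x)"
  proof (rule contraction_bij[OF T])
    show "norm (T x) \<le> (1 - a / b) * norm x" for x
    proof (rule positive_op_norm[OF T])
      show "cinner (T x) y = cinner x (T y)" for x y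
        by (simp add: T_def cinner_diff_left cinner_diff_right cinner_scaleC_left cinner_scaleC_right
            frame_op_self_adjoint[OF bessel])
      show "0 \<le> Re (cinner (T x) x)" for x
        using bessel_analysis(2)[OF bessel, of x] b_pos
        by (simp add: form frame_op_form[OF bessel] field_simps)
      show "Re (cinner (T x) x) \<le> (1 - a / b) * (norm x)\<^sup>2" for x
        using lower[of x] b_pos
        by (simp add: form frame_op_form[OF bessel] field_simps)
    qed
  qed (use a_pos b_pos ab in auto)
  then have "bij ((\<lambda>x. complex_of_real b *\<^sub>C x) \<circ> (\<lambda>x. x - T x))"
  proof (rule bij_comp)
    show "bij (\<lambda>x::'h. complex_of_real b *\<^sub>C x)"
      by (rule bij_betw_byWitness[where f' = "\<lambda>x. complex_of_real (1 / b) *\<^sub>C x"])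
        (use b_pos in \<open>auto simp: scaleC_scaleC simp flip: of_real_mult\<close>)
  qed
  moreover have "(\<lambda>x. complex_of_real b *\<^sub>C x) \<circ> (\<lambda>x. x - T x) = S"
    using b_pos by (auto simp: T_def fun_eq_iff scaleC_scaleC simp flip: of_real_mult)
  ultimately show ?thesis by simp
qed

lemma clin_Q: "clin Q"
  and Q_bound: "norm (Q x) \<le> norm x / a"
  unfolding Q_def using inv_clin[OF clin_S S_bij a_pos S_lower] by auto

lemma SQ [simp]: "S (Q x) = x"
  by (simp add: Q_def S_bij bij_is_surj surj_f_inv_f)

lemma QS [simp]: "Q (S x) = x"
  by (simp add: Q_def S_bij bij_is_inj)

lemma Q_self_adjoint: "cinner (Q x) y = cinner x (Q y)"
  using frame_op_self_adjoint[OF bessel, of "Q x" "Q y"] by simp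

lemma canonical_dual_eq: "canonical_dual \<psi> i = Q (\<psi> i)"
  by (simp add: canonical_dual_def Q_def)

text \<open>The reconstruction formula in weak form. Testing it with frame elements shows how the matrices \<open>P\<close>
  and \<open>G\<close> act on coefficient sequences.\<close>

lemma recon: "((\<lambda>i. cinner f (canonical_dual \<psi> i) * cinner (\<psi> i) g) has_sum cinner f g) UNIV"
  using frame_op_has_sum[OF bessel, of "Q f" g] by (simp add: canonical_dual_eq Q_self_adjoint)

lemma dual_bessel: "bessel (canonical_dual \<psi>) (b / a\<^sup>2)"
proof -
  have "(\<Sum>i\<in>F. (cmod (cinner f (canonical_dual \<psi> i)))\<^sup>2) \<le> b / a\<^sup>2 * (norm f)\<^sup>2" if "finite F" for f F
  proof -
    have "(\<Sum>i\<in>F. (cmod (cinner f (canonical_dual \<psi> i)))\<^sup>2) \<le> b * (norm (Q f))\<^sup>2"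
      using bessel that by (simp add: bessel_def canonical_dual_eq Q_self_adjoint[symmetric])
    also have "\<dots> \<le> b * (norm f / a)\<^sup>2"
      using b_pos Q_bound by (intro mult_left_mono power_mono) auto
    finally show ?thesis by (simp add: power_divide)
  qed
  then show ?thesis using b_pos by (simp add: bessel_def)
qed

end

section \<open>Matrices of operators relative to a frame\<close>

lemma mat_one_has_sum: "((\<lambda>j. mat_one i j * c j) has_sum c i) UNIV"
  by (rule has_sum_finite_neutralI[where B = "{i}"]) (auto simp: mat_one_def)

lemma mat_one_has_sum': "((\<lambda>k. c k * mat_one k j) has_sum c j) UNIV"
  by (rule has_sum_finite_neutralI[where B = "{j}"]) (auto simp: mat_one_def)

lemma lpw2: "lpw 2 (\<lambda>i. 1) = {c. sq_summable c}"
  by (auto simp: lpw_def lp_def)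

lemma lpw2_norm: "lpw_norm 2 (\<lambda>i. 1) c = sqrt (\<Sum>\<^sub>\<infinity>i. (cmod (c i))\<^sup>2)"
  by (simp add: lpw_norm_def lp_norm_def powr_half_sqrt infsum_nonneg)

context frame_bounds
begin

text \<open>The matrix of \<open>C U D\<close> on \<open>\<ell>\<^sup>2\<close>, where \<open>C\<close> and \<open>D\<close> are the analysis and the synthesis operator of the
  frame. As \<open>D C = S\<close>, the matrices of \<open>U\<close> and \<open>V\<close> multiply to the matrix of \<open>U S V\<close>.\<close>

definition opmat :: "('h \<Rightarrow> 'h) \<Rightarrow> 'i matrix"
  where "opmat U i j = cinner (U (\<psi> j)) (\<psi> i)"

text \<open>The matrix of \<open>1 + C U D\<close>. The inverses that are needed later are again of this form.\<close>

definition idop :: "('h \<Rightarrow> 'h) \<Rightarrow> 'i matrix"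
  where "idop U i j = mat_one i j + opmat U i j"

lemma gram_opmat: "gram \<psi> = opmat (\<lambda>x. x)"
  by (simp add: fun_eq_iff gram_def opmat_def)

lemma opmat_app:
  assumes U: "clin U" and c: "sq_summable c"
  shows "((\<lambda>j. opmat U i j * c j) has_sum analysis \<psi> (U (synthesis \<psi> c)) i) UNIV"
proof -
  have "bounded_linear (\<lambda>x. cinner (U x) (\<psi> i))"
    using bounded_linear_compose[OF bounded_linear_cinner_left clin_bounded_linear[OF U]] .
  from has_sum_bounded_linear[OF this synthesis_has_sum[OF bessel c]]
  show ?thesis by (simp add: analysis_def opmat_def clin_scaleC[OF U] cinner_scaleC_left mult.commute)
qed

lemma idop_app:
  assumes U: "clin U" and c: "sq_summable c"
  shows "((\<lambda>j. idop U i j * c j) has_sum (c i + analysis \<psi> (U (synthesis \<psi> c)) i)) UNIV"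
  using has_sum_add[OF mat_one_has_sum opmat_app[OF U c]] by (simp add: idop_def distrib_right)

lemma mat_app_idop:
  assumes "clin U" "sq_summable c"
  shows "mat_app (idop U) c = (\<lambda>i. c i + analysis \<psi> (U (synthesis \<psi> c)) i)"
  using infsumI[OF idop_app[OF assms]] by (simp add: mat_app_def fun_eq_iff)

lemma sq_summable_analysis: "sq_summable (analysis \<psi> f)"
  by (rule bessel_analysis(1)[OF bessel])

lemma synthesis_analysis: "synthesis \<psi> (analysis \<psi> f) = S f"
  by (simp add: frame_op_def)

lemma opmat_mult_has_sum:
  assumes "clin U"
  shows "((\<lambda>k. opmat U i k * opmat V k j) has_sum opmat (\<lambda>x. U (S (V x))) i j) UNIV"
  using opmat_app[OF assms sq_summable_analysis, of i "V (\<psi> j)"]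
  unfolding synthesis_analysis by (simp add: analysis_def opmat_def)

lemma idop_mult_opmat:
  assumes "clin U"
  shows "mat_mult (idop U) (opmat V) = opmat (\<lambda>x. V x + U (S (V x)))"
proof (intro ext)
  fix i j
  have "((\<lambda>k. idop U i k * opmat V k j) has_sum (opmat V i j + opmat (\<lambda>x. U (S (V x))) i j)) UNIV"
    using has_sum_add[OF mat_one_has_sum opmat_mult_has_sum[OF assms]]
    by (simp add: idop_def distrib_right)
  then show "mat_mult (idop U) (opmat V) i j = opmat (\<lambda>x. V x + U (S (V x))) i j"
    by (simp add: mat_mult_def infsumI opmat_def cinner_add_left)
qed

lemma opmat_mult_idop:
  assumes "clin U"
  shows "mat_mult (opmat U) (idop V) = opmat (\<lambda>x. U x + U (S (V x)))"
proof (intro ext)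
  fix i j
  have "((\<lambda>k. opmat U i k * idop V k j) has_sum (opmat U i j + opmat (\<lambda>x. U (S (V x))) i j)) UNIV"
    using has_sum_add[OF mat_one_has_sum' opmat_mult_has_sum[OF assms]]
    by (simp add: idop_def distrib_left)
  then show "mat_mult (opmat U) (idop V) i j = opmat (\<lambda>x. U x + U (S (V x))) i j"
    by (simp add: mat_mult_def infsumI opmat_def cinner_add_left)
qed

lemma idop_bounded:
  assumes U: "clin U"
  shows "bounded_mat 2 (\<lambda>i. 1) (idop U)"
proof -
  obtain K where K: "K \<ge> 0" "\<And>x. norm (U x) \<le> K * norm x" using clin_bound[OF U] by blast
  define n where "n c = (\<Sum>\<^sub>\<infinity>i. (cmod (c i))\<^sup>2)" for c :: "'i \<Rightarrow> complex"
  have main: "sq_summable (mat_app (idop U) c) \<and>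
      sqrt (n (mat_app (idop U) c)) \<le> sqrt (2 + 2 * (b * (K\<^sup>2 * b))) * sqrt (n c)" if c: "sq_summable c" for c
  proof -
    have "n (analysis \<psi> (U (synthesis \<psi> c))) \<le> b * (norm (U (synthesis \<psi> c)))\<^sup>2"
      unfolding n_def by (rule bessel_analysis(2)[OF bessel])
    also have "\<dots> \<le> b * (K * norm (synthesis \<psi> c))\<^sup>2"
      using b_pos K by (intro mult_left_mono power_mono) auto
    also have "\<dots> = b * (K\<^sup>2 * (norm (synthesis \<psi> c))\<^sup>2)" by (simp add: power_mult_distrib)
    also have "\<dots> \<le> b * (K\<^sup>2 * (b * n c))"
      unfolding n_def using b_pos by (intro mult_left_mono synthesis_bound[OF bessel c]) auto
    finally have "2 * n c + 2 * n (analysis \<psi> (U (synthesis \<psi> c))) \<le> (2 + 2 * (b * (K\<^sup>2 * b))) * n c"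
      by (simp add: algebra_simps)
    moreover have "n (mat_app (idop U) c) \<le> 2 * n c + 2 * n (analysis \<psi> (U (synthesis \<psi> c)))"
      unfolding mat_app_idop[OF U c] n_def by (rule sq_summable_add(2)[OF c sq_summable_analysis])
    ultimately show ?thesis
      using sq_summable_add(1)[OF c sq_summable_analysis]
      by (simp add: mat_app_idop[OF U c] real_sqrt_mult[symmetric])
  qed
  show ?thesis
    unfolding bounded_mat_def lpw2 lpw2_norm
    using main has_sum_imp_summable[OF idop_app[OF U]] by (auto simp: n_def)
qed

text \<open>Since \<open>D C = S\<close>, the product of \<open>1 + C U D\<close> and \<open>1 + C V D\<close> is \<open>1 + C (U + V + U S V) D\<close>.\<close>

lemma idop_inverse_app:
  assumes U: "clin U" and V: "clin V" and inv: "\<And>x. U x + V x + U (S (V x)) = 0"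
    and c: "sq_summable c"
  shows "mat_app (idop U) (mat_app (idop V) c) = c"
proof -
  define D where "D = synthesis \<psi> c"
  have e: "mat_app (idop V) c = (\<lambda>i. c i + analysis \<psi> (V D) i)"
    by (simp add: mat_app_idop[OF V c] D_def)
  have s: "sq_summable (mat_app (idop V) c)"
    unfolding e by (rule sq_summable_add(1)[OF c sq_summable_analysis])
  have d: "synthesis \<psi> (mat_app (idop V) c) = D + S (V D)"
    by (simp add: e synthesis_add[OF bessel c sq_summable_analysis] synthesis_analysis D_def)
  have "mat_app (idop U) (mat_app (idop V) c) = (\<lambda>i. c i + analysis \<psi> (U D + V D + U (S (V D))) i)"
    unfolding mat_app_idop[OF U s] d by (simp add: e clin_add[OF U] analysis_add fun_eq_iff)
  then show ?thesis by (simp add: inv analysis_def)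
qed

section \<open>Resolvents of the frame operator\<close>

text \<open>Half the lower frame bound: the circle of radius \<open>r\<close> separates \<open>0\<close> from the rest of the spectrum of
  the Gram matrix.\<close>

definition r :: complex where "r = complex_of_real (a / 2)"

lemma r_ne0 [simp]: "r \<noteq> 0" using a_pos by (simp add: r_def)

text \<open>The operator norm of \<open>r Q\<close> is at most \<open>1/2\<close>, because that of \<open>Q\<close> is at most \<open>1/a\<close>.\<close>

definition R :: "'h \<Rightarrow> 'h" where "R x = r *\<^sub>C Q x"

lemma clin_R: "clin R" unfolding R_def by (intro clin_scale clin_Q)

lemma R_bound: "norm (R x) \<le> norm x / 2"
  using Q_bound[of x] a_pos by (simp add: R_def r_def norm_scaleC norm_divide field_simps)

lemma clin_sR: "clin (\<lambda>x. s *\<^sub>C R x)" by (intro clin_scale clin_R)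

definition E :: "complex \<Rightarrow> 'h \<Rightarrow> 'h" where "E s = inv (\<lambda>x. x - s *\<^sub>C R x)"

context
  fixes s :: complex assumes s: "cmod s = 1"
begin

lemma sR_bound: "norm (s *\<^sub>C R x) \<le> 1 / 2 * norm x"
  using R_bound[of x] by (simp add: norm_scaleC s)

lemma one_minus_sR_bij: "bij (\<lambda>x. x - s *\<^sub>C R x)"
  by (rule contraction_bij[OF clin_sR _ _ sR_bound]) auto

lemma E_right: "E s x - s *\<^sub>C R (E s x) = x"
  using surj_f_inv_f[OF bij_is_surj[OF one_minus_sR_bij], of x] by (simp add: E_def)

lemma E_left: "E s (x - s *\<^sub>C R x) = x"
  using inv_f_f[OF bij_is_inj[OF one_minus_sR_bij], of x] by (simp add: E_def)

lemma clin_E: "clin (E s)" and E_bound: "norm (E s x) \<le> 2 * norm x"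
proof -
  have "1 / 2 * norm x \<le> norm (x - s *\<^sub>C R x)" for x
    using sR_bound[of x] norm_triangle_ineq2[of x "s *\<^sub>C R x"] by simp
  from inv_clin[OF clin_sub[OF clin_id clin_sR] one_minus_sR_bij _ this]
  show "clin (E s)" "norm (E s x) \<le> 2 * norm x" by (auto simp: E_def mult.commute)
qed

lemma E_Q: "E s (Q x) = Q (E s x)"
proof -
  have "Q x = Q (E s x - s *\<^sub>C R (E s x))" by (simp add: E_right)
  also have "\<dots> = Q (E s x) - s *\<^sub>C R (Q (E s x))"
    by (simp add: clin_diff[OF clin_Q] clin_scaleC[OF clin_Q] R_def scaleC_scaleC)
  finally show ?thesis using E_left by simp
qed

lemma s_ne0: "s \<noteq> 0" using s by auto

lemma QE: "Q (E s x) = (1 / (s * r)) *\<^sub>C (E s x - x)"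
proof -
  have "E s x - x = (s * r) *\<^sub>C Q (E s x)"
    using E_right[of x] by (simp add: R_def scaleC_scaleC algebra_simps)
  then show ?thesis using s_ne0 by (simp add: scaleC_scaleC)
qed

text \<open>The Neumann series of \<open>E s = (1 - s R)\<inverse>\<close>, stopped after \<open>n\<close> terms and with its exact remainder.\<close>

lemma E_expand: "E s x = (\<Sum>m<n. s ^ m *\<^sub>C (R ^^ m) x) + s ^ n *\<^sub>C (R ^^ n) (E s x)"
proof (induction n)
  case (Suc n)
  have cl: "clin (R ^^ n)" for n
    by (induction n) (auto intro: clin_compose[OF clin_R] clin_id simp: o_def id_def)
  have "E s x = x + s *\<^sub>C R (E s x)" using E_right[of x] by (simp add: algebra_simps)
  then have "(R ^^ n) (E s x) = (R ^^ n) (x + s *\<^sub>C R (E s x))" by simp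
  also have "\<dots> = (R ^^ n) x + s *\<^sub>C (R ^^ Suc n) (E s x)"
    by (simp add: clin_add[OF cl] clin_scaleC[OF cl] funpow_swap1)
  finally have "s ^ n *\<^sub>C (R ^^ n) (E s x) = s ^ n *\<^sub>C ((R ^^ n) x + s *\<^sub>C (R ^^ Suc n) (E s x))"
    by (rule arg_cong)
  also have "\<dots> = s ^ n *\<^sub>C (R ^^ n) x + s ^ Suc n *\<^sub>C (R ^^ Suc n) (E s x)"
    by (simp add: scaleC_add_right scaleC_scaleC mult.commute)
  finally have "(\<Sum>m<n. s ^ m *\<^sub>C (R ^^ m) x) + s ^ n *\<^sub>C (R ^^ n) (E s x)
      = (\<Sum>m<Suc n. s ^ m *\<^sub>C (R ^^ m) x) + s ^ Suc n *\<^sub>C (R ^^ Suc n) (E s x)"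
    by (simp only: sum.lessThan_Suc add.assoc)
  then show ?case using Suc by (rule trans[rotated])
qed simp

end

lemma R_pow_bound: "norm ((R ^^ n) x) \<le> (1 / 2) ^ n * norm x"
proof (induction n)
  case (Suc n)
  have "norm ((R ^^ Suc n) x) \<le> norm ((R ^^ n) x) / 2" using R_bound by simp
  then show ?case using Suc by simp
qed simp

text \<open>For \<open>|s| = 1\<close> this is the inverse of \<open>1 - G / (s r)\<close>, that is, up to a scalar the resolvent of the Gram
  matrix at the point \<open>s r\<close>.\<close>

definition M :: "complex \<Rightarrow> 'i matrix" where "M s = idop (\<lambda>x. - Q (E s x))"

lemma clin_QE: "cmod s = 1 \<Longrightarrow> clin (\<lambda>x. - Q (E s x))"
  by (intro clin_uminus clin_compose[OF clin_Q] clin_E)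

lemma resolvent_identity:
  assumes s: "cmod s = 1" and t: "cmod t = 1"
  shows "M s i j - M t i j = (t - s) / (r * t * s) * mat_mult (M t) (mat_mult (gram \<psi>) (M s)) i j"
proof -
  have gm: "mat_mult (gram \<psi>) (M s) = opmat (\<lambda>x. x - E s x)"
    unfolding gram_opmat M_def opmat_mult_idop[OF clin_id]
    by (simp add: clin_minus[OF clin_S])
  have mgm: "mat_mult (M t) (opmat (\<lambda>x. x - E s x)) = opmat (\<lambda>x. (x - E s x) - E t (x - E s x))"
    unfolding M_def idop_mult_opmat[OF clin_QE[OF t]]
    by (simp add: E_Q[OF t, symmetric])
  have key: "- Q (E s x) + Q (E t x) = ((t - s) / (r * t * s)) *\<^sub>C ((x - E s x) - E t (x - E s x))" for x
  proof -
    have 1: "x - E s x = (- s) *\<^sub>C R (E s x)"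
      using E_right[OF s, of x] by (simp add: scaleC_minus_left algebra_simps)
    have 2: "y - E t y = (- t) *\<^sub>C R (E t y)" for y
      using E_right[OF t, of y] by (simp add: scaleC_minus_left algebra_simps)
    have RE: "E t (R y) = R (E t y)" for y
      by (simp add: R_def clin_scaleC[OF clin_E[OF t]] E_Q[OF t])
    have 3: "(x - E s x) - E t (x - E s x) = (t * s) *\<^sub>C R (R (E t (E s x)))"
      unfolding 2 unfolding 1
      by (simp add: clin_scaleC[OF clin_E[OF t]] clin_minus[OF clin_E[OF t]] clin_minus[OF clin_R] RE
          clin_scaleC[OF clin_R] scaleC_scaleC scaleC_minus_left scaleC_minus_right)
    have "E t x = E t (E s x) - s *\<^sub>C R (E t (E s x))"
      using arg_cong[OF E_right[OF s, of x], of "E t"]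
      by (simp add: clin_diff[OF clin_E[OF t]] clin_scaleC[OF clin_E[OF t]] RE)
    moreover have "E s x = E t (E s x) - t *\<^sub>C R (E t (E s x))"
      using E_left[OF t, of "E s x"]
      by (simp add: clin_diff[OF clin_E[OF t]] clin_scaleC[OF clin_E[OF t]] RE)
    ultimately have "E t x - E s x = (t - s) *\<^sub>C R (E t (E s x))"
      by (simp add: scaleC_diff_left algebra_simps)
    then have "- Q (E s x) + Q (E t x) = (t - s) *\<^sub>C Q (R (E t (E s x)))"
      by (metis clin_diff[OF clin_Q] clin_scaleC[OF clin_Q] uminus_add_conv_diff)
    also have "\<dots> = ((t - s) / (r * t * s)) *\<^sub>C ((t * s) *\<^sub>C R (R (E t (E s x))))"
      using s_ne0[OF s] s_ne0[OF t] by (subst (2) R_def) (simp add: scaleC_scaleC)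
    finally show ?thesis by (simp add: 3)
  qed
  have "M s i j - M t i j = cinner (- Q (E s (\<psi> j)) + Q (E t (\<psi> j))) (\<psi> i)"
    by (simp add: M_def idop_def opmat_def cinner_add_left cinner_minus_left cinner_diff_left)
  then show ?thesis unfolding gm mgm key by (simp add: opmat_def cinner_scaleC_left)
qed

section \<open>Averages of resolvents over roots of unity\<close>

definition \<omega> :: "nat \<Rightarrow> complex" where "\<omega> n = cis (2 * pi / 2 ^ n)"

text \<open>A Riemann sum for the contour integral that defines the Riesz projection of the Gram matrix at \<open>0\<close>.\<close>

definition avg :: "nat \<Rightarrow> 'i matrix"
  where "avg n i j = (1 / 2 ^ n) * (\<Sum>k<2 ^ n. M (\<omega> n ^ k) i j)"

lemma cmod_\<omega>_pow [simp]: "cmod (\<omega> n ^ k) = 1"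
  by (simp add: \<omega>_def norm_power)

lemma sum_\<omega>_pow:
  assumes "m < 2 ^ n"
  shows "(\<Sum>k<2 ^ n. (\<omega> n ^ k) ^ m) = (if m = 0 then 2 ^ n else 0)"
proof (cases "m = 0")
  case False
  define z where "z = \<omega> n ^ m"
  have z: "z = cis (2 * pi * m / 2 ^ n)" unfolding z_def \<omega>_def Complex.DeMoivre by (rule arg_cong[where f = cis]) simp
  have "real m / 2 ^ n < 1"
    using assms by (simp add: field_simps)
  then have "2 * pi * m / 2 ^ n < 2 * pi"
    using mult_strict_left_mono[of "real m / 2 ^ n" 1 "2 * pi"] by simp
  then have "z \<noteq> 1"
    using exp_i_ne_1[of "2 * pi * m / 2 ^ n"] False by (simp add: z cis_conv_exp)
  moreover have "z ^ 2 ^ n = 1"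
    unfolding z Complex.DeMoivre using cis_multiple_2pi[of "real m"] by (simp add: mult_ac)
  ultimately have "(\<Sum>k<2 ^ n. z ^ k) = 0" by (simp add: geometric_sum)
  then show ?thesis using False by (simp add: z_def power_mult[symmetric] mult.commute)
qed simp

text \<open>Averaging \<open>s^m\<close> over the roots of unity of order \<open>2^n\<close> gives zero for \<open>0 < m < 2^n\<close>. Of the Neumann
  series only the constant term and a remainder of size \<open>(1/2)^(2^n)\<close> are left.\<close>

lemma E_average: "norm ((1 / 2 ^ n) *\<^sub>C (\<Sum>k<2 ^ n. E (\<omega> n ^ k) x) - x) \<le> 2 * norm x * (1 / 2) ^ 2 ^ n"
proof -
  define L :: nat where "L = 2 ^ n"
  have L: "L > 0" by (simp add: L_def)
  have "(\<Sum>k<L. \<Sum>m<L. (\<omega> n ^ k) ^ m *\<^sub>C (R ^^ m) x) = (\<Sum>m<L. (\<Sum>k<L. (\<omega> n ^ k) ^ m) *\<^sub>C (R ^^ m) x)"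
    unfolding scaleC_sum_left by (rule sum.swap)
  also have "\<dots> = (\<Sum>m<L. if m = 0 then of_nat L *\<^sub>C x else 0)"
    by (rule sum.cong) (auto simp: sum_\<omega>_pow L_def)
  also have "\<dots> = of_nat L *\<^sub>C x" using L by simp
  finally have m: "(\<Sum>k<L. \<Sum>m<L. (\<omega> n ^ k) ^ m *\<^sub>C (R ^^ m) x) = of_nat L *\<^sub>C x" .
  have "(\<Sum>k<L. E (\<omega> n ^ k) x) = of_nat L *\<^sub>C x + (\<Sum>k<L. (\<omega> n ^ k) ^ L *\<^sub>C (R ^^ L) (E (\<omega> n ^ k) x))"
    unfolding m[symmetric] sum.distrib[symmetric]
    by (rule sum.cong[OF refl]) (rule E_expand, simp)
  then have "(1 / of_nat L) *\<^sub>C (\<Sum>k<L. E (\<omega> n ^ k) x) - x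
      = (1 / of_nat L) *\<^sub>C (\<Sum>k<L. (\<omega> n ^ k) ^ L *\<^sub>C (R ^^ L) (E (\<omega> n ^ k) x))"
    using L by (simp add: scaleC_add_right scaleC_scaleC)
  moreover have "norm (\<Sum>k<L. (\<omega> n ^ k) ^ L *\<^sub>C (R ^^ L) (E (\<omega> n ^ k) x)) \<le> of_nat (card {..<L}) * (2 * norm x * (1 / 2) ^ L)"
  proof (rule sum_norm_bound)
    fix k
    have "norm ((R ^^ L) (E (\<omega> n ^ k) x)) \<le> (1 / 2) ^ L * (2 * norm x)"
      using R_pow_bound[of L "E (\<omega> n ^ k) x"] mult_left_mono[OF E_bound[of "\<omega> n ^ k" x], of "(1/2) ^ L"]
      by (meson cmod_\<omega>_pow order_trans zero_le_power zero_le_divide_1_iff zero_le_numeral)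
    then show "norm ((\<omega> n ^ k) ^ L *\<^sub>C (R ^^ L) (E (\<omega> n ^ k) x)) \<le> 2 * norm x * (1 / 2) ^ L"
      unfolding norm_scaleC norm_power[of "\<omega> n ^ k"] cmod_\<omega>_pow by (simp add: mult_ac)
  qed
  ultimately have "norm ((1 / of_nat L) *\<^sub>C (\<Sum>k<L. E (\<omega> n ^ k) x) - x) \<le> 2 * norm x * (1 / 2) ^ L"
    using L by (simp add: norm_scaleC norm_divide field_simps)
  then show ?thesis by (simp add: L_def)
qed

text \<open>The matrix of \<open>Q\<close> is \<open>P\<close>, so the limit is \<open>1 - P\<close>.\<close>

lemma avg_limit: "(\<lambda>n. avg n i j) \<longlonglongrightarrow> mat_one i j - opmat Q i j"
proof -
  define F where "F n = (1 / 2 ^ n) *\<^sub>C (\<Sum>k<2 ^ n. E (\<omega> n ^ k) (\<psi> j))" for n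
  have avg: "avg n i j = mat_one i j - cinner (Q (F n)) (\<psi> i)" for n
  proof -
    have "Q (F n) = (1 / 2 ^ n) *\<^sub>C (\<Sum>k<2 ^ n. Q (E (\<omega> n ^ k) (\<psi> j)))"
      by (simp add: F_def clin_scaleC[OF clin_Q] clin_sum[OF clin_Q])
    then show ?thesis
      by (simp add: avg_def M_def idop_def opmat_def cinner_minus_left cinner_scaleC_left
          cinner_sum_left sum_subtractf diff_divide_distrib)
  qed
  have "(\<lambda>n. F n - \<psi> j) \<longlonglongrightarrow> 0"
  proof (rule Lim_null_comparison)
    show "\<forall>\<^sub>F n in sequentially. norm (F n - \<psi> j) \<le> 2 * norm (\<psi> j) * (1 / 2) ^ n"
    proof (rule always_eventually, rule allI)
      fix n
      have "(1 / 2 :: real) ^ 2 ^ n \<le> (1 / 2) ^ n" by (rule power_decreasing) (auto simp: less_imp_le)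
      then have "2 * norm (\<psi> j) * (1 / 2) ^ 2 ^ n \<le> 2 * norm (\<psi> j) * (1 / 2) ^ n"
        by (intro mult_left_mono) auto
      then show "norm (F n - \<psi> j) \<le> 2 * norm (\<psi> j) * (1 / 2) ^ n"
        using E_average[of n "\<psi> j"] by (simp add: F_def)
    qed
    show "(\<lambda>n. 2 * norm (\<psi> j) * (1 / 2) ^ n) \<longlonglongrightarrow> 0"
      by (intro tendsto_mult_right_zero LIMSEQ_power_zero) simp
  qed
  then have "F \<longlonglongrightarrow> \<psi> j" by (simp add: LIM_zero_iff)
  then have "(\<lambda>n. cinner (Q (F n)) (\<psi> i)) \<longlonglongrightarrow> cinner (Q (\<psi> j)) (\<psi> i)"
    by (intro bounded_linear.tendsto[OF bounded_linear_cinner_left]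
        bounded_linear.tendsto[OF clin_bounded_linear[OF clin_Q]])
  then show ?thesis unfolding avg opmat_def by (intro tendsto_intros)
qed

text \<open>The roots of order \<open>2^(n+1)\<close> form pairs of neighbours, each of which contains one root of order \<open>2^n\<close>.\<close>

lemma avg_step:
  "avg (Suc n) i j - avg n i j =
    (1 / 2 ^ Suc n) * (\<Sum>k<2 ^ n. M (\<omega> (Suc n) ^ (2 * k + 1)) i j - M (\<omega> (Suc n) ^ (2 * k)) i j)"
proof -
  have sq: "\<omega> (Suc n) ^ (2 * k) = \<omega> n ^ k" for k
    unfolding \<omega>_def Complex.DeMoivre by (rule arg_cong[where f = cis]) simp
  have split: "(\<Sum>k<2 * m. f k) = (\<Sum>k<m. f (2 * k) + f (2 * k + 1))" for f :: "nat \<Rightarrow> complex" and m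
    by (induction m) (auto simp: algebra_simps)
  show ?thesis
    unfolding avg_def power_Suc[of 2] split sq by (simp add: sum.distrib sum_subtractf field_simps)
qed

lemma \<omega>_step: "cmod (\<omega> (Suc n) ^ (2 * k + 1) - \<omega> (Suc n) ^ (2 * k)) \<le> 2 * pi / 2 ^ Suc n"
proof -
  have "\<omega> (Suc n) ^ (2 * k + 1) - \<omega> (Suc n) ^ (2 * k) = \<omega> (Suc n) ^ (2 * k) * (\<omega> (Suc n) - 1)"
    by (simp add: algebra_simps)
  then have "cmod (\<omega> (Suc n) ^ (2 * k + 1) - \<omega> (Suc n) ^ (2 * k)) = cmod (\<omega> (Suc n) - 1)"
    by (simp only: norm_mult cmod_\<omega>_pow)
  also have "\<dots> = 2 * \<bar>sin ((2 * pi / 2 ^ Suc n) / 2)\<bar>"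
    unfolding \<omega>_def cis_conv_exp by (rule dist_exp_i_1)
  also have "\<dots> \<le> 2 * \<bar>(2 * pi / 2 ^ Suc n) / 2\<bar>"
    by (rule mult_left_mono[OF abs_sin_x_le_abs_x]) simp
  finally show ?thesis by simp
qed

end

section \<open>Spectral matrix algebras\<close>

context spectral_matrix_algebra
begin

lemma zero: "(\<lambda>i j. 0) \<in> \<A>"
  using scale[OF one, of 0] by simp

lemma norm_zero: "N (\<lambda>i j. 0) = 0"
  using norm_eq_0[OF zero] by simp

lemma diff: "A \<in> \<A> \<Longrightarrow> B \<in> \<A> \<Longrightarrow> (\<lambda>i j. A i j - B i j) \<in> \<A>"
  using add[of A "\<lambda>i j. (- 1) * B i j"] scale[of B "- 1"] by simp

lemma sum_mem: "finite K \<Longrightarrow> (\<And>k. k \<in> K \<Longrightarrow> X k \<in> \<A>) \<Longrightarrow> (\<lambda>i j. \<Sum>k\<in>K. X k i j) \<in> \<A>"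
  by (induction K rule: finite_induct) (auto simp: zero intro: add)

lemma norm_sum:
  "finite K \<Longrightarrow> (\<And>k. k \<in> K \<Longrightarrow> X k \<in> \<A>) \<Longrightarrow> N (\<lambda>i j. \<Sum>k\<in>K. X k i j) \<le> (\<Sum>k\<in>K. N (X k))"
proof (induction K rule: finite_induct)
  case (insert k K)
  have "N (\<lambda>i j. X k i j + (\<Sum>k\<in>K. X k i j)) \<le> N (X k) + N (\<lambda>i j. \<Sum>k\<in>K. X k i j)"
    using insert by (intro norm_add sum_mem) auto
  then show ?case using insert by simp
qed (simp add: norm_zero)

text \<open>If some member of the algebra has a nonzero entry at \<open>(i, j)\<close>, then by solidity the matrix unit at
  \<open>(i, j)\<close> is a member, too, and \<open>A\<close> dominates \<open>A i j\<close> times that unit. If no member has such an entry,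
  there is nothing to show. Hence convergence in the algebra implies convergence of the entries.\<close>

lemma entry_bound: "\<exists>\<kappa>>0. \<forall>A\<in>\<A>. \<kappa> * cmod (A i j) \<le> N A"
proof -
  define D where "D k l = (if k = i \<and> l = j then 1 else 0 :: complex)" for k l
  have D: "D \<in> \<A> \<and> cmod (A i j) * N D \<le> N A" if A: "A \<in> \<A>" "A i j \<noteq> 0" for A
  proof -
    have sc: "(\<lambda>k l. A i j * D k l) \<in> \<A> \<and> N (\<lambda>k l. A i j * D k l) \<le> N A"
      by (rule solid[OF A(1)]) (simp add: D_def)
    have "(\<lambda>k l. (1 / A i j) * (A i j * D k l)) \<in> \<A>" by (rule scale[OF conjunct1[OF sc]])
    moreover have "(\<lambda>k l. (1 / A i j) * (A i j * D k l)) = D" using A by (auto simp: fun_eq_iff)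
    ultimately have "D \<in> \<A>" by simp
    then show ?thesis using sc by (simp add: norm_scale)
  qed
  have "D i j = 1" by (simp add: D_def)
  then have nz: "D \<noteq> (\<lambda>i j. 0)" by (metis zero_neq_one)
  have pos: "N D > 0" if "D \<in> \<A>"
    using norm_eq_0[OF that] norm_nonneg[OF that] nz by simp
  show ?thesis
  proof (rule exI[of _ "if D \<in> \<A> then N D else 1"], intro conjI ballI)
    show "0 < (if D \<in> \<A> then N D else 1)" using pos by simp
    fix A assume A: "A \<in> \<A>"
    show "(if D \<in> \<A> then N D else 1) * cmod (A i j) \<le> N A"
      using D[OF A] norm_nonneg[OF A] by (cases "A i j = 0") (auto simp: mult.commute)
  qed
qed

lemma entry_tendsto:
  assumes A: "A \<in> \<A>" and X: "\<And>n. X n \<in> \<A>" and lim: "(\<lambda>n. N (\<lambda>i j. X n i j - A i j)) \<longlonglongrightarrow> 0"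
  shows "(\<lambda>n. X n i j) \<longlonglongrightarrow> A i j"
proof -
  obtain \<kappa> where \<kappa>: "\<kappa> > 0" "\<And>A. A \<in> \<A> \<Longrightarrow> \<kappa> * cmod (A i j) \<le> N A" using entry_bound by blast
  have "(\<lambda>n. X n i j - A i j) \<longlonglongrightarrow> 0"
  proof (rule Lim_null_comparison)
    show "\<forall>\<^sub>F n in sequentially. norm (X n i j - A i j) \<le> N (\<lambda>i j. X n i j - A i j) / \<kappa>"
      using \<kappa>(2)[OF diff[OF X A]] \<kappa>(1) by (simp add: field_simps)
    show "(\<lambda>n. N (\<lambda>i j. X n i j - A i j) / \<kappa>) \<longlonglongrightarrow> 0"
      using tendsto_divide[OF lim tendsto_const[of \<kappa>]] \<kappa> by simp
  qed
  then show ?thesis by (simp add: LIM_zero_iff)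
qed

lemma geometric_limit:
  assumes X: "\<And>n. X n \<in> \<A>" and step: "\<And>n. N (\<lambda>i j. X (Suc n) i j - X n i j) \<le> D * (1 / 2) ^ n"
  shows "\<exists>A\<in>\<A>. \<forall>i j. (\<lambda>n. X n i j) \<longlonglongrightarrow> A i j"
proof -
  have D: "D \<ge> 0" using step[of 0] norm_nonneg[OF diff[OF X X], of "Suc 0" 0] by simp
  have far: "N (\<lambda>i j. X (m + d) i j - X m i j) \<le> D * (1 / 2) ^ m * (2 - 2 * (1 / 2) ^ d)" for m d
  proof (induction d)
    case (Suc d)
    have "N (\<lambda>i j. (X (Suc (m + d)) i j - X (m + d) i j) + (X (m + d) i j - X m i j))
        \<le> N (\<lambda>i j. X (Suc (m + d)) i j - X (m + d) i j) + N (\<lambda>i j. X (m + d) i j - X m i j)"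
      by (intro norm_add diff X)
    also have "\<dots> \<le> D * (1 / 2) ^ (m + d) + D * (1 / 2) ^ m * (2 - 2 * (1 / 2) ^ d)"
      by (intro add_mono step Suc)
    also have "\<dots> = D * (1 / 2) ^ m * (2 - 2 * (1 / 2) ^ Suc d)"
      by (simp add: power_add algebra_simps)
    finally show ?case by simp
  qed (simp add: norm_zero)
  have far': "N (\<lambda>i j. X n i j - X m i j) \<le> 2 * D * (1 / 2) ^ m" if "m \<le> n" for m n
  proof -
    obtain d where d: "n = m + d" using \<open>m \<le> n\<close> le_Suc_ex by blast
    have "D * (1 / 2) ^ m * (2 - 2 * (1 / 2) ^ d) \<le> D * (1 / 2) ^ m * 2"
      using D by (intro mult_left_mono) auto
    then show ?thesis using far[of m d] by (simp add: d)
  qed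
  have sym: "N (\<lambda>i j. X m i j - X n i j) = N (\<lambda>i j. X n i j - X m i j)" for m n
    using norm_scale[OF diff[OF X X], of "- 1" n m] by simp
  have "\<exists>A\<in>\<A>. (\<lambda>n. N (\<lambda>i j. X n i j - A i j)) \<longlonglongrightarrow> 0"
  proof (rule complete)
    fix e :: real assume "e > 0"
    have "(\<lambda>m. 2 * D * (1 / 2 :: real) ^ m) \<longlonglongrightarrow> 0"
      by (intro tendsto_mult_right_zero LIMSEQ_power_zero) simp
    then obtain n0 where n0: "\<And>m. m \<ge> n0 \<Longrightarrow> 2 * D * (1 / 2) ^ m < e"
      using \<open>e > 0\<close> order_tendstoD(2) by (fastforce simp: eventually_sequentially)
    have "N (\<lambda>i j. X m i j - X n i j) < e" if "m \<ge> n0" "n \<ge> n0" for m n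
      using far'[of m n] far'[of n m] sym[of m n] n0[of m] n0[of n] that by (cases "m \<le> n") auto
    then show "\<exists>n0. \<forall>m\<ge>n0. \<forall>n\<ge>n0. N (\<lambda>i j. X m i j - X n i j) < e" by blast
  qed (rule X)
  then show ?thesis using entry_tendsto X by blast
qed

end

section \<open>The dual of a localised frame is localised\<close>

locale localised_frame_bounds = frame_bounds \<psi> a b + spectral_matrix_algebra \<A> N
  for \<psi> :: "'i \<Rightarrow> 'h::chilbert_space" and a b \<A> N +
  assumes gram: "gram \<psi> \<in> \<A>"
begin

lemma idop_inverse_mem:
  assumes U: "clin U" and V: "clin V" and mem: "idop U \<in> \<A>"
    and 1: "\<And>x. U x + V x + U (S (V x)) = 0" and 2: "\<And>x. U x + V x + V (S (U x)) = 0"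
  shows "idop V \<in> \<A>"
proof (rule inverse_closed[OF mem idop_bounded[OF V]])
  fix c :: "'i \<Rightarrow> complex" assume "c \<in> lp 2"
  then have c: "sq_summable c" by (simp add: lp_def)
  show "mat_app (idop U) (mat_app (idop V) c) = c \<and> mat_app (idop V) (mat_app (idop U) c) = c"
    using idop_inverse_app[OF U V 1 c] idop_inverse_app[OF V U _ c] 2 by (simp add: add.commute)
qed

lemma M_mem:
  assumes s: "cmod s = 1"
  shows "M s \<in> \<A>"
  unfolding M_def
proof (rule idop_inverse_mem[where U = "\<lambda>x. (- (1 / (s * r))) *\<^sub>C x"])
  show "clin (\<lambda>x::'h. (- (1 / (s * r))) *\<^sub>C x)" by (intro clin_scale clin_id)
  show "clin (\<lambda>x. - Q (E s x))" by (rule clin_QE[OF s])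
  have "idop (\<lambda>x. (- (1 / (s * r))) *\<^sub>C x) = (\<lambda>i j. mat_one i j + (- (1 / (s * r))) * gram \<psi> i j)"
    by (simp add: fun_eq_iff idop_def opmat_def gram_def cinner_scaleC_left)
  then show "idop (\<lambda>x. (- (1 / (s * r))) *\<^sub>C x) \<in> \<A>"
    by (rule ssubst) (rule add[OF one scale[OF gram]])
  have 1: "S (- Q (E s x)) = - E s x" for x by (simp add: clin_minus[OF clin_S])
  show "(- (1 / (s * r))) *\<^sub>C x + - Q (E s x) + (- (1 / (s * r))) *\<^sub>C S (- Q (E s x)) = 0" for x
    by (simp only: 1) (simp add: QE[OF s] scaleC_minus_left scaleC_minus_right scaleC_diff_right)
  have 2: "Q (E s (S ((- (1 / (s * r))) *\<^sub>C x))) = (- (1 / (s * r))) *\<^sub>C E s x" for x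
    unfolding E_Q[OF s, symmetric] QS by (rule clin_scaleC[OF clin_E[OF s]])
  show "(- (1 / (s * r))) *\<^sub>C x + - Q (E s x) + - Q (E s (S ((- (1 / (s * r))) *\<^sub>C x))) = 0" for x
    by (simp only: 2) (simp add: QE[OF s] scaleC_minus_left scaleC_diff_right)
qed

lemma gram_norm_nonneg: "N (gram \<psi>) \<ge> 0" by (rule norm_nonneg[OF gram])

lemma M_diff:
  assumes s: "cmod s = 1" and t: "cmod t = 1"
  shows "N (\<lambda>i j. M s i j - M t i j) \<le> cmod (t - s) * (N (gram \<psi>) / cmod r) * N (M t) * N (M s)"
proof -
  have "N (\<lambda>i j. M s i j - M t i j)
      = cmod ((t - s) / (r * t * s)) * N (\<lambda>i j. mat_mult (M t) (mat_mult (gram \<psi>) (M s)) i j)"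
    unfolding resolvent_identity[OF s t]
    by (rule norm_scale) (intro mult M_mem s t gram)
  also have "\<dots> \<le> cmod ((t - s) / (r * t * s)) * (N (M t) * (N (gram \<psi>) * N (M s)))"
    by (intro mult_left_mono order_trans[OF norm_mult] norm_mult mult M_mem s t gram norm_nonneg) auto
  finally show ?thesis using s t by (simp add: norm_mult norm_divide Real_Vector_Spaces.norm_mult mult_ac)
qed

text \<open>By the resolvent identity \<open>N (M s) \<le> 2 * N (M t)\<close> whenever \<open>s\<close> is close to \<open>t\<close>, and the circle is
  compact.\<close>

lemma M_norm_bounded: "\<exists>K\<ge>0. \<forall>s. cmod s = 1 \<longrightarrow> N (M s) \<le> K"
proof (rule ccontr)
  assume "\<not> ?thesis"
  then have "\<forall>n::nat. \<exists>s. cmod s = 1 \<and> N (M s) > n"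
    by (metis not_less of_nat_0_le_iff)
  then obtain s where s: "\<And>n::nat. cmod (s n) = 1" "\<And>n::nat. N (M (s n)) > n" by metis
  have "compact (sphere (0::complex) 1)" by simp
  then obtain t \<rho> where t: "cmod t = 1" and \<rho>: "strict_mono \<rho>" and lim: "(s \<circ> \<rho>) \<longlonglongrightarrow> t"
    using s(1) unfolding compact_def by (metis (no_types, lifting) dist_0_norm mem_sphere)
  define c where "c = (N (gram \<psi>) / cmod r) * N (M t)"
  have c: "c \<ge> 0" unfolding c_def by (intro mult_nonneg_nonneg divide_nonneg_nonneg gram_norm_nonneg norm_nonneg M_mem t) auto
  have "(\<lambda>n. cmod (t - s (\<rho> n)) * c) \<longlonglongrightarrow> cmod (t - t) * c"
    using lim by (intro tendsto_intros) (simp add: o_def)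
  then have "eventually (\<lambda>n. cmod (t - s (\<rho> n)) * c < 1 / 2) sequentially"
    by (intro order_tendstoD(2)) auto
  then obtain n0 where n0: "\<And>n. n \<ge> n0 \<Longrightarrow> cmod (t - s (\<rho> n)) * c < 1 / 2"
    by (auto simp: eventually_sequentially)
  \<comment> \<open>An index so large that \<open>N (M u) \<le> 2 * N (M t)\<close> contradicts the choice of the sequence.\<close>
  define n where "n = max n0 (nat \<lceil>2 * N (M t)\<rceil>)"
  define u where "u = s (\<rho> n)"
  have u: "cmod u = 1" using s by (simp add: u_def)
  have nn: "N (M u) \<ge> 0" by (rule norm_nonneg[OF M_mem[OF u]])
  have "N (M u) = N (\<lambda>i j. M t i j + (M u i j - M t i j))" by simp
  also have "\<dots> \<le> N (M t) + N (\<lambda>i j. M u i j - M t i j)"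
    by (intro norm_add diff M_mem u t)
  also have "N (\<lambda>i j. M u i j - M t i j) \<le> (cmod (t - u) * c) * N (M u)"
    using M_diff[OF u t] by (simp add: c_def mult_ac)
  also have "\<dots> \<le> 1 / 2 * N (M u)"
    using n0[of n] nn by (intro mult_right_mono) (auto simp: n_def u_def)
  finally have "N (M u) \<le> 2 * N (M t)" by simp
  moreover have "2 * N (M t) \<le> n" unfolding n_def by linarith
  moreover have "n \<le> \<rho> n" using \<rho> by (rule seq_suble)
  moreover have "N (M u) > \<rho> n" unfolding u_def by (rule s(2))
  ultimately show False by linarith
qed

text \<open>With \<open>L\<close> a Lipschitz constant of \<open>M\<close>, two consecutive averages differ by at most \<open>L * pi / 2^n\<close> in the norm of
  the algebra, so they converge there. The entrywise limit of the averages identifies the result.\<close>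

lemma range_projection_mem: "opmat Q \<in> \<A>"
proof -
  obtain K where K: "K \<ge> 0" "\<And>s. cmod s = 1 \<Longrightarrow> N (M s) \<le> K" using M_norm_bounded by blast
  define L where "L = (N (gram \<psi>) / cmod r) * K * K"
  have L: "L \<ge> 0" unfolding L_def using K(1) by (intro mult_nonneg_nonneg divide_nonneg_nonneg gram_norm_nonneg) auto
  have lip: "N (\<lambda>i j. M s i j - M t i j) \<le> cmod (s - t) * L" if "cmod s = 1" "cmod t = 1" for s t
  proof -
    have "cmod (t - s) * (N (gram \<psi>) / cmod r) * N (M t) * N (M s) \<le> cmod (t - s) * (N (gram \<psi>) / cmod r) * K * K"
      using norm_nonneg[OF M_mem] that K gram_norm_nonneg
      by (intro mult_mono K(2) mult_nonneg_nonneg divide_nonneg_nonneg order_refl) auto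
    then show ?thesis using M_diff[OF that] by (simp add: L_def norm_minus_commute mult_ac)
  qed
  have avg: "avg n \<in> \<A>" for n
  proof -
    have "(\<lambda>i j. (1 / 2 ^ n) * (\<Sum>k<2 ^ n. M (\<omega> n ^ k) i j)) \<in> \<A>"
      by (intro scale sum_mem M_mem) auto
    then show ?thesis by (simp add: avg_def[abs_def])
  qed
  have "\<exists>A\<in>\<A>. \<forall>i j. (\<lambda>n. avg n i j) \<longlonglongrightarrow> A i j"
  proof (rule geometric_limit[where D = "L * pi"])
    fix n
    have mem: "(\<lambda>i j. \<Sum>k<2 ^ n. M (\<omega> (Suc n) ^ (2 * k + 1)) i j - M (\<omega> (Suc n) ^ (2 * k)) i j) \<in> \<A>"
      by (intro sum_mem diff M_mem cmod_\<omega>_pow finite_lessThan)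
    have "N (\<lambda>i j. avg (Suc n) i j - avg n i j) = cmod (1 / 2 ^ Suc n) *
        N (\<lambda>i j. \<Sum>k<2 ^ n. M (\<omega> (Suc n) ^ (2 * k + 1)) i j - M (\<omega> (Suc n) ^ (2 * k)) i j)"
      unfolding avg_step by (rule norm_scale) (rule mem)
    also have "\<dots> \<le> cmod (1 / 2 ^ Suc n) *
        (\<Sum>k<2 ^ n. N (\<lambda>i j. M (\<omega> (Suc n) ^ (2 * k + 1)) i j - M (\<omega> (Suc n) ^ (2 * k)) i j))"
      by (intro mult_left_mono norm_sum diff M_mem cmod_\<omega>_pow finite_lessThan norm_ge_zero)
    also have "\<dots> \<le> cmod (1 / 2 ^ Suc n) * (\<Sum>k<(2::nat) ^ n. 2 * pi / 2 ^ Suc n * L)"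
      by (intro mult_left_mono sum_mono order_trans[OF lip] mult_right_mono \<omega>_step L
          cmod_\<omega>_pow norm_ge_zero)
    also have "\<dots> = L * pi * (1 / 2) ^ n / 2"
      by (simp add: norm_divide norm_power power_divide mult.commute)
    also have "\<dots> \<le> L * pi * (1 / 2) ^ n" using L by simp
    finally show "N (\<lambda>i j. avg (Suc n) i j - avg n i j) \<le> L * pi * (1 / 2) ^ n" .
  qed (rule avg)
  then obtain A where A: "A \<in> \<A>" "\<And>i j. (\<lambda>n. avg n i j) \<longlonglongrightarrow> A i j" by blast
  have "A i j = mat_one i j - opmat Q i j" for i j
    using LIMSEQ_unique[OF A(2) avg_limit] .
  then have "opmat Q = (\<lambda>i j. mat_one i j - A i j)" by (simp add: fun_eq_iff)
  then show ?thesis using diff[OF one A(1)] by simp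
qed

text \<open>The matrix \<open>G + 1 - P\<close> acts as \<open>G\<close> on the range of \<open>P\<close> and as the identity on its kernel; its inverse is
  the dual Gram matrix on the former and the identity on the latter.\<close>

lemma dual_gram_mem: "opmat (\<lambda>x. Q (Q x)) \<in> \<A>"
proof -
  have "idop (\<lambda>x. x - Q x) = (\<lambda>i j. mat_one i j + (gram \<psi> i j - opmat Q i j))"
    by (simp add: fun_eq_iff idop_def opmat_def gram_def cinner_diff_left)
  then have mem: "idop (\<lambda>x. x - Q x) \<in> \<A>"
    using add[OF one diff[OF gram range_projection_mem]] by simp
  have "idop (\<lambda>x. Q (Q x) - Q x) \<in> \<A>"
  proof (rule idop_inverse_mem[OF _ _ mem])
    show "clin (\<lambda>x. x - Q x)" by (intro clin_sub clin_id clin_Q)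
    show "clin (\<lambda>x. Q (Q x) - Q x)" by (intro clin_sub clin_compose[OF clin_Q clin_Q] clin_Q)
  qed (simp_all add: clin_diff[OF clin_S] clin_diff[OF clin_Q])
  then have "(\<lambda>i j. (idop (\<lambda>x. Q (Q x) - Q x) i j - mat_one i j) + opmat Q i j) \<in> \<A>"
    by (intro add diff one range_projection_mem)
  moreover have "(\<lambda>i j. (idop (\<lambda>x. Q (Q x) - Q x) i j - mat_one i j) + opmat Q i j) = opmat (\<lambda>x. Q (Q x))"
    by (simp add: fun_eq_iff idop_def opmat_def cinner_diff_left)
  ultimately show ?thesis by simp
qed

end

section \<open>Schur bounds\<close>

text \<open>Boundedness on the weighted \<open>\<ell>\<^sup>1\<close>-space, read off from the images of the unit vectors.\<close>

definition schur :: "('i \<Rightarrow> real) \<Rightarrow> 'i matrix \<Rightarrow> real \<Rightarrow> bool"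
  where "schur w A C \<longleftrightarrow> 0 \<le> C \<and> (\<forall>j F. finite F \<longrightarrow> (\<Sum>i\<in>F. cmod (A i j) * w i) \<le> C * w j)"

lemma admissible_schur:
  assumes w: "admissible_weight \<A> w" and A: "A \<in> \<A>"
  shows "\<exists>C. schur w A C"
proof -
  have wp: "w i > 0" for i using w by (simp add: admissible_weight_def)
  have "bounded_mat 1 w A" using w A by (simp add: admissible_weight_def)
  then obtain M where M: "\<And>c. c \<in> lpw 1 w \<Longrightarrow> mat_app A c \<in> lpw 1 w \<and> lpw_norm 1 w (mat_app A c) \<le> M * lpw_norm 1 w c"
    by (auto simp: bounded_mat_def)
  have nrm: "lpw_norm 1 w c = (\<Sum>\<^sub>\<infinity>i. cmod (c i) * w i)" for c
    using wp by (simp add: lpw_norm_def lp_norm_def norm_mult less_imp_le infsum_nonneg)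
  have mem: "c \<in> lpw 1 w \<longleftrightarrow> (\<lambda>i. cmod (c i) * w i) summable_on UNIV" for c
    using wp by (simp add: lpw_def lp_def norm_mult less_imp_le)
  have "(\<Sum>i\<in>F. cmod (A i j) * w i) \<le> max M 0 * w j" if F: "finite F" for j F
  proof -
    have d: "((\<lambda>i. cmod (mat_one i j) * w i) has_sum w j) UNIV"
      by (rule has_sum_finite_neutralI[where B = "{j}"]) (auto simp: mat_one_def)
    have e: "mat_app A (\<lambda>i. mat_one i j) = (\<lambda>i. A i j)"
      unfolding mat_app_def by (intro ext infsumI mat_one_has_sum')
    have "(\<lambda>i. mat_one i j) \<in> lpw 1 w" using d by (simp add: mem has_sum_imp_summable)
    from M[OF this] have s: "(\<lambda>i. cmod (A i j) * w i) summable_on UNIV"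
      and le: "(\<Sum>\<^sub>\<infinity>i. cmod (A i j) * w i) \<le> M * w j"
      by (simp_all add: e mem nrm infsumI[OF d])
    have "(\<Sum>i\<in>F. cmod (A i j) * w i) \<le> (\<Sum>\<^sub>\<infinity>i. cmod (A i j) * w i)"
      using s F wp by (intro finite_sum_le_infsum) (auto simp: less_imp_le)
    also note le
    also have "M * w j \<le> max M 0 * w j" using wp[of j] by (intro mult_right_mono) auto
    finally show ?thesis .
  qed
  then show ?thesis unfolding schur_def by (intro exI[of _ "max M 0"]) auto
qed

lemma localised_frame_schur:
  fixes \<psi> :: "'i \<Rightarrow> 'h::chilbert_space"
  assumes "spectral_matrix_algebra \<A> N" "localised_frame \<A> \<psi>" "admissible_weight \<A> w"
  shows "\<exists>C. schur w (gram \<psi>) C"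
    "\<exists>C. schur w (\<lambda>i j. cinner (\<psi> j) (canonical_dual \<psi> i)) C"
    "\<exists>C. schur w (gram (canonical_dual \<psi>)) C"
proof -
  obtain a b where "frame_bounds \<psi> a b" using assms(2) frame_obtain_bounds[of \<psi>] by (auto simp: localised_frame_def)
  then interpret localised_frame_bounds \<psi> a b \<A> N
    using assms by (intro localised_frame_bounds.intro) (auto simp: localised_frame_bounds_axioms_def localised_frame_def)
  show "\<exists>C. schur w (gram \<psi>) C" by (rule admissible_schur[OF assms(3) gram])
  \<comment> \<open>The matrix of \<open>Q\<close> is \<open>P\<close>, that of \<open>Q Q\<close> is the dual Gram matrix.\<close>
  have "(\<lambda>i j. cinner (\<psi> j) (canonical_dual \<psi> i)) = opmat Q"
    by (simp add: fun_eq_iff opmat_def canonical_dual_eq Q_self_adjoint)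
  then show "\<exists>C. schur w (\<lambda>i j. cinner (\<psi> j) (canonical_dual \<psi> i)) C"
    using admissible_schur[OF assms(3) range_projection_mem] by simp
  have "gram (canonical_dual \<psi>) = opmat (\<lambda>x. Q (Q x))"
    by (simp add: fun_eq_iff opmat_def gram_def canonical_dual_eq Q_self_adjoint)
  then show "\<exists>C. schur w (gram (canonical_dual \<psi>)) C"
    using admissible_schur[OF assms(3) dual_gram_mem] by simp
qed

section \<open>Frames of simple tensors\<close>

lemma has_sum_product:
  fixes f :: "'i \<Rightarrow> complex" and g :: "'j \<Rightarrow> complex"
  assumes f: "(f has_sum a) UNIV" and g: "(g has_sum b) UNIV"
  shows "((\<lambda>p. f (fst p) * g (snd p)) has_sum a * b) UNIV"
proof -
  have fs: "(\<lambda>i. cmod (f i)) summable_on UNIV" and gs: "(\<lambda>j. cmod (g j)) summable_on UNIV"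
    using f g by (auto simp: summable_on_iff_abs_summable_on_complex[symmetric] has_sum_imp_summable)
  have "(\<lambda>p. cmod (f (fst p) * g (snd p))) summable_on (UNIV \<times> UNIV)"
    unfolding Infinite_Sum.abs_summable_on_Sigma_iff
    using fs gs by (simp add: norm_mult infsum_cmult_right summable_on_cmult_right summable_on_cmult_left
        infsum_nonneg abs_mult)
  then have "(\<lambda>p. f (fst p) * g (snd p)) summable_on (UNIV \<times> UNIV)"
    by (simp only: summable_on_iff_abs_summable_on_complex)
  then have "((\<lambda>p. f (fst p) * g (snd p)) has_sum a * b) (UNIV \<times> UNIV)"
    by (rule has_sum_SigmaI[rotated 2])
      (simp_all only: fst_conv snd_conv, (rule has_sum_cmult_right[OF g] has_sum_cmult_left[OF f])+)
  then show ?thesis by simp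
qed

lemma Rep_finrank_sum: "Rep_finrank (\<Sum>k\<in>K. T k) f = (\<Sum>k\<in>K. Rep_finrank (T k) f)"
  by (induction K rule: infinite_finite_induct) (auto simp: zero_finrank.rep_eq plus_finrank.rep_eq)

text \<open>An orthonormal first factor makes the norm of a finite-rank tensor computable.\<close>

lemma finrank_orthonormal_rep:
  fixes T :: "('a::cinner_space, 'b::cinner_space) finrank"
  obtains E g where "finite E" "\<And>e e'. e \<in> E \<Longrightarrow> e' \<in> E \<Longrightarrow> cinner e e' = (if e = e' then 1 else 0)"
    "T = (\<Sum>e\<in>E. rank_one e (g e))"
proof -
  obtain l where l: "Rep_finrank T = finrank_op l" using Rep_finrank[of T] by blast
  obtain E g where E: "finite E" "\<forall>e\<in>E. \<forall>e'\<in>E. cinner e e' = (if e = e' then 1 else 0)"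
    and op: "finrank_op l = (\<lambda>f. \<Sum>e\<in>E. cinner f e *\<^sub>C g e)"
    using finrank_orthonormal[of l] by blast
  have "Rep_finrank T = Rep_finrank (\<Sum>e\<in>E. rank_one e (g e))"
    by (simp add: fun_eq_iff l op Rep_finrank_sum rank_one.rep_eq)
  then have "T = (\<Sum>e\<in>E. rank_one e (g e))" by (simp add: Rep_finrank_inject)
  then show ?thesis using that E by blast
qed

lemma cembed_sum: "cembed (\<Sum>k\<in>K. T k) = (\<Sum>k\<in>K. cembed (T k))"
proof -
  have "cembed (0 :: 'a) = 0" using cembed_diff[of 0 0] by simp
  then show ?thesis by (induction K rule: infinite_finite_induct) (auto simp: cembed_add)
qed

text \<open>The finite sums of simple tensors are dense in the completion.\<close>

lemma bounded_linear_zero_on_tensors: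
  fixes h :: "('a::cinner_space, 'b::cinner_space) htensor \<Rightarrow> 'c::real_normed_vector"
  assumes h: "bounded_linear h" and z: "\<And>x y. h (tensor x y) = 0"
  shows "h F = 0"
proof -
  interpret bounded_linear h by fact
  have "range cembed \<subseteq> {F. h F = 0}"
  proof clarify
    fix T :: "('a, 'b) finrank"
    obtain E g where T: "T = (\<Sum>e\<in>E. rank_one e (g e))" by (rule finrank_orthonormal_rep)
    show "h (cembed T) = 0" unfolding T cembed_sum sum using z by (simp add: tensor_def)
  qed
  moreover have "closed {F. h F = 0}"
    by (intro closed_Collect_eq continuous_on continuous_on_const) simp
  ultimately have "closure (range cembed) \<subseteq> {F. h F = 0}" by (rule closure_minimal)
  then show ?thesis unfolding closure_range_cembed by blast
qed

lemma tensor_orthogonal: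
  fixes F :: "('a::cinner_space, 'b::cinner_space) htensor"
  assumes "\<And>x y. cinner F (tensor x y) = 0"
  shows "F = 0"
proof -
  have "cinner (tensor x y) F = 0" for x y using assms[of x y] by (simp add: cinner_commute[of _ F])
  then have "cinner F F = 0"
    by (rule bounded_linear_zero_on_tensors[OF bounded_linear_cinner_left])
  then show ?thesis by (simp add: cinner_self)
qed

lemma tensor_eqI:
  fixes F G :: "('a::cinner_space, 'b::cinner_space) htensor"
  assumes "\<And>x y. cinner F (tensor x y) = cinner G (tensor x y)"
  shows "F = G"
  using tensor_orthogonal[of "F - G"] assms by (simp add: cinner_diff_left)

lemma norm_orthonormal_sum:
  fixes E :: "'h::cinner_space set"
  assumes E: "finite E" and on: "\<And>e e'. e \<in> E \<Longrightarrow> e' \<in> E \<Longrightarrow> cinner e e' = (if e = e' then 1 else 0)"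
  shows "(norm (\<Sum>e\<in>E. c e *\<^sub>C e))\<^sup>2 = (\<Sum>e\<in>E. (cmod (c e))\<^sup>2)"
proof -
  have "cinner (\<Sum>e\<in>E. c e *\<^sub>C e) (\<Sum>e\<in>E. c e *\<^sub>C e)
      = (\<Sum>e\<in>E. \<Sum>e'\<in>E. if e' = e then c e * cnj (c e) else 0)"
    unfolding cinner_sum_left cinner_sum_right
    by (intro sum.cong) (auto simp: cinner_scaleC_left cinner_scaleC_right on)
  also have "\<dots> = (\<Sum>e\<in>E. complex_of_real ((cmod (c e))\<^sup>2))"
    using E by (intro sum.cong) (auto simp: complex_norm_square[symmetric])
  finally have "complex_of_real ((norm (\<Sum>e\<in>E. c e *\<^sub>C e))\<^sup>2) = complex_of_real (\<Sum>e\<in>E. (cmod (c e))\<^sup>2)"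
    by (simp add: cinner_self)
  then show ?thesis by (simp only: of_real_eq_iff)
qed

text \<open>For \<open>T = (\<Sum>e\<in>E. e \<otimes> g e)\<close> with \<open>E\<close> orthonormal, the coefficients with fixed \<open>j\<close> are, up to conjugation, those of
  \<open>x j = (\<Sum>e\<in>E. cnj \<langle>g e, \<psi>2 j\<rangle> e)\<close>. Summing first over \<open>i\<close> and then over \<open>j\<close> uses one Bessel bound after
  the other. Density extends the estimate to the completion.\<close>

lemma bessel_tensor:
  fixes \<psi>1 :: "'i \<Rightarrow> 'a::cinner_space" and \<psi>2 :: "'j \<Rightarrow> 'b::cinner_space"
  assumes b1: "bessel \<psi>1 B1" and b2: "bessel \<psi>2 B2"
  shows "bessel (tensor_frame \<psi>1 \<psi>2) (B1 * B2)"
proof -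
  have B: "B1 \<ge> 0" "B2 \<ge> 0" using b1 b2 by (auto simp: bessel_def)
  have fin: "(\<Sum>p\<in>K. (cmod (cinner (cembed T) (tensor_frame \<psi>1 \<psi>2 p)))\<^sup>2) \<le> B1 * B2 * (norm (cembed T))\<^sup>2"
    if K: "finite K" for T and K :: "('i \<times> 'j) set"
  proof -
    obtain E g where E: "finite E" and on: "\<And>e e'. e \<in> E \<Longrightarrow> e' \<in> E \<Longrightarrow> cinner e e' = (if e = e' then 1 else 0)"
      and T: "T = (\<Sum>e\<in>E. rank_one e (g e))" using finrank_orthonormal_rep[of T] by metis
    have "cinner T T = (\<Sum>e\<in>E. \<Sum>e'\<in>E. if e' = e then cinner (g e) (g e) else 0)"
      unfolding T cinner_sum_left cinner_sum_right
      by (intro sum.cong) (auto simp: cinner_rank_one on)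
    also have "\<dots> = complex_of_real (\<Sum>e\<in>E. (norm (g e))\<^sup>2)" using E by (simp add: cinner_self)
    finally have nT: "(norm (cembed T))\<^sup>2 = (\<Sum>e\<in>E. (norm (g e))\<^sup>2)"
      by (simp only: norm_cembed cinner_self of_real_eq_iff)
    define x where "x j = (\<Sum>e\<in>E. cnj (cinner (g e) (\<psi>2 j)) *\<^sub>C e)" for j
    have xj: "cmod (cinner (cembed T) (tensor_frame \<psi>1 \<psi>2 (i, j))) = cmod (cinner (x j) (\<psi>1 i))" for i j
    proof -
      have "cinner (cembed T) (tensor_frame \<psi>1 \<psi>2 (i, j)) = cnj (cinner (x j) (\<psi>1 i))"
        by (simp add: tensor_frame_def tensor_def cinner_cembed T x_def cinner_sum_left cinner_rank_one
            cinner_scaleC_left mult.commute)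
      then show ?thesis by simp
    qed
    define F1 where "F1 = fst ` K"
    define F2 where "F2 = snd ` K"
    have F: "finite F1" "finite F2" "K \<subseteq> F1 \<times> F2" using K by (force simp: F1_def F2_def)+
    have "(\<Sum>p\<in>K. (cmod (cinner (cembed T) (tensor_frame \<psi>1 \<psi>2 p)))\<^sup>2)
        \<le> (\<Sum>p\<in>F1 \<times> F2. (cmod (cinner (cembed T) (tensor_frame \<psi>1 \<psi>2 p)))\<^sup>2)"
      by (rule sum_mono2) (use F in auto)
    also have "\<dots> = (\<Sum>j\<in>F2. \<Sum>i\<in>F1. (cmod (cinner (x j) (\<psi>1 i)))\<^sup>2)"
      by (subst sum.swap) (simp only: sum.cartesian_product' xj[symmetric])
    also have "\<dots> \<le> (\<Sum>j\<in>F2. B1 * (norm (x j))\<^sup>2)"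
      using b1 F by (intro sum_mono) (auto simp: bessel_def)
    also have "\<dots> = B1 * (\<Sum>j\<in>F2. \<Sum>e\<in>E. (cmod (cinner (g e) (\<psi>2 j)))\<^sup>2)"
      by (simp add: x_def norm_orthonormal_sum[OF E on] sum_distrib_left)
    also have "\<dots> = B1 * (\<Sum>e\<in>E. \<Sum>j\<in>F2. (cmod (cinner (g e) (\<psi>2 j)))\<^sup>2)"
      by (subst sum.swap) simp
    also have "\<dots> \<le> B1 * (\<Sum>e\<in>E. B2 * (norm (g e))\<^sup>2)"
      using b2 F B by (intro mult_left_mono sum_mono) (auto simp: bessel_def)
    finally show ?thesis by (simp add: nT sum_distrib_left mult.assoc)
  qed
  have "(\<Sum>p\<in>K. (cmod (cinner F (tensor_frame \<psi>1 \<psi>2 p)))\<^sup>2) \<le> B1 * B2 * (norm F)\<^sup>2"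
    if K: "finite K" for F and K :: "('i \<times> 'j) set"
  proof -
    have "closed {F. (\<Sum>p\<in>K. (cmod (cinner F (tensor_frame \<psi>1 \<psi>2 p)))\<^sup>2) \<le> B1 * B2 * (norm F)\<^sup>2}"
      by (intro closed_Collect_le continuous_intros
          bounded_linear.continuous_on[OF bounded_linear_cinner_left])
    then have "closure (range cembed) \<subseteq> {F. (\<Sum>p\<in>K. (cmod (cinner F (tensor_frame \<psi>1 \<psi>2 p)))\<^sup>2) \<le> B1 * B2 * (norm F)\<^sup>2}"
      using fin[OF K] by (intro closure_minimal) auto
    then show ?thesis unfolding closure_range_cembed by blast
  qed
  then show ?thesis using B by (simp add: bessel_def)
qed

text \<open>Both sides are continuous in \<open>F\<close> by the Bessel bounds, and on simple tensors the sum factorises.\<close>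

lemma tensor_recon:
  fixes \<psi>1 \<phi>1 :: "'i \<Rightarrow> 'a::chilbert_space" and \<psi>2 \<phi>2 :: "'j \<Rightarrow> 'b::chilbert_space"
  assumes p1: "bessel \<psi>1 B1" and p2: "bessel \<psi>2 B2" and q1: "bessel \<phi>1 C1" and q2: "bessel \<phi>2 C2"
    and r1: "\<And>f g. ((\<lambda>i. cinner f (\<phi>1 i) * cinner (\<psi>1 i) g) has_sum cinner f g) UNIV"
    and r2: "\<And>f g. ((\<lambda>i. cinner f (\<phi>2 i) * cinner (\<psi>2 i) g) has_sum cinner f g) UNIV"
  shows "((\<lambda>p. cinner F (tensor_frame \<phi>1 \<phi>2 p) * cinner (tensor_frame \<psi>1 \<psi>2 p) G) has_sum cinner F G) UNIV"
proof -
  define \<Psi> where "\<Psi> = tensor_frame \<psi>1 \<psi>2"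
  define \<Phi> where "\<Phi> = tensor_frame \<phi>1 \<phi>2"
  have b: "bessel \<Psi> (B1 * B2)" "bessel \<Phi> (C1 * C2)"
    unfolding \<Psi>_def \<Phi>_def by (rule bessel_tensor[OF p1 p2], rule bessel_tensor[OF q1 q2])
  define U where "U F = synthesis \<Psi> (analysis \<Phi> F)" for F
  have U: "clin U" unfolding U_def by (rule clin_synthesis_analysis[OF b(2,1)])
  have sum: "((\<lambda>p. cinner F (\<Phi> p) * cinner (\<Psi> p) G) has_sum cinner (U F) G) UNIV" for F G
    using cinner_synthesis_left[OF b(1) bessel_analysis(1)[OF b(2)], of F G]
    by (simp add: U_def analysis_def)
  have Ut: "U (tensor x y) = tensor x y" for x y
  proof (rule tensor_eqI)
    fix u v
    have "((\<lambda>i. cnj (cinner x (\<phi>1 i) * cinner (\<psi>1 i) u)) has_sum cnj (cinner x u)) UNIV"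
      using r1[of x u] by (simp only: has_sum_cnj_iff)
    from has_sum_product[OF this r2[of y v]]
    have "((\<lambda>p. cinner (tensor x y) (\<Phi> p) * cinner (\<Psi> p) (tensor u v)) has_sum
        cinner (tensor x y) (tensor u v)) UNIV"
      by (simp add: \<Phi>_def \<Psi>_def tensor_frame_def case_prod_unfold cinner_tensor mult_ac)
    then show "cinner (U (tensor x y)) (tensor u v) = cinner (tensor x y) (tensor u v)"
      using sum has_sum_unique by blast
  qed
  have "U F - F = 0"
    by (rule bounded_linear_zero_on_tensors[OF clin_bounded_linear[OF clin_sub[OF U clin_id]]])
      (simp only: Ut diff_self)
  then have "U F = F" by (simp only: right_minus_eq)
  then show ?thesis using sum[of F G] unfolding \<Phi>_def \<Psi>_def by (simp only:)
qed

lemma frame_op_tensor: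
  fixes \<psi>1 :: "'i \<Rightarrow> 'a::chilbert_space" and \<psi>2 :: "'j \<Rightarrow> 'b::chilbert_space"
  assumes b1: "bessel \<psi>1 B1" and b2: "bessel \<psi>2 B2"
  shows "frame_op (tensor_frame \<psi>1 \<psi>2) (tensor x y) = tensor (frame_op \<psi>1 x) (frame_op \<psi>2 y)"
proof (rule tensor_eqI)
  fix u v
  have "((\<lambda>i. cnj (cinner x (\<psi>1 i) * cinner (\<psi>1 i) u)) has_sum cnj (cinner (frame_op \<psi>1 x) u)) UNIV"
    using frame_op_has_sum[OF b1, of x u] by (simp only: has_sum_cnj_iff)
  from has_sum_product[OF this frame_op_has_sum[OF b2, of y v]]
  have "((\<lambda>p. cinner (tensor x y) (tensor_frame \<psi>1 \<psi>2 p) * cinner (tensor_frame \<psi>1 \<psi>2 p) (tensor u v)) has_sum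
      cinner (tensor (frame_op \<psi>1 x) (frame_op \<psi>2 y)) (tensor u v)) UNIV"
    by (simp add: tensor_frame_def case_prod_unfold cinner_tensor mult_ac)
  then show "cinner (frame_op (tensor_frame \<psi>1 \<psi>2) (tensor x y)) (tensor u v)
      = cinner (tensor (frame_op \<psi>1 x) (frame_op \<psi>2 y)) (tensor u v)"
    using frame_op_has_sum[OF bessel_tensor[OF b1 b2]] has_sum_unique by blast
qed

lemma recon_swap:
  assumes "\<And>f g. ((\<lambda>i. cinner f (\<phi> i) * cinner (\<psi> i) g) has_sum cinner f g) UNIV"
  shows "((\<lambda>i. cinner f (\<psi> i) * cinner (\<phi> i) g) has_sum cinner f g) UNIV"
proof -
  have "((\<lambda>i. cnj (cinner g (\<phi> i) * cinner (\<psi> i) f)) has_sum cnj (cinner g f)) UNIV"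
    using assms[of g f] by (simp only: has_sum_cnj_iff)
  then show ?thesis by (simp add: cinner_commute[symmetric] mult.commute)
qed

section \<open>Localised dual pairs\<close>

text \<open>All that localisation contributes to the analysis of the co-orbit spaces. In this form it is stable
  under tensor products.\<close>

locale localised_pair =
  fixes \<psi> \<phi> :: "'i::countable \<Rightarrow> 'h::chilbert_space" and w :: "'i \<Rightarrow> real" and C :: real
  assumes dual: "canonical_dual \<psi> = \<phi>"
    and recon: "\<And>f g. ((\<lambda>i. cinner f (\<phi> i) * cinner (\<psi> i) g) has_sum cinner f g) UNIV"
    and hermitian: "cinner (\<psi> j) (\<phi> i) = cinner (\<phi> j) (\<psi> i)"
    and w_pos: "0 < w i"
    and schur_P: "schur w (\<lambda>i j. cinner (\<psi> j) (\<phi> i)) C"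
    and schur_G: "schur w (gram \<psi>) C"
    and schur_D: "schur w (gram \<phi>) C"

lemma schur_mono:
  assumes "schur w A C" "C \<le> D" "\<And>i. 0 < w i"
  shows "schur w A D"
proof -
  have "C * w j \<le> D * w j" for j using assms(2,3) by (simp add: less_imp_le mult_right_mono)
  then show ?thesis using assms(1,2) unfolding schur_def by (meson order_trans)
qed

lemma localised_pair_of_frame:
  fixes \<psi> :: "'i::countable \<Rightarrow> 'h::chilbert_space"
  assumes A: "spectral_matrix_algebra \<A> N" and l: "localised_frame \<A> \<psi>" and w: "admissible_weight \<A> w"
  shows "\<exists>C. localised_pair \<psi> (canonical_dual \<psi>) w C"
proof -
  obtain C1 C2 C3 where C: "schur w (gram \<psi>) C1"
    "schur w (\<lambda>i j. cinner (\<psi> j) (canonical_dual \<psi> i)) C2" "schur w (gram (canonical_dual \<psi>)) C3"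
    using localised_frame_schur[OF assms] by blast
  have wp: "0 < w i" for i using w by (simp add: admissible_weight_def)
  obtain a b where "frame_bounds \<psi> a b" using l frame_obtain_bounds[of \<psi>] by (auto simp: localised_frame_def)
  then interpret frame_bounds \<psi> a b .
  have "localised_pair \<psi> (canonical_dual \<psi>) w (max C1 (max C2 C3))"
  proof
    show "cinner (\<psi> j) (canonical_dual \<psi> i) = cinner (canonical_dual \<psi> j) (\<psi> i)" for i j
      by (simp add: canonical_dual_eq Q_self_adjoint)
    show "schur w (gram \<psi>) (max C1 (max C2 C3))" by (rule schur_mono[OF C(1) _ wp]) simp
    show "schur w (\<lambda>i j. cinner (\<psi> j) (canonical_dual \<psi> i)) (max C1 (max C2 C3))"
      by (rule schur_mono[OF C(2) _ wp]) simp
    show "schur w (gram (canonical_dual \<psi>)) (max C1 (max C2 C3))" by (rule schur_mono[OF C(3) _ wp]) simp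
  qed (rule refl recon wp)+
  then show ?thesis by blast
qed

lemma schur_tensor:
  assumes a: "schur w1 A1 C1" "schur w2 A2 C2" and w: "\<And>i. 0 < w1 i" "\<And>j. 0 < w2 j"
    and b: "\<And>i j i' j'. cmod (B (i, j) (i', j')) = cmod (A1 i i') * cmod (A2 j j')"
  shows "schur (tensor_weight w1 w2) B (C1 * C2)"
proof -
  have C: "C1 \<ge> 0" "C2 \<ge> 0" using a by (auto simp: schur_def)
  have "(\<Sum>p\<in>K. cmod (B p (i', j')) * tensor_weight w1 w2 p) \<le> C1 * C2 * tensor_weight w1 w2 (i', j')"
    if K: "finite K" for K i' j'
  proof -
    define F1 where "F1 = fst ` K"
    define F2 where "F2 = snd ` K"
    have F: "finite F1" "finite F2" "K \<subseteq> F1 \<times> F2" using K by (force simp: F1_def F2_def)+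
    have "(\<Sum>p\<in>K. cmod (B p (i', j')) * tensor_weight w1 w2 p)
        \<le> (\<Sum>p\<in>F1 \<times> F2. cmod (B p (i', j')) * tensor_weight w1 w2 p)"
      by (rule sum_mono2) (use F w in \<open>auto simp: tensor_weight_def less_imp_le\<close>)
    also have "\<dots> = (\<Sum>i\<in>F1. cmod (A1 i i') * w1 i) * (\<Sum>j\<in>F2. cmod (A2 j j') * w2 j)"
      unfolding sum_product sum.cartesian_product
      by (intro sum.cong) (auto simp: tensor_weight_def b mult_ac)
    also have "\<dots> \<le> (C1 * w1 i') * (C2 * w2 j')"
      using a F w C by (intro mult_mono) (auto simp: schur_def less_imp_le intro!: sum_nonneg)
    finally show ?thesis by (simp add: tensor_weight_def mult_ac)
  qed
  then show ?thesis using C by (auto simp: schur_def)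
qed

text \<open>The frame operator of the tensor frame maps \<open>\<phi>1 i \<otimes> \<phi>2 j\<close> to \<open>\<psi>1 i \<otimes> \<psi>2 j\<close>. It is injective, since a vector in
  its kernel is orthogonal to the frame and hence zero by the reconstruction formula. Therefore the
  canonical dual consists of the tensors \<open>\<phi>1 i \<otimes> \<phi>2 j\<close>.\<close>

lemma localised_pair_tensor:
  fixes \<psi>1 :: "'i::countable \<Rightarrow> 'a::chilbert_space" and \<psi>2 :: "'j::countable \<Rightarrow> 'b::chilbert_space"
  assumes f1: "frame \<psi>1" and f2: "frame \<psi>2"
    and l1: "localised_pair \<psi>1 \<phi>1 w1 C1" and l2: "localised_pair \<psi>2 \<phi>2 w2 C2"
  shows "localised_pair (tensor_frame \<psi>1 \<psi>2) (tensor_frame \<phi>1 \<phi>2) (tensor_weight w1 w2) (C1 * C2)"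
proof -
  obtain a1 b1 where "frame_bounds \<psi>1 a1 b1" using frame_obtain_bounds[OF f1] by blast
  then interpret h1: frame_bounds \<psi>1 a1 b1 .
  obtain a2 b2 where "frame_bounds \<psi>2 a2 b2" using frame_obtain_bounds[OF f2] by blast
  then interpret h2: frame_bounds \<psi>2 a2 b2 .
  interpret p1: localised_pair \<psi>1 \<phi>1 w1 C1 by fact
  interpret p2: localised_pair \<psi>2 \<phi>2 w2 C2 by fact
  note bessel = h1.bessel h2.bessel h1.dual_bessel[unfolded p1.dual] h2.dual_bessel[unfolded p2.dual]
  note recon = tensor_recon[OF bessel p1.recon p2.recon]
  note bt = bessel_tensor[OF bessel(1,2)]
  show ?thesis
  proof
    have inj: "inj (frame_op (tensor_frame \<psi>1 \<psi>2))"
    proof (rule injI)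
      fix F G assume e: "frame_op (tensor_frame \<psi>1 \<psi>2) F = frame_op (tensor_frame \<psi>1 \<psi>2) G"
      define H where "H = F - G"
      have "frame_op (tensor_frame \<psi>1 \<psi>2) H = 0"
        unfolding H_def clin_diff[OF frame_op_clin[OF bt]] e by simp
      then have "(\<Sum>\<^sub>\<infinity>p. (cmod (analysis (tensor_frame \<psi>1 \<psi>2) H p))\<^sup>2) = 0"
        using frame_op_form[OF bt, of H] by simp
      then have "(cmod (analysis (tensor_frame \<psi>1 \<psi>2) H p))\<^sup>2 = 0" for p
        using nonneg_infsum_le_0D[OF _ bessel_analysis(1)[OF bt], of H p] by simp
      then have z: "cinner H (tensor_frame \<psi>1 \<psi>2 p) = 0" for p by (simp add: analysis_def)
      have "((\<lambda>p. cinner H (tensor_frame \<psi>1 \<psi>2 p) * cinner (tensor_frame \<phi>1 \<phi>2 p) H) has_sum cinner H H) UNIV"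
        by (rule recon_swap[OF recon])
      then have "cinner H H = 0" unfolding z by (simp add: has_sum_unique[OF _ has_sum_0_simp])
      then show "F = G" by (simp add: cinner_self H_def)
    qed
    show "canonical_dual (tensor_frame \<psi>1 \<psi>2) = tensor_frame \<phi>1 \<phi>2"
    proof
      fix p :: "'i \<times> 'j"
      obtain i j where p: "p = (i, j)" by (cases p)
      have "frame_op (tensor_frame \<psi>1 \<psi>2) (tensor_frame \<phi>1 \<phi>2 p) = tensor_frame \<psi>1 \<psi>2 p"
        using frame_op_tensor[OF bessel(1,2), of "\<phi>1 i" "\<phi>2 j"]
        by (simp add: p tensor_frame_def
            p1.dual[symmetric] p2.dual[symmetric] h1.canonical_dual_eq h2.canonical_dual_eq)
      then show "canonical_dual (tensor_frame \<psi>1 \<psi>2) p = tensor_frame \<phi>1 \<phi>2 p"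
        unfolding canonical_dual_def by (metis inj inv_f_f)
    qed
    show "0 < tensor_weight w1 w2 p" for p
      by (simp add: tensor_weight_def case_prod_unfold p1.w_pos p2.w_pos)
    show "cinner (tensor_frame \<psi>1 \<psi>2 q) (tensor_frame \<phi>1 \<phi>2 p)
        = cinner (tensor_frame \<phi>1 \<phi>2 q) (tensor_frame \<psi>1 \<psi>2 p)" for p q
      by (simp add: tensor_frame_def case_prod_unfold cinner_tensor p1.hermitian p2.hermitian)
  qed (rule recon, (rule schur_tensor[OF p1.schur_P p2.schur_P p1.w_pos p2.w_pos]
      schur_tensor[OF p1.schur_G p2.schur_G p1.w_pos p2.w_pos]
      schur_tensor[OF p1.schur_D p2.schur_D p1.w_pos p2.w_pos],
      simp add: tensor_frame_def cinner_tensor norm_mult gram_def)+)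
qed

section \<open>Weighted sequence spaces and Schur matrices\<close>

definition L1 :: "('i \<Rightarrow> real) \<Rightarrow> ('i \<Rightarrow> complex) set"
  where "L1 w = {c. (\<lambda>i. cmod (c i) * w i) summable_on UNIV}"

definition n1 :: "('i \<Rightarrow> real) \<Rightarrow> ('i \<Rightarrow> complex) \<Rightarrow> real"
  where "n1 w c = (\<Sum>\<^sub>\<infinity>i. cmod (c i) * w i)"

text \<open>The space \<open>\<ell>\<^sup>\<infinity>\<close> with weight \<open>1/w\<close>, the dual of \<open>L1 w\<close>.\<close>

definition Linf :: "('i \<Rightarrow> real) \<Rightarrow> ('i \<Rightarrow> complex) set"
  where "Linf w = {d. \<exists>K. \<forall>i. cmod (d i) \<le> K * w i}"

lemma LinfI: "(\<And>i. cmod (d i) \<le> K * w i) \<Longrightarrow> d \<in> Linf w"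
  by (auto simp: Linf_def)

text \<open>A criterion for absolute summability over pairs in which one of the two sums is only bounded on
  finite sets; this is the shape in which Schur bounds are available.\<close>

lemma double_sumI:
  fixes g :: "'i \<Rightarrow> 'j \<Rightarrow> complex"
  assumes le: "\<And>j F. finite F \<Longrightarrow> (\<Sum>i\<in>F. cmod (g i j)) \<le> b j" and b: "b summable_on UNIV"
  shows "(\<lambda>(i, j). cmod (g i j)) summable_on UNIV" "(\<Sum>\<^sub>\<infinity>(i, j). cmod (g i j)) \<le> infsum b UNIV"
proof -
  have b0: "b j \<ge> 0" for j using le[of "{}" j] by simp
  have *: "(\<Sum>(i, j)\<in>K. cmod (g i j)) \<le> infsum b UNIV" if K: "finite K" for K :: "('i \<times> 'j) set"
  proof -
    define F1 where "F1 = fst ` K"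
    define F2 where "F2 = snd ` K"
    have F: "finite F1" "finite F2" "K \<subseteq> F1 \<times> F2" using K by (force simp: F1_def F2_def)+
    have "(\<Sum>(i, j)\<in>K. cmod (g i j)) \<le> (\<Sum>(i, j)\<in>F1 \<times> F2. cmod (g i j))"
      by (rule sum_mono2) (use F in auto)
    also have "\<dots> = (\<Sum>i\<in>F1. \<Sum>j\<in>F2. cmod (g i j))" by (simp add: sum.cartesian_product)
    also have "\<dots> = (\<Sum>j\<in>F2. \<Sum>i\<in>F1. cmod (g i j))" by (rule sum.swap)
    also have "\<dots> \<le> (\<Sum>j\<in>F2. b j)" by (intro sum_mono le F)
    also have "\<dots> \<le> infsum b UNIV" using F b b0 by (intro finite_sum_le_infsum) auto
    finally show ?thesis .
  qed
  show s: "(\<lambda>(i, j). cmod (g i j)) summable_on UNIV"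
    by (rule nonneg_bdd_above_summable_on) (auto intro!: bdd_aboveI[of _ "infsum b UNIV"] *)
  show "(\<Sum>\<^sub>\<infinity>(i, j). cmod (g i j)) \<le> infsum b UNIV"
    by (rule infsum_le_finite_sums[OF s]) (rule *)
qed

lemma double_sumD:
  fixes g :: "'i \<Rightarrow> 'j \<Rightarrow> complex"
  assumes s: "(\<lambda>(i, j). cmod (g i j)) summable_on UNIV"
  shows "(\<lambda>j. g i j) summable_on UNIV"
    "(\<Sum>\<^sub>\<infinity>i. \<Sum>\<^sub>\<infinity>j. g i j) = (\<Sum>\<^sub>\<infinity>j. \<Sum>\<^sub>\<infinity>i. g i j)"
    "(\<Sum>\<^sub>\<infinity>i. \<Sum>\<^sub>\<infinity>j. g i j) = (\<Sum>\<^sub>\<infinity>(i, j). g i j)"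
    "(\<lambda>i. cmod (\<Sum>\<^sub>\<infinity>j. g i j)) summable_on UNIV"
    "(\<Sum>\<^sub>\<infinity>i. cmod (\<Sum>\<^sub>\<infinity>j. g i j)) \<le> (\<Sum>\<^sub>\<infinity>(i, j). cmod (g i j))"
    "(\<lambda>j. cmod (g i j)) summable_on UNIV"
    "(\<lambda>i. \<Sum>\<^sub>\<infinity>j. cmod (g i j)) summable_on UNIV"
    "(\<Sum>\<^sub>\<infinity>i. \<Sum>\<^sub>\<infinity>j. cmod (g i j)) = (\<Sum>\<^sub>\<infinity>(i, j). cmod (g i j))"
proof -
  have s': "(\<lambda>(i, j). cmod (g i j)) summable_on UNIV \<times> UNIV" using s by simp
  have gs: "(\<lambda>(i, j). g i j) summable_on UNIV \<times> UNIV"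
    using s by (simp add: summable_on_iff_abs_summable_on_complex case_prod_unfold)
  show "(\<lambda>j. g i j) summable_on UNIV" by (rule summable_on_SigmaD1[OF gs]) simp
  show 1: "(\<lambda>j. cmod (g i j)) summable_on UNIV" for i by (rule summable_on_SigmaD1[OF s']) simp
  show "(\<Sum>\<^sub>\<infinity>i. \<Sum>\<^sub>\<infinity>j. g i j) = (\<Sum>\<^sub>\<infinity>j. \<Sum>\<^sub>\<infinity>i. g i j)" by (rule infsum_swap_banach[OF gs])
  show "(\<Sum>\<^sub>\<infinity>i. \<Sum>\<^sub>\<infinity>j. g i j) = (\<Sum>\<^sub>\<infinity>(i, j). g i j)" using infsum_Sigma'_banach[OF gs] by simp
  show 2: "(\<lambda>i. \<Sum>\<^sub>\<infinity>j. cmod (g i j)) summable_on UNIV" by (rule summable_on_Sigma_banach[OF s'])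
  show 3: "(\<Sum>\<^sub>\<infinity>i. \<Sum>\<^sub>\<infinity>j. cmod (g i j)) = (\<Sum>\<^sub>\<infinity>(i, j). cmod (g i j))"
    using infsum_Sigma'_banach[OF s'] by simp
  have le: "cmod (\<Sum>\<^sub>\<infinity>j. g i j) \<le> (\<Sum>\<^sub>\<infinity>j. cmod (g i j))" for i
    by (rule norm_infsum_bound[OF 1])
  show 4: "(\<lambda>i. cmod (\<Sum>\<^sub>\<infinity>j. g i j)) summable_on UNIV"
    by (rule summable_on_comparison_test[OF 2 le]) simp
  show "(\<Sum>\<^sub>\<infinity>i. cmod (\<Sum>\<^sub>\<infinity>j. g i j)) \<le> (\<Sum>\<^sub>\<infinity>(i, j). cmod (g i j))"
    unfolding 3[symmetric] by (rule infsum_mono[OF 4 2 le])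
qed

lemma infsum_sub:
  fixes f g :: "'i \<Rightarrow> 'b::real_normed_vector"
  assumes "f summable_on A" "g summable_on A"
  shows "infsum (\<lambda>i. f i - g i) A = infsum f A - infsum g A"
  using infsum_add[OF assms(1), of "\<lambda>i. - g i"] assms(2)
  by (simp add: summable_on_uminus infsum_uminus)

text \<open>Dominated convergence, from the uniform convergence of the finite partial sums. The type
  \<open>nat option\<close> indexes the sequence together with its limit.\<close>

lemma dominated_infsum:
  fixes g :: "nat \<Rightarrow> 'i \<Rightarrow> complex"
  assumes b: "b summable_on UNIV" and le: "\<And>n i. cmod (g n i) \<le> b i" and lim: "\<And>i. (\<lambda>n. g n i) \<longlonglongrightarrow> h i"
  shows "(\<lambda>n. \<Sum>\<^sub>\<infinity>i. g n i) \<longlonglongrightarrow> (\<Sum>\<^sub>\<infinity>i. h i)"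
proof (rule metric_LIMSEQ_I)
  fix e :: real assume e: "e > 0"
  have leh: "cmod (h i) \<le> b i" for i
    by (rule LIMSEQ_le_const2[OF tendsto_norm[OF lim]]) (use le in auto)
  define H where "H i y = (case y of None \<Rightarrow> h i | Some n \<Rightarrow> g n i)" for i y
  have "uniform_limit UNIV (\<lambda>F y. \<Sum>i\<in>F. H i y) (\<lambda>y. \<Sum>\<^sub>\<infinity>i. H i y) (finite_subsets_at_top UNIV)"
    by (rule Weierstrass_m_test_general[OF _ b]) (use le leh in \<open>auto simp: H_def split: option.splits\<close>)
  then have "\<forall>\<^sub>F F in finite_subsets_at_top UNIV. \<forall>y\<in>UNIV. dist (\<Sum>i\<in>F. H i y) (\<Sum>\<^sub>\<infinity>i. H i y) < e / 3"
    by (rule uniform_limitD) (use e in simp)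
  then obtain F where "finite F" and F: "\<And>y. dist (\<Sum>i\<in>F. H i y) (\<Sum>\<^sub>\<infinity>i. H i y) < e / 3"
    unfolding eventually_finite_subsets_at_top by auto
  have n: "dist (\<Sum>i\<in>F. g n i) (\<Sum>\<^sub>\<infinity>i. g n i) < e / 3" for n using F[of "Some n"] by (simp add: H_def)
  have h: "dist (\<Sum>i\<in>F. h i) (\<Sum>\<^sub>\<infinity>i. h i) < e / 3" using F[of None] by (simp add: H_def)
  have "(\<lambda>n. \<Sum>i\<in>F. g n i) \<longlonglongrightarrow> (\<Sum>i\<in>F. h i)" by (intro tendsto_sum lim)
  then obtain n0 where n0: "\<And>n. n \<ge> n0 \<Longrightarrow> dist (\<Sum>i\<in>F. g n i) (\<Sum>i\<in>F. h i) < e / 3"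
    using metric_LIMSEQ_D[of _ _ "e / 3"] e by (metis zero_less_divide_iff zero_less_numeral)
  have "dist (\<Sum>\<^sub>\<infinity>i. g n i) (\<Sum>\<^sub>\<infinity>i. h i) < e" if "n \<ge> n0" for n
    using n[of n] h n0[OF that] dist_triangle[of "\<Sum>\<^sub>\<infinity>i. g n i" "\<Sum>\<^sub>\<infinity>i. h i" "\<Sum>i\<in>F. g n i"]
      dist_triangle[of "\<Sum>i\<in>F. g n i" "\<Sum>\<^sub>\<infinity>i. h i" "\<Sum>i\<in>F. h i"]
    by (simp add: dist_commute)
  then show "\<exists>n0. \<forall>n\<ge>n0. dist (\<Sum>\<^sub>\<infinity>i. g n i) (\<Sum>\<^sub>\<infinity>i. h i) < e" by blast
qed

locale weight =
  fixes w :: "'i \<Rightarrow> real"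
  assumes wpos: "0 < w i"
begin

lemma n1_nonneg: "0 \<le> n1 w c"
  unfolding n1_def by (intro infsum_nonneg) (simp add: wpos less_imp_le)

lemma L1_add: "c \<in> L1 w \<Longrightarrow> d \<in> L1 w \<Longrightarrow> (\<lambda>i. c i + d i) \<in> L1 w"
  and n1_add: "c \<in> L1 w \<Longrightarrow> d \<in> L1 w \<Longrightarrow> n1 w (\<lambda>i. c i + d i) \<le> n1 w c + n1 w d"
proof -
  assume c: "c \<in> L1 w" and d: "d \<in> L1 w"
  then have s: "(\<lambda>i. cmod (c i) * w i + cmod (d i) * w i) summable_on UNIV"
    unfolding L1_def by (intro summable_on_add) auto
  have le: "cmod (c i + d i) * w i \<le> cmod (c i) * w i + cmod (d i) * w i" for i
    using norm_triangle_ineq[of "c i" "d i"] wpos[of i]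
    by (metis distrib_right less_imp_le mult_right_mono)
  show 1: "(\<lambda>i. c i + d i) \<in> L1 w"
    unfolding L1_def mem_Collect_eq
    by (rule summable_on_comparison_test[OF s le]) (simp add: wpos less_imp_le)
  have "n1 w (\<lambda>i. c i + d i) \<le> (\<Sum>\<^sub>\<infinity>i. cmod (c i) * w i + cmod (d i) * w i)"
    unfolding n1_def using 1 by (intro infsum_mono[OF _ s le]) (simp add: L1_def)
  also have "\<dots> = n1 w c + n1 w d"
    unfolding n1_def using c d by (intro infsum_add) (auto simp: L1_def)
  finally show "n1 w (\<lambda>i. c i + d i) \<le> n1 w c + n1 w d" .
qed

lemma L1_scale: "c \<in> L1 w \<Longrightarrow> (\<lambda>i. a * c i) \<in> L1 w"
  and n1_scale: "n1 w (\<lambda>i. a * c i) = cmod a * n1 w c"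
  by (auto simp: L1_def n1_def norm_mult mult.assoc summable_on_cmult_right infsum_cmult_right')

lemma L1_diff: "c \<in> L1 w \<Longrightarrow> d \<in> L1 w \<Longrightarrow> (\<lambda>i. c i - d i) \<in> L1 w"
  using L1_add[of c "\<lambda>i. (- 1) * d i"] L1_scale[of d "- 1"] by simp

lemma n1_diff_commute: "n1 w (\<lambda>i. c i - d i) = n1 w (\<lambda>i. d i - c i)"
  by (simp add: n1_def norm_minus_commute)

lemma n1_diff_triangle:
  assumes "c \<in> L1 w" "d \<in> L1 w" "e \<in> L1 w"
  shows "n1 w (\<lambda>i. c i - e i) \<le> n1 w (\<lambda>i. c i - d i) + n1 w (\<lambda>i. d i - e i)"
  using n1_add[OF L1_diff[OF assms(1,2)] L1_diff[OF assms(2,3)]] by simp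

lemma n1_diff_le:
  assumes "c \<in> L1 w" "d \<in> L1 w"
  shows "\<bar>n1 w c - n1 w d\<bar> \<le> n1 w (\<lambda>i. c i - d i)"
  using n1_add[OF L1_diff[OF assms] assms(2)] n1_add[OF L1_diff[OF assms(2,1)] assms(1)]
  by (simp add: n1_diff_commute[of d c] abs_le_iff)

lemma n1_entry: "c \<in> L1 w \<Longrightarrow> cmod (c i) * w i \<le> n1 w c"
  using finite_sum_le_infsum[of "\<lambda>i. cmod (c i) * w i" UNIV "{i}"] wpos
  by (simp add: L1_def n1_def less_imp_le)

lemma L1_finite_support:
  assumes "finite I"
  shows "(\<lambda>i. if i \<in> I then c i else 0) \<in> L1 w"
  unfolding L1_def mem_Collect_eq
  by (rule has_sum_imp_summable, rule has_sum_finite_neutralI[OF assms]) auto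

lemma L1_limit_pointwise:
  assumes u: "\<And>n. u n \<in> L1 w" and c: "c \<in> L1 w" and lim: "(\<lambda>n. n1 w (\<lambda>i. u n i - c i)) \<longlonglongrightarrow> 0"
  shows "(\<lambda>n. u n i) \<longlonglongrightarrow> c i"
proof -
  have "(\<lambda>n. u n i - c i) \<longlonglongrightarrow> 0"
  proof (rule Lim_null_comparison)
    show "\<forall>\<^sub>F n in sequentially. norm (u n i - c i) \<le> n1 w (\<lambda>i. u n i - c i) / w i"
      using n1_entry[OF L1_diff[OF u c]] wpos[of i] by (simp add: field_simps)
    show "(\<lambda>n. n1 w (\<lambda>i. u n i - c i) / w i) \<longlonglongrightarrow> 0"
      using tendsto_divide[OF lim tendsto_const[of "w i"]] wpos[of i] by simp
  qed
  then show ?thesis by (simp add: LIM_zero_iff)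
qed

lemma L1_complete:
  assumes u: "\<And>n. u n \<in> L1 w"
    and cauchy: "\<And>e. e > 0 \<Longrightarrow> \<exists>n0. \<forall>m\<ge>n0. \<forall>n\<ge>n0. n1 w (\<lambda>i. u m i - u n i) < e"
  shows "\<exists>c\<in>L1 w. (\<lambda>n. n1 w (\<lambda>i. u n i - c i)) \<longlonglongrightarrow> 0"
proof -
  have "Cauchy (\<lambda>n. u n i)" for i
  proof (rule CauchyI)
    fix e :: real assume "e > 0"
    then obtain n0 where n0: "\<And>m n. m \<ge> n0 \<Longrightarrow> n \<ge> n0 \<Longrightarrow> n1 w (\<lambda>i. u m i - u n i) < e * w i"
      using cauchy[of "e * w i"] wpos[of i] by (metis mult_pos_pos)
    have "norm (u m i - u n i) < e" if "m \<ge> n0" "n \<ge> n0" for m n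
    proof -
      have "cmod (u m i - u n i) * w i \<le> n1 w (\<lambda>i. u m i - u n i)"
        by (rule n1_entry[OF L1_diff[OF u u]])
      also have "\<dots> < e * w i" by (rule n0[OF that])
      finally show ?thesis using wpos[of i] by simp
    qed
    then show "\<exists>M. \<forall>m\<ge>M. \<forall>n\<ge>M. norm (u m i - u n i) < e" by blast
  qed
  then have "\<exists>l. (\<lambda>n. u n i) \<longlonglongrightarrow> l" for i
    using Cauchy_convergent by (auto simp: convergent_def)
  then obtain c where c: "\<And>i. (\<lambda>n. u n i) \<longlonglongrightarrow> c i" by metis
  have near: "(\<lambda>i. u n i - c i) \<in> L1 w \<and> n1 w (\<lambda>i. u n i - c i) \<le> e"
    if e: "\<And>m. m \<ge> n0 \<Longrightarrow> n1 w (\<lambda>i. u n i - u m i) < e" for n n0 e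
  proof -
    have fin: "(\<Sum>i\<in>F. cmod (u n i - c i) * w i) \<le> e" if F: "finite F" for F
    proof (rule LIMSEQ_le_const2)
      show "(\<lambda>m. \<Sum>i\<in>F. cmod (u n i - u m i) * w i) \<longlonglongrightarrow> (\<Sum>i\<in>F. cmod (u n i - c i) * w i)"
        by (intro tendsto_intros c)
      have "(\<Sum>i\<in>F. cmod (u n i - u m i) * w i) \<le> n1 w (\<lambda>i. u n i - u m i)" for m
        unfolding n1_def using L1_diff[OF u u, of n m] F
        by (intro finite_sum_le_infsum) (auto simp: L1_def wpos less_imp_le)
      then show "\<exists>N. \<forall>m\<ge>N. (\<Sum>i\<in>F. cmod (u n i - u m i) * w i) \<le> e"
        using e by (meson less_imp_le order_trans)
    qed
    have s: "(\<lambda>i. cmod (u n i - c i) * w i) summable_on UNIV"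
      by (rule nonneg_bdd_above_summable_on)
        (auto simp: wpos less_imp_le intro!: bdd_aboveI[of _ e] fin)
    then show ?thesis
      using infsum_le_finite_sums[OF s, of e] fin by (auto simp: L1_def n1_def)
  qed
  obtain n0 where N: "\<And>m. m \<ge> n0 \<Longrightarrow> n1 w (\<lambda>i. u n0 i - u m i) < 1"
    using cauchy[of 1] by auto
  have "(\<lambda>i. u n0 i - c i) \<in> L1 w" by (rule conjunct1[OF near]) (rule N)
  then have "(\<lambda>i. u n0 i - (u n0 i - c i)) \<in> L1 w" by (rule L1_diff[OF u])
  then have cL: "c \<in> L1 w" by simp
  have "(\<lambda>n. n1 w (\<lambda>i. u n i - c i)) \<longlonglongrightarrow> 0"
  proof (rule LIMSEQ_I)
    fix e :: real assume "e > 0"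
    then obtain n0 where n0: "\<And>m n. m \<ge> n0 \<Longrightarrow> n \<ge> n0 \<Longrightarrow> n1 w (\<lambda>i. u m i - u n i) < e / 2"
      using cauchy[of "e / 2"] by auto
    have "norm (n1 w (\<lambda>i. u n i - c i) - 0) < e" if "n \<ge> n0" for n
    proof -
      have "n1 w (\<lambda>i. u n i - c i) \<le> e / 2" by (rule conjunct2[OF near[of n0]]) (rule n0[OF that])
      then show ?thesis using n1_nonneg[of "\<lambda>i. u n i - c i"] \<open>e > 0\<close> by simp
    qed
    then show "\<exists>no. \<forall>n\<ge>no. norm (n1 w (\<lambda>i. u n i - c i) - 0) < e" by blast
  qed
  then show ?thesis using cL by blast
qed

lemma L1_Linf_summable:
  assumes c: "c \<in> L1 w" and d: "\<And>i. cmod (d i) \<le> K * w i"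
  shows "(\<lambda>i. cmod (c i * d i)) summable_on UNIV" "(\<lambda>i. c i * d i) summable_on UNIV"
    "cmod (\<Sum>\<^sub>\<infinity>i. c i * d i) \<le> K * n1 w c"
proof -
  have s: "(\<lambda>i. K * (cmod (c i) * w i)) summable_on UNIV"
    using c by (intro summable_on_cmult_right) (simp add: L1_def)
  have le: "cmod (c i * d i) \<le> K * (cmod (c i) * w i)" for i
    using mult_left_mono[OF d[of i], of "cmod (c i)"] by (simp add: norm_mult mult_ac)
  show 1: "(\<lambda>i. cmod (c i * d i)) summable_on UNIV"
    by (rule summable_on_comparison_test[OF s le]) simp
  then show "(\<lambda>i. c i * d i) summable_on UNIV"
    by (simp add: summable_on_iff_abs_summable_on_complex)
  have "cmod (\<Sum>\<^sub>\<infinity>i. c i * d i) \<le> (\<Sum>\<^sub>\<infinity>i. cmod (c i * d i))" by (rule norm_infsum_bound[OF 1])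
  also have "\<dots> \<le> (\<Sum>\<^sub>\<infinity>i. K * (cmod (c i) * w i))" by (rule infsum_mono[OF 1 s le])
  finally show "cmod (\<Sum>\<^sub>\<infinity>i. c i * d i) \<le> K * n1 w c"
    by (simp add: n1_def infsum_cmult_right')
qed

end

definition herm :: "'i matrix \<Rightarrow> bool"
  where "herm A \<longleftrightarrow> (\<forall>i j. A j i = cnj (A i j))"

locale schur_matrix = weight w for w :: "'i \<Rightarrow> real" +
  fixes A :: "'i matrix" and C :: real
  assumes schur: "schur w A C" and herm: "herm A"
begin

lemma C_nonneg: "0 \<le> C" using schur by (simp add: schur_def)

lemma A_sym: "cmod (A j i) = cmod (A i j)" using herm by (metis herm_def complex_mod_cnj)

lemma cnj_A: "cnj (A i j) = A j i" using herm unfolding herm_def by metis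

lemma column_bound: "finite F \<Longrightarrow> (\<Sum>i\<in>F. cmod (A i j) * w i) \<le> C * w j"
  using schur by (simp add: schur_def)

lemma row_bound: "finite F \<Longrightarrow> (\<Sum>j\<in>F. cmod (A i j) * w j) \<le> C * w i"
  using column_bound[of F i] A_sym by simp

lemma row_summable: "(\<lambda>j. cmod (A i j) * w j) summable_on UNIV"
  by (rule nonneg_bdd_above_summable_on)
    (auto simp: wpos less_imp_le intro!: bdd_aboveI[of _ "C * w i"] row_bound)

lemma column_L1: "(\<lambda>i. A i j) \<in> L1 w"
  using row_summable[of j] A_sym by (simp add: L1_def)

lemma column_n1: "n1 w (\<lambda>i. A i j) \<le> C * w j"
  unfolding n1_def
  by (rule infsum_le_finite_sums) (use column_L1[of j] column_bound in \<open>auto simp: L1_def\<close>)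

lemma column_Linf: "cmod (A i j) \<le> C * w i / w j"
  using row_bound[of "{j}" i] wpos[of j] by (simp add: field_simps)

lemma app_L1:
  assumes c: "c \<in> L1 w"
  shows "(\<lambda>j. A i j * c j) summable_on UNIV" "mat_app A c \<in> L1 w" "n1 w (mat_app A c) \<le> C * n1 w c"
proof -
  define g where "g i j = A i j * c j * complex_of_real (w i)" for i j
  have cg: "cmod (g i j) = cmod (c j) * (cmod (A i j) * w i)" for i j
    using wpos[of i] by (simp add: g_def norm_mult mult_ac)
  have le: "(\<Sum>i\<in>F. cmod (g i j)) \<le> C * (cmod (c j) * w j)" if "finite F" for F j
    using mult_left_mono[OF column_bound[OF that, of j], of "cmod (c j)"]
    unfolding cg sum_distrib_left[symmetric] by (simp add: mult.left_commute)
  have b: "(\<lambda>j. C * (cmod (c j) * w j)) summable_on UNIV"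
    using c by (intro summable_on_cmult_right) (simp add: L1_def)
  note d = double_sumI[OF le b]
  have "(\<lambda>j. g i j * (1 / complex_of_real (w i))) summable_on UNIV"
    by (intro summable_on_cmult_left double_sumD(1)[OF d(1)])
  moreover have "g i j * (1 / complex_of_real (w i)) = A i j * c j" for j
    using wpos[of i] by (simp add: g_def)
  ultimately show "(\<lambda>j. A i j * c j) summable_on UNIV" by simp
  have e: "cmod (mat_app A c i) * w i = cmod (\<Sum>\<^sub>\<infinity>j. g i j)" for i
    using wpos[of i] by (simp add: mat_app_def g_def infsum_cmult_left' norm_mult)
  show "mat_app A c \<in> L1 w" using double_sumD(4)[OF d(1)] by (simp add: L1_def e)
  show "n1 w (mat_app A c) \<le> C * n1 w c"
    using double_sumD(5)[OF d(1)] d(2) by (simp add: n1_def e infsum_cmult_right')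
qed

lemma app_Linf:
  assumes d: "\<And>i. cmod (d i) \<le> K * w i"
  shows "(\<lambda>j. cmod (A i j * d j)) summable_on UNIV" "(\<lambda>j. A i j * d j) summable_on UNIV"
    "cmod (mat_app A d i) \<le> K * C * w i"
proof -
  have K: "K \<ge> 0" using d[of undefined] wpos[of undefined] by (smt (verit) norm_ge_zero zero_le_mult_iff)
  have r: "A i \<in> L1 w" using row_summable[of i] by (simp add: L1_def)
  show "(\<lambda>j. cmod (A i j * d j)) summable_on UNIV" "(\<lambda>j. A i j * d j) summable_on UNIV"
    by (rule L1_Linf_summable[OF r d])+
  have "n1 w (A i) \<le> C * w i" using column_n1[of i] A_sym by (simp add: n1_def)
  then have "K * n1 w (A i) \<le> K * (C * w i)" using K by (rule mult_left_mono)
  then show "cmod (mat_app A d i) \<le> K * C * w i"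
    using L1_Linf_summable(3)[OF r d] by (simp add: mat_app_def mult.assoc)
qed

text \<open>A Hermitian matrix is its own adjoint for the pairing of \<open>L1 w\<close> with \<open>Linf w\<close>; the Schur bound on rows
  justifies exchanging the two sums.\<close>

lemma app_dual:
  assumes c: "c \<in> L1 w" and d: "\<And>i. cmod (d i) \<le> K * w i"
  shows "(\<Sum>\<^sub>\<infinity>i. c i * cnj (mat_app A d i)) = (\<Sum>\<^sub>\<infinity>i. mat_app A c i * cnj (d i))"
proof -
  have K: "K \<ge> 0" using d[of undefined] wpos[of undefined] by (smt (verit) norm_ge_zero zero_le_mult_iff)
  define g where "g j i = c i * cnj (A i j * d j)" for i j
  have le: "(\<Sum>j\<in>F. cmod (g j i)) \<le> K * C * (cmod (c i) * w i)" if "finite F" for F i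
  proof -
    have "(\<Sum>j\<in>F. cmod (g j i)) \<le> (\<Sum>j\<in>F. K * cmod (c i) * (cmod (A i j) * w j))"
    proof (rule sum_mono)
      fix j
      have "cmod (c i) * (cmod (A i j) * cmod (d j)) \<le> cmod (c i) * (cmod (A i j) * (K * w j))"
        by (intro mult_left_mono d) auto
      then show "cmod (g j i) \<le> K * cmod (c i) * (cmod (A i j) * w j)"
        by (simp add: g_def norm_mult mult_ac)
    qed
    also have "\<dots> \<le> K * cmod (c i) * (C * w i)"
      unfolding sum_distrib_left[symmetric] using K by (intro mult_left_mono row_bound that) auto
    finally show ?thesis by (simp add: mult_ac)
  qed
  have b: "(\<lambda>i. K * C * (cmod (c i) * w i)) summable_on UNIV"
    using c by (intro summable_on_cmult_right) (simp add: L1_def)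
  have swap: "(\<Sum>\<^sub>\<infinity>j. \<Sum>\<^sub>\<infinity>i. g j i) = (\<Sum>\<^sub>\<infinity>i. \<Sum>\<^sub>\<infinity>j. g j i)"
    by (rule double_sumD(2)[OF double_sumI(1)[OF le b]])
  have "(\<Sum>\<^sub>\<infinity>j. g j i) = c i * cnj (mat_app A d i)" for i
    unfolding g_def mat_app_def infsum_cnj[symmetric] by (rule infsum_cmult_right')
  moreover have "(\<Sum>\<^sub>\<infinity>i. g j i) = mat_app A c j * cnj (d j)" for j
  proof -
    have "g j i = A j i * c i * cnj (d j)" for i
      by (simp add: g_def cnj_A mult_ac)
    then show ?thesis by (simp add: mat_app_def infsum_cmult_left')
  qed
  ultimately show ?thesis using swap by simp
qed

lemma app_L1_tendsto:
  assumes u: "\<And>n. u n \<in> L1 w" and c: "c \<in> L1 w" and lim: "(\<lambda>n. n1 w (\<lambda>i. u n i - c i)) \<longlonglongrightarrow> 0"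
  shows "(\<lambda>n. n1 w (\<lambda>i. mat_app A (u n) i - mat_app A c i)) \<longlonglongrightarrow> 0"
proof (rule Lim_null_comparison)
  have e: "(\<lambda>i. mat_app A (u n) i - mat_app A c i) = mat_app A (\<lambda>i. u n i - c i)" for n
    unfolding mat_app_def right_diff_distrib
    by (intro ext infsum_sub[symmetric] app_L1(1) u c)
  show "\<forall>\<^sub>F n in sequentially. norm (n1 w (\<lambda>i. mat_app A (u n) i - mat_app A c i)) \<le> C * n1 w (\<lambda>i. u n i - c i)"
    unfolding e using app_L1(3)[OF L1_diff[OF u c]] n1_nonneg by simp
  show "(\<lambda>n. C * n1 w (\<lambda>i. u n i - c i)) \<longlonglongrightarrow> 0" by (rule tendsto_mult_right_zero[OF lim])
qed

lemma app_Linf_tendsto: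
  assumes u: "\<And>n i. cmod (u n i) \<le> K * w i" and lim: "\<And>i. (\<lambda>n. u n i) \<longlonglongrightarrow> c i"
  shows "(\<lambda>n. mat_app A (u n) i) \<longlonglongrightarrow> mat_app A c i"
  unfolding mat_app_def
proof (rule dominated_infsum)
  show "(\<lambda>j. K * (cmod (A i j) * w j)) summable_on UNIV"
    by (intro summable_on_cmult_right row_summable)
  show "cmod (A i j * u n j) \<le> K * (cmod (A i j) * w j)" for n j
    using mult_left_mono[OF u[of n j], of "cmod (A i j)"] by (simp add: norm_mult mult_ac)
  show "(\<lambda>n. A i j * u n j) \<longlonglongrightarrow> A i j * c j" for j by (intro tendsto_intros lim)
qed

end

lemma truncation_tendsto:
  fixes f :: "'i::countable \<Rightarrow> real"
  assumes "f summable_on UNIV"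
  shows "(\<lambda>n. \<Sum>\<^sub>\<infinity>i. f i - (if to_nat i < n then f i else 0)) \<longlonglongrightarrow> 0"
proof -
  have fin: "finite {i :: 'i. to_nat i < n}" for n
    using finite_vimageI[OF finite_lessThan, of to_nat n] by (simp add: vimage_def)
  have "filterlim (\<lambda>n. {i :: 'i. to_nat i < n}) (finite_subsets_at_top UNIV) sequentially"
    unfolding filterlim_finite_subsets_at_top
  proof (intro allI impI)
    fix X :: "'i set" assume "finite X \<and> X \<subseteq> UNIV"
    then have "finite (to_nat ` X)" by simp
    then obtain m where m: "\<And>i. i \<in> X \<Longrightarrow> to_nat i < m"
      by (auto simp: finite_nat_set_iff_bounded)
    show "\<forall>\<^sub>F n in sequentially. finite {i :: 'i. to_nat i < n} \<and> X \<subseteq> {i. to_nat i < n} \<and> {i :: 'i. to_nat i < n} \<subseteq> UNIV"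
      using eventually_ge_at_top[of m] by (rule eventually_mono) (use m fin in \<open>auto intro: less_le_trans\<close>)
  qed
  then have "(\<lambda>n. sum f {i. to_nat i < n}) \<longlonglongrightarrow> infsum f UNIV"
    using infsum_tendsto[OF assms] by (rule filterlim_compose[rotated])
  then have "(\<lambda>n. infsum f UNIV - sum f {i. to_nat i < n}) \<longlonglongrightarrow> infsum f UNIV - infsum f UNIV"
    by (intro tendsto_intros)
  moreover have "(\<Sum>\<^sub>\<infinity>i. f i - (if to_nat i < n then f i else 0)) = infsum f UNIV - sum f {i. to_nat i < n}" for n
  proof -
    have h: "((\<lambda>i. if to_nat i < n then f i else 0) has_sum sum f {i. to_nat i < n}) UNIV"
      by (rule has_sum_finite_neutralI[OF fin]) (auto intro: sum.cong)
    show ?thesis using infsum_sub[OF assms has_sum_imp_summable[OF h]] infsumI[OF h] by simp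
  qed
  ultimately show ?thesis by simp
qed

section \<open>Coefficient models of the co-orbit spaces\<close>

text \<open>A normed space on a carrier whose elements are determined by sequences: \<open>cf\<close> is a linear bijection
  onto the set \<open>D\<close>.\<close>

locale coef_model =
  fixes X :: "'v cnormed" and cf :: "'v \<Rightarrow> 'i \<Rightarrow> complex" and D :: "('i \<Rightarrow> complex) set"
  assumes cf_bij: "bij_betw cf (carr X) D"
    and add_carr: "F \<in> carr X \<Longrightarrow> G \<in> carr X \<Longrightarrow> vadd X F G \<in> carr X"
    and cf_add: "F \<in> carr X \<Longrightarrow> G \<in> carr X \<Longrightarrow> cf (vadd X F G) = (\<lambda>i. cf F i + cf G i)"
    and scale_carr: "F \<in> carr X \<Longrightarrow> vscale X a F \<in> carr X"
    and cf_scale: "F \<in> carr X \<Longrightarrow> cf (vscale X a F) = (\<lambda>i. a * cf F i)"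
    and zero_carr: "vzero X \<in> carr X"
    and cf_zero: "cf (vzero X) = (\<lambda>i. 0)"
begin

lemma cf_mem: "F \<in> carr X \<Longrightarrow> cf F \<in> D"
  using cf_bij by (rule bij_betwE[THEN bspec])

lemma cf_inject: "F \<in> carr X \<Longrightarrow> G \<in> carr X \<Longrightarrow> cf F = cf G \<Longrightarrow> F = G"
  using cf_bij by (meson bij_betw_def inj_onD)

definition el :: "('i \<Rightarrow> complex) \<Rightarrow> 'v" where "el = inv_into (carr X) cf"

lemma el_carr: "c \<in> D \<Longrightarrow> el c \<in> carr X"
  using cf_bij unfolding el_def by (metis bij_betw_def inv_into_into)

lemma cf_el: "c \<in> D \<Longrightarrow> cf (el c) = c"
  using cf_bij unfolding el_def by (meson bij_betw_inv_into_right)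

end

text \<open>If equivalence of sequences means that a linear map \<open>\<kappa>\<close> takes the same value, then the classes are the
  nonempty fibres of \<open>\<kappa>\<close>.\<close>

lemma seq_quotient_coef_model:
  fixes \<kappa> :: "(nat \<Rightarrow> 'h::cinner_space) \<Rightarrow> 'i \<Rightarrow> complex"
  assumes rel: "r = {(f, g). f \<in> V \<and> g \<in> V \<and> \<kappa> f = \<kappa> g}"
    and V0: "(\<lambda>n. 0) \<in> V" and V_add: "\<And>f g. f \<in> V \<Longrightarrow> g \<in> V \<Longrightarrow> (\<lambda>n. f n + g n) \<in> V"
    and V_scale: "\<And>a f. f \<in> V \<Longrightarrow> (\<lambda>n. a *\<^sub>C f n) \<in> V"
    and k0: "\<kappa> (\<lambda>n. 0) = (\<lambda>i. 0)"
    and k_add: "\<And>f g. f \<in> V \<Longrightarrow> g \<in> V \<Longrightarrow> \<kappa> (\<lambda>n. f n + g n) = (\<lambda>i. \<kappa> f i + \<kappa> g i)"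
    and k_scale: "\<And>a f. f \<in> V \<Longrightarrow> \<kappa> (\<lambda>n. a *\<^sub>C f n) = (\<lambda>i. a * \<kappa> f i)"
    and image: "\<kappa> ` V = D"
  shows "coef_model (seq_quotient V r \<nu>) (\<lambda>F. \<kappa> (rep_seq F)) D"
    and "F \<in> carr (seq_quotient V r \<nu>) \<Longrightarrow> rep_seq F \<in> V"
proof -
  let ?X = "seq_quotient V r \<nu>"
  define cl where "cl c = {f \<in> V. \<kappa> f = c}" for c
  have cls: "r `` {f} = cl (\<kappa> f)" if "f \<in> V" for f
    using that by (auto simp: rel cl_def)
  have carr: "carr ?X = cl ` D"
    unfolding image[symmetric] by (auto simp: seq_quotient_def quotient_def cls)
  have rep: "rep_seq (cl c) \<in> V \<and> \<kappa> (rep_seq (cl c)) = c" if c: "c \<in> D" for c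
  proof -
    have "\<exists>f. f \<in> cl c" using c image by (auto simp: cl_def)
    then have "rep_seq (cl c) \<in> cl c" unfolding rep_seq_def by (rule someI_ex)
    then show ?thesis by (simp add: cl_def)
  qed
  then show "F \<in> carr ?X \<Longrightarrow> rep_seq F \<in> V" for F by (auto simp: carr)
  have D_E: "\<exists>f\<in>V. \<kappa> f = c" if "c \<in> D" for c using that image by blast
  have D_I: "\<kappa> f \<in> D" if "f \<in> V" for f using that image by blast
  have D_add: "(\<lambda>i. c i + d i) \<in> D" if cd: "c \<in> D" "d \<in> D" for c d
  proof -
    obtain f g where "f \<in> V" "\<kappa> f = c" "g \<in> V" "\<kappa> g = d" using cd D_E by blast
    then show ?thesis using D_I[OF V_add, of f g] k_add[of f g] by simp
  qed
  have D_scale: "(\<lambda>i. a * c i) \<in> D" if c: "c \<in> D" for c a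
  proof -
    obtain f where "f \<in> V" "\<kappa> f = c" using c D_E by blast
    then show ?thesis using D_I[OF V_scale, of f a] k_scale[of f a] by simp
  qed
  have D_zero: "(\<lambda>i. 0) \<in> D" using D_I[OF V0] by (simp add: k0)
  have one_class: "r `` B = cl c" if B: "B \<noteq> {}" "B \<subseteq> V" "\<And>f. f \<in> B \<Longrightarrow> \<kappa> f = c" for B c
    using B by (auto simp: rel cl_def)
  have vadd: "vadd ?X (cl c) (cl d) = cl (\<lambda>i. c i + d i)" if cd: "c \<in> D" "d \<in> D" for c d
  proof -
    obtain f g where fg: "f \<in> V" "\<kappa> f = c" "g \<in> V" "\<kappa> g = d" using cd D_E by blast
    have "r `` {\<lambda>n. f n + g n | f g. f \<in> cl c \<and> g \<in> cl d} = cl (\<lambda>i. c i + d i)"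
    proof (rule one_class)
      show "{\<lambda>n. f n + g n | f g. f \<in> cl c \<and> g \<in> cl d} \<noteq> {}" using fg by (auto simp: cl_def)
    qed (auto simp: cl_def V_add k_add)
    then show ?thesis by (simp add: seq_quotient_def)
  qed
  have vscale: "vscale ?X a (cl c) = cl (\<lambda>i. a * c i)" if c: "c \<in> D" for a c
  proof -
    obtain f where f: "f \<in> V" "\<kappa> f = c" using c D_E by blast
    have "r `` {\<lambda>n. a *\<^sub>C f n | f. f \<in> cl c} = cl (\<lambda>i. a * c i)"
    proof (rule one_class)
      show "{\<lambda>n. a *\<^sub>C f n | f. f \<in> cl c} \<noteq> {}" using f by (auto simp: cl_def)
    qed (auto simp: cl_def V_scale k_scale)
    then show ?thesis by (simp add: seq_quotient_def)
  qed
  have vzero: "vzero ?X = cl (\<lambda>i. 0)" by (simp add: seq_quotient_def cls[OF V0] k0)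
  show "coef_model ?X (\<lambda>F. \<kappa> (rep_seq F)) D"
  proof
    show "bij_betw (\<lambda>F. \<kappa> (rep_seq F)) (carr ?X) D"
      by (rule bij_betw_byWitness[where f' = cl]) (use rep in \<open>auto simp: carr\<close>)
  qed (auto simp: carr vadd vscale vzero rep D_add D_scale D_zero)
qed

context localised_pair
begin

definition P :: "'i matrix" where "P i j = cinner (\<psi> j) (\<phi> i)"

definition "G = gram \<psi>"

lemma hermP: "herm P"
  unfolding herm_def P_def by (metis hermitian cinner_commute)

lemma hermG: "herm G"
  unfolding herm_def G_def gram_def by (metis cinner_commute)

sublocale weight w by unfold_locales (rule w_pos)

sublocale P: schur_matrix w P C
  by unfold_locales (use schur_P hermP in \<open>auto simp: P_def[abs_def]\<close>)

sublocale G: schur_matrix w G C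
  by unfold_locales (use schur_G hermG in \<open>auto simp: G_def\<close>)

text \<open>Both this and the next identity are the reconstruction formula, tested with \<open>\<phi> i\<close> and with \<open>\<psi> i\<close>.\<close>

lemma P_analysis: "mat_app P (analysis \<phi> f) = analysis \<phi> f"
  using infsumI[OF recon[of f]] by (simp add: mat_app_def P_def analysis_def fun_eq_iff mult.commute)

lemma G_analysis: "mat_app G (analysis \<phi> f) = analysis \<psi> f"
  using infsumI[OF recon[of f]] by (simp add: mat_app_def G_def gram_def analysis_def fun_eq_iff mult.commute)

definition D1 :: "('i \<Rightarrow> complex) set" where "D1 = {c \<in> L1 w. mat_app P c = c}"

definition Dinf :: "('i \<Rightarrow> complex) set" where "Dinf = {c \<in> Linf w. mat_app P c = c}"

definition \<kappa> :: "(nat \<Rightarrow> 'h) \<Rightarrow> 'i \<Rightarrow> complex"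
  where "\<kappa> f i = lim (\<lambda>n. analysis \<phi> (f n) i)"

lemma ext_analysis_dual: "ext_analysis \<phi> = (\<lambda>F. \<kappa> (rep_seq F))"
  by (simp add: ext_analysis_def \<kappa>_def fun_eq_iff)

lemma analysis_finite_combination:
  assumes "finite I"
  shows "analysis \<phi> (\<Sum>i\<in>I. c i *\<^sub>C \<psi> i) = mat_app P (\<lambda>i. if i \<in> I then c i else 0)"
proof
  fix k
  have "((\<lambda>j. P k j * (if j \<in> I then c j else 0)) has_sum (\<Sum>i\<in>I. c i * P k i)) UNIV"
    by (rule has_sum_finite_neutralI[OF assms]) (auto intro!: sum.cong)
  then show "analysis \<phi> (\<Sum>i\<in>I. c i *\<^sub>C \<psi> i) k = mat_app P (\<lambda>i. if i \<in> I then c i else 0) k"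
    by (simp add: mat_app_def infsumI analysis_def cinner_sum_left cinner_scaleC_left P_def)
qed

lemma H00_L1: "f \<in> H00 \<psi> \<Longrightarrow> analysis \<phi> f \<in> L1 w"
  by (auto simp: H00_def analysis_finite_combination intro!: P.app_L1(2) L1_finite_support)

lemma H00_zero: "0 \<in> H00 \<psi>"
  unfolding H00_def mem_Collect_eq by (intro exI[of _ "{}"]) simp

lemma H00_add:
  assumes "f \<in> H00 \<psi>" "g \<in> H00 \<psi>"
  shows "f + g \<in> H00 \<psi>"
proof -
  obtain I c J d where fg: "f = (\<Sum>i\<in>I. c i *\<^sub>C \<psi> i)" "finite I" "g = (\<Sum>i\<in>J. d i *\<^sub>C \<psi> i)" "finite J"
    using assms by (auto simp: H00_def)
  have f: "f = (\<Sum>i\<in>I \<union> J. (if i \<in> I then c i else 0) *\<^sub>C \<psi> i)"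
    unfolding fg(1) by (rule sum.mono_neutral_cong_left) (use fg in auto)
  have g: "g = (\<Sum>i\<in>I \<union> J. (if i \<in> J then d i else 0) *\<^sub>C \<psi> i)"
    unfolding fg(3) by (rule sum.mono_neutral_cong_left) (use fg in auto)
  have "f + g = (\<Sum>i\<in>I \<union> J. ((if i \<in> I then c i else 0) + (if i \<in> J then d i else 0)) *\<^sub>C \<psi> i)"
    unfolding scaleC_add_left sum.distrib f[symmetric] g[symmetric] ..
  moreover have "finite (I \<union> J)" using fg by simp
  ultimately show ?thesis unfolding H00_def mem_Collect_eq by (intro exI conjI)
qed

lemma H00_scale:
  assumes "f \<in> H00 \<psi>"
  shows "a *\<^sub>C f \<in> H00 \<psi>"
proof -
  obtain I c where f: "f = (\<Sum>i\<in>I. c i *\<^sub>C \<psi> i)" and I: "finite I" using assms by (auto simp: H00_def)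
  have "a *\<^sub>C f = (\<Sum>i\<in>I. (a * c i) *\<^sub>C \<psi> i)" by (simp add: f scaleC_sum_right scaleC_scaleC)
  then show ?thesis using I unfolding H00_def mem_Collect_eq by (intro exI conjI)
qed

lemma H00_norm_n1: "H00_norm 1 \<psi> w f = n1 w (analysis \<phi> f)"
  by (simp add: H00_norm_def dual lpw_norm_def lp_norm_def n1_def norm_mult infsum_nonneg w_pos less_imp_le)

lemma fin_seqs_iff: "f \<in> fin_seqs 1 \<psi> w \<longleftrightarrow> (\<forall>n. f n \<in> H00 \<psi>) \<and>
    (\<exists>c\<in>L1 w. (\<lambda>n. n1 w (\<lambda>i. analysis \<phi> (f n) i - c i)) \<longlonglongrightarrow> 0)"
  (is "_ \<longleftrightarrow> ?H \<and> ?L")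
proof -
  have "(\<forall>e>0. \<exists>n0. \<forall>m\<ge>n0. \<forall>n\<ge>n0. n1 w (analysis \<phi> (f m - f n)) < e) \<longleftrightarrow> ?L" if h: ?H
  proof
    assume "\<forall>e>0. \<exists>n0. \<forall>m\<ge>n0. \<forall>n\<ge>n0. n1 w (analysis \<phi> (f m - f n)) < e"
    then show ?L using h by (intro L1_complete) (auto simp: analysis_diff H00_L1)
  next
    assume ?L
    then obtain c where c: "c \<in> L1 w" and lim: "(\<lambda>n. n1 w (\<lambda>i. analysis \<phi> (f n) i - c i)) \<longlonglongrightarrow> 0" by blast
    show "\<forall>e>0. \<exists>n0. \<forall>m\<ge>n0. \<forall>n\<ge>n0. n1 w (analysis \<phi> (f m - f n)) < e"
    proof (intro allI impI)
      fix e :: real assume "e > 0"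
      then have "\<forall>\<^sub>F n in sequentially. n1 w (\<lambda>i. analysis \<phi> (f n) i - c i) < e / 2"
        using lim by (intro order_tendstoD(2)) auto
      then obtain n0 where n0: "\<And>n. n \<ge> n0 \<Longrightarrow> n1 w (\<lambda>i. analysis \<phi> (f n) i - c i) < e / 2"
        by (auto simp: eventually_sequentially)
      have "n1 w (analysis \<phi> (f m - f n)) < e" if "m \<ge> n0" "n \<ge> n0" for m n
      proof -
        have "n1 w (analysis \<phi> (f m - f n)) \<le>
            n1 w (\<lambda>i. analysis \<phi> (f m) i - c i) + n1 w (\<lambda>i. c i - analysis \<phi> (f n) i)"
          unfolding analysis_diff using h by (intro n1_diff_triangle H00_L1 c) auto
        then show ?thesis using n0[OF that(1)] n0[OF that(2)]
          by (simp add: n1_diff_commute[of c])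
      qed
      then show "\<exists>n0. \<forall>m\<ge>n0. \<forall>n\<ge>n0. n1 w (analysis \<phi> (f m - f n)) < e" by blast
    qed
  qed
  then show ?thesis unfolding fin_seqs_def mem_Collect_eq H00_norm_n1 by blast
qed

lemma fin_seqs_limit:
  assumes f: "f \<in> fin_seqs 1 \<psi> w"
  shows "\<And>n. analysis \<phi> (f n) \<in> L1 w" "\<kappa> f \<in> L1 w"
    "(\<lambda>n. n1 w (\<lambda>i. analysis \<phi> (f n) i - \<kappa> f i)) \<longlonglongrightarrow> 0"
    "\<And>i. (\<lambda>n. analysis \<phi> (f n) i) \<longlonglongrightarrow> \<kappa> f i"
proof -
  show u: "analysis \<phi> (f n) \<in> L1 w" for n using f by (auto simp: fin_seqs_iff H00_L1)
  obtain c where c: "c \<in> L1 w" and lim: "(\<lambda>n. n1 w (\<lambda>i. analysis \<phi> (f n) i - c i)) \<longlonglongrightarrow> 0"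
    using f by (auto simp: fin_seqs_iff)
  have pw: "(\<lambda>n. analysis \<phi> (f n) i) \<longlonglongrightarrow> c i" for i by (rule L1_limit_pointwise[OF u c lim])
  then have k: "\<kappa> f = c" by (auto simp: \<kappa>_def fun_eq_iff intro: limI)
  show "\<kappa> f \<in> L1 w" "(\<lambda>n. n1 w (\<lambda>i. analysis \<phi> (f n) i - \<kappa> f i)) \<longlonglongrightarrow> 0"
    "(\<lambda>n. analysis \<phi> (f n) i) \<longlonglongrightarrow> \<kappa> f i" for i
    using c lim pw by (auto simp: k)
qed

lemma fin_seqs_app:
  assumes f: "f \<in> fin_seqs 1 \<psi> w" and A: "schur_matrix w A K"
  shows "(\<lambda>n. mat_app A (analysis \<phi> (f n)) i) \<longlonglongrightarrow> mat_app A (\<kappa> f) i"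
proof -
  interpret A: schur_matrix w A K by fact
  note l = fin_seqs_limit[OF f]
  show ?thesis
    by (rule L1_limit_pointwise[OF A.app_L1(2)[OF l(1)] A.app_L1(2)[OF l(2)] A.app_L1_tendsto[OF l(1-3)]])
qed

lemma fin_seqs_fixed: "f \<in> fin_seqs 1 \<psi> w \<Longrightarrow> mat_app P (\<kappa> f) = \<kappa> f"
  by (rule ext, rule LIMSEQ_unique[OF fin_seqs_app[OF _ P.schur_matrix_axioms, unfolded P_analysis]
      fin_seqs_limit(4)])

lemma fin_seqs_of_limit:
  assumes "\<And>n. f n \<in> H00 \<psi>" "c \<in> L1 w" "(\<lambda>n. n1 w (\<lambda>i. analysis \<phi> (f n) i - c i)) \<longlonglongrightarrow> 0"
  shows "f \<in> fin_seqs 1 \<psi> w" "\<kappa> f = c"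
proof -
  show f: "f \<in> fin_seqs 1 \<psi> w" using assms by (auto simp: fin_seqs_iff)
  have "(\<lambda>n. analysis \<phi> (f n) i) \<longlonglongrightarrow> c i" for i
    by (rule L1_limit_pointwise[OF fin_seqs_limit(1)[OF f] assms(2,3)])
  then show "\<kappa> f = c" by (auto simp: \<kappa>_def fun_eq_iff intro: limI)
qed

text \<open>Cauchy sequences of coefficients converge in norm, so a difference is null in norm as soon as it is
  null entrywise.\<close>

lemma fin_rel_eq: "fin_rel 1 \<psi> w = {(f, g). f \<in> fin_seqs 1 \<psi> w \<and> g \<in> fin_seqs 1 \<psi> w \<and> \<kappa> f = \<kappa> g}"
proof -
  have "(\<lambda>n. n1 w (analysis \<phi> (f n - g n))) \<longlonglongrightarrow> 0 \<longleftrightarrow> \<kappa> f = \<kappa> g"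
    if f: "f \<in> fin_seqs 1 \<psi> w" and g: "g \<in> fin_seqs 1 \<psi> w" for f g
  proof
    note lf = fin_seqs_limit[OF f] note lg = fin_seqs_limit[OF g]
    assume z: "(\<lambda>n. n1 w (analysis \<phi> (f n - g n))) \<longlonglongrightarrow> 0"
    have zero: "(\<lambda>i. 0) \<in> L1 w" by (simp add: L1_def)
    have "(\<lambda>n. analysis \<phi> (f n) i - analysis \<phi> (g n) i) \<longlonglongrightarrow> 0" for i
      by (rule L1_limit_pointwise[where u = "\<lambda>n i. analysis \<phi> (f n) i - analysis \<phi> (g n) i", OF _ zero])
        (use z L1_diff[OF lf(1) lg(1)] in \<open>simp_all add: analysis_diff\<close>)
    then have "(\<lambda>n. analysis \<phi> (f n) i) \<longlonglongrightarrow> \<kappa> g i" for i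
      using tendsto_add[OF _ lg(4)[of i], of "\<lambda>n. analysis \<phi> (f n) i - analysis \<phi> (g n) i" 0] by simp
    then show "\<kappa> f = \<kappa> g" by (intro ext LIMSEQ_unique[OF lf(4)])
  next
    note lf = fin_seqs_limit[OF f] note lg = fin_seqs_limit[OF g]
    assume e: "\<kappa> f = \<kappa> g"
    show "(\<lambda>n. n1 w (analysis \<phi> (f n - g n))) \<longlonglongrightarrow> 0"
    proof (rule Lim_null_comparison)
      have "norm (n1 w (analysis \<phi> (f n - g n))) \<le> n1 w (\<lambda>i. analysis \<phi> (f n) i - \<kappa> f i)
          + n1 w (\<lambda>i. analysis \<phi> (g n) i - \<kappa> g i)" for n
        unfolding analysis_diff
        using n1_diff_triangle[OF lf(1,2) lg(1), of n n] n1_nonneg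
        by (simp add: n1_diff_commute[of "\<kappa> f"] e[symmetric])
      then show "\<forall>\<^sub>F n in sequentially. norm (n1 w (analysis \<phi> (f n - g n))) \<le>
          n1 w (\<lambda>i. analysis \<phi> (f n) i - \<kappa> f i) + n1 w (\<lambda>i. analysis \<phi> (g n) i - \<kappa> g i)" by simp
      show "(\<lambda>n. n1 w (\<lambda>i. analysis \<phi> (f n) i - \<kappa> f i) + n1 w (\<lambda>i. analysis \<phi> (g n) i - \<kappa> g i)) \<longlonglongrightarrow> 0"
        using tendsto_add[OF lf(3) lg(3)] by simp
    qed
  qed
  then show ?thesis unfolding fin_rel_def H00_norm_n1 by auto
qed

definition trunc :: "nat \<Rightarrow> ('i \<Rightarrow> complex) \<Rightarrow> 'i \<Rightarrow> complex"
  where "trunc n c = (\<lambda>i. if to_nat i < n then c i else 0)"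

text \<open>For a sequence \<open>c\<close> fixed by \<open>P\<close> the dual coefficients of these vectors, which are \<open>P\<close> applied to truncations of \<open>c\<close>,
  converge to \<open>c\<close>. This realises every admissible sequence in the co-orbit space.\<close>

definition partial :: "('i \<Rightarrow> complex) \<Rightarrow> nat \<Rightarrow> 'h"
  where "partial c n = (\<Sum>i\<in>{i. to_nat i < n}. c i *\<^sub>C \<psi> i)"

lemma finite_to_nat_less: "finite {i :: 'i. to_nat i < n}"
  using finite_vimageI[OF finite_lessThan, of to_nat n] by (simp add: vimage_def)

lemma partial_H00: "partial c n \<in> H00 \<psi>"
  unfolding partial_def H00_def mem_Collect_eq
  by (rule exI[of _ "{i. to_nat i < n}"], rule exI[of _ c]) (simp add: finite_to_nat_less)

lemma analysis_partial: "analysis \<phi> (partial c n) = mat_app P (trunc n c)"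
  unfolding partial_def trunc_def using analysis_finite_combination[OF finite_to_nat_less] by simp

lemma trunc_L1: "trunc n c \<in> L1 w"
  unfolding trunc_def using L1_finite_support[OF finite_to_nat_less] by simp

lemma partial_fin_seqs:
  assumes c: "c \<in> D1"
  shows "partial c \<in> fin_seqs 1 \<psi> w" "\<kappa> (partial c) = c"
proof -
  have cL: "c \<in> L1 w" and Pc: "mat_app P c = c" using c by (auto simp: D1_def)
  have "(\<lambda>n. n1 w (\<lambda>i. c i - trunc n c i)) \<longlonglongrightarrow> 0"
  proof -
    have "cmod (c i - trunc n c i) * w i = cmod (c i) * w i - (if to_nat i < n then cmod (c i) * w i else 0)" for i n
      by (simp add: trunc_def)
    then show ?thesis
      using truncation_tendsto[of "\<lambda>i. cmod (c i) * w i"] cL by (simp add: n1_def L1_def)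
  qed
  then have "(\<lambda>n. n1 w (\<lambda>i. trunc n c i - c i)) \<longlonglongrightarrow> 0" by (simp add: n1_diff_commute[of c])
  from P.app_L1_tendsto[OF trunc_L1 cL this]
  have "(\<lambda>n. n1 w (\<lambda>i. analysis \<phi> (partial c n) i - c i)) \<longlonglongrightarrow> 0" by (simp add: analysis_partial Pc)
  from fin_seqs_of_limit[OF partial_H00 cL this]
  show "partial c \<in> fin_seqs 1 \<psi> w" "\<kappa> (partial c) = c" .
qed

lemma coorbit1_eq: "coorbit 1 \<psi> w = seq_quotient (fin_seqs 1 \<psi> w) (fin_rel 1 \<psi> w)
    (\<lambda>F. lim (\<lambda>n. H00_norm 1 \<psi> w (rep_seq F n)))"
  by (simp add: coorbit_def)

lemma coorbit1:
  shows "coef_model (coorbit 1 \<psi> w) (ext_analysis \<phi>) D1"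
    and "F \<in> carr (coorbit 1 \<psi> w) \<Longrightarrow> rep_seq F \<in> fin_seqs 1 \<psi> w"
proof -
  have V_add: "(\<lambda>n. f n + g n) \<in> fin_seqs 1 \<psi> w \<and> \<kappa> (\<lambda>n. f n + g n) = (\<lambda>i. \<kappa> f i + \<kappa> g i)"
    if f: "f \<in> fin_seqs 1 \<psi> w" and g: "g \<in> fin_seqs 1 \<psi> w" for f g
  proof -
    note lf = fin_seqs_limit[OF f] note lg = fin_seqs_limit[OF g]
    have "(\<lambda>n. n1 w (\<lambda>i. analysis \<phi> (f n + g n) i - (\<kappa> f i + \<kappa> g i))) \<longlonglongrightarrow> 0"
    proof (rule Lim_null_comparison)
      have "norm (n1 w (\<lambda>i. analysis \<phi> (f n + g n) i - (\<kappa> f i + \<kappa> g i))) \<le>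
          n1 w (\<lambda>i. analysis \<phi> (f n) i - \<kappa> f i) + n1 w (\<lambda>i. analysis \<phi> (g n) i - \<kappa> g i)" for n
        using n1_add[OF L1_diff[OF lf(1,2)] L1_diff[OF lg(1,2)], of n n] n1_nonneg
        by (simp add: analysis_add algebra_simps)
      then show "\<forall>\<^sub>F n in sequentially. norm (n1 w (\<lambda>i. analysis \<phi> (f n + g n) i - (\<kappa> f i + \<kappa> g i))) \<le>
          n1 w (\<lambda>i. analysis \<phi> (f n) i - \<kappa> f i) + n1 w (\<lambda>i. analysis \<phi> (g n) i - \<kappa> g i)" by simp
      show "(\<lambda>n. n1 w (\<lambda>i. analysis \<phi> (f n) i - \<kappa> f i) + n1 w (\<lambda>i. analysis \<phi> (g n) i - \<kappa> g i)) \<longlonglongrightarrow> 0"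
        using tendsto_add[OF lf(3) lg(3)] by simp
    qed
    moreover have "f n + g n \<in> H00 \<psi>" for n using f g by (auto simp: fin_seqs_iff intro: H00_add)
    ultimately show ?thesis
      using fin_seqs_of_limit[of "\<lambda>n. f n + g n", OF _ L1_add[OF lf(2) lg(2)]] by blast
  qed
  have V_scale: "(\<lambda>n. a *\<^sub>C f n) \<in> fin_seqs 1 \<psi> w \<and> \<kappa> (\<lambda>n. a *\<^sub>C f n) = (\<lambda>i. a * \<kappa> f i)"
    if f: "f \<in> fin_seqs 1 \<psi> w" for f a
  proof -
    note lf = fin_seqs_limit[OF f]
    have "n1 w (\<lambda>i. analysis \<phi> (a *\<^sub>C f n) i - a * \<kappa> f i) = cmod a * n1 w (\<lambda>i. analysis \<phi> (f n) i - \<kappa> f i)" for n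
      unfolding n1_scale[symmetric] by (simp add: analysis_scale algebra_simps)
    then have "(\<lambda>n. n1 w (\<lambda>i. analysis \<phi> (a *\<^sub>C f n) i - a * \<kappa> f i)) \<longlonglongrightarrow> 0"
      using tendsto_mult_right_zero[OF lf(3), of "cmod a"] by simp
    moreover have "a *\<^sub>C f n \<in> H00 \<psi>" for n using f by (auto simp: fin_seqs_iff intro: H00_scale)
    ultimately show ?thesis
      using fin_seqs_of_limit[of "\<lambda>n. a *\<^sub>C f n", OF _ L1_scale[OF lf(2)]] by blast
  qed
  have zero: "(\<lambda>n. 0) \<in> fin_seqs 1 \<psi> w \<and> \<kappa> (\<lambda>n. 0) = (\<lambda>i. 0)"
    using fin_seqs_of_limit[of "\<lambda>n. 0" "\<lambda>i. 0"] H00_zero by (simp add: L1_def n1_def analysis_def)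
  have image: "\<kappa> ` fin_seqs 1 \<psi> w = D1"
  proof
    show "\<kappa> ` fin_seqs 1 \<psi> w \<subseteq> D1" using fin_seqs_limit(2) fin_seqs_fixed by (auto simp: D1_def)
    show "D1 \<subseteq> \<kappa> ` fin_seqs 1 \<psi> w" using partial_fin_seqs by (metis image_eqI subsetI)
  qed
  note m = seq_quotient_coef_model[where \<kappa> = \<kappa>, OF fin_rel_eq _ _ _ _ _ _ image, where \<nu> = "\<lambda>F. lim (\<lambda>n. H00_norm 1 \<psi> w (rep_seq F n))", folded coorbit1_eq]
  show "coef_model (coorbit 1 \<psi> w) (ext_analysis \<phi>) D1"
    unfolding ext_analysis_dual by (rule m(1)) (use zero V_add V_scale in auto)
  show "F \<in> carr (coorbit 1 \<psi> w) \<Longrightarrow> rep_seq F \<in> fin_seqs 1 \<psi> w"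
    by (rule m(2)) (use zero V_add V_scale in auto)
qed

lemma coorbit1_norm:
  assumes F: "F \<in> carr (coorbit 1 \<psi> w)"
  shows "vnorm (coorbit 1 \<psi> w) F = n1 w (ext_analysis \<phi> F)"
proof -
  note l = fin_seqs_limit[OF coorbit1(2)[OF F]]
  have "(\<lambda>n. n1 w (analysis \<phi> (rep_seq F n)) - n1 w (\<kappa> (rep_seq F))) \<longlonglongrightarrow> 0"
    by (rule Lim_null_comparison[OF _ l(3)]) (simp add: n1_diff_le l)
  then have "(\<lambda>n. n1 w (analysis \<phi> (rep_seq F n))) \<longlonglongrightarrow> n1 w (\<kappa> (rep_seq F))"
    by (simp add: LIM_zero_iff)
  then show ?thesis
    by (simp add: coorbit1_eq seq_quotient_def H00_norm_n1 ext_analysis_dual limI)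
qed

lemma coorbit1_frame_coefficients:
  assumes F: "F \<in> carr (coorbit 1 \<psi> w)"
  shows "ext_analysis \<psi> F = mat_app G (ext_analysis \<phi> F)"
  unfolding ext_analysis_dual ext_analysis_def[of \<psi>, abs_def]
  by (rule ext, rule limI[OF fin_seqs_app[OF coorbit1(2)[OF F] G.schur_matrix_axioms, unfolded G_analysis]])

lemma lpw_inf:
  assumes "c \<in> lpw \<infinity> (recip w)"
  shows "cmod (c i) \<le> lpw_norm \<infinity> (recip w) c * w i"
proof -
  have e: "cmod (c i * complex_of_real (recip w i)) = cmod (c i) / w i" for i
    using wpos[of i] by (simp add: recip_def norm_divide)
  have "bdd_above (range (\<lambda>i. cmod (c i) / w i))"
    using assms unfolding lpw_def lp_def mem_Collect_eq e by simp
  from cSUP_upper[OF UNIV_I this, of i]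
  have "cmod (c i) / w i \<le> lpw_norm \<infinity> (recip w) c"
    by (simp only: lpw_norm_def lp_norm_def e if_True refl)
  then show ?thesis using wpos[of i] by (simp add: field_simps)
qed

lemma lpw_infI:
  assumes "\<And>i. cmod (c i) \<le> K * w i"
  shows "c \<in> lpw \<infinity> (recip w)" "lpw_norm \<infinity> (recip w) c \<le> K"
proof -
  have e: "cmod (c i * complex_of_real (recip w i)) = cmod (c i) / w i" for i
    using wpos[of i] by (simp add: recip_def norm_divide)
  have le: "cmod (c i) / w i \<le> K" for i using assms[of i] wpos[of i] by (simp add: field_simps)
  show "c \<in> lpw \<infinity> (recip w)" unfolding lpw_def lp_def mem_Collect_eq e using le by (auto intro!: bdd_aboveI[of _ K])
  show "lpw_norm \<infinity> (recip w) c \<le> K"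
    unfolding lpw_norm_def lp_norm_def e using le by (auto intro: cSUP_least)
qed

lemma inf_seqs_iff: "f \<in> inf_seqs \<psi> (recip w) \<longleftrightarrow>
    (\<forall>i. (\<lambda>n. analysis \<phi> (f n) i) \<longlonglongrightarrow> \<kappa> f i) \<and> (\<exists>K. \<forall>n i. cmod (analysis \<phi> (f n) i) \<le> K * w i)"
proof -
  have 1: "convergent (\<lambda>n. analysis \<phi> (f n) i) \<longleftrightarrow> (\<lambda>n. analysis \<phi> (f n) i) \<longlonglongrightarrow> \<kappa> f i" for i
    by (simp add: \<kappa>_def convergent_LIMSEQ_iff)
  have 2: "(\<forall>n. analysis \<phi> (f n) \<in> lpw \<infinity> (recip w)) \<and>
      bdd_above (range (\<lambda>n. lpw_norm \<infinity> (recip w) (analysis \<phi> (f n)))) \<longleftrightarrow>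
      (\<exists>K. \<forall>n i. cmod (analysis \<phi> (f n) i) \<le> K * w i)"
  proof
    assume a: "(\<forall>n. analysis \<phi> (f n) \<in> lpw \<infinity> (recip w)) \<and>
      bdd_above (range (\<lambda>n. lpw_norm \<infinity> (recip w) (analysis \<phi> (f n))))"
    then obtain K where K: "\<And>n. lpw_norm \<infinity> (recip w) (analysis \<phi> (f n)) \<le> K"
      by (auto simp: bdd_above_def)
    have "cmod (analysis \<phi> (f n) i) \<le> K * w i" for n i
      using lpw_inf[of "analysis \<phi> (f n)" i] a mult_right_mono[OF K[of n], of "w i"] wpos[of i]
      by (meson less_imp_le order_trans)
    then show "\<exists>K. \<forall>n i. cmod (analysis \<phi> (f n) i) \<le> K * w i" by blast
  next
    assume "\<exists>K. \<forall>n i. cmod (analysis \<phi> (f n) i) \<le> K * w i"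
    then obtain K where K: "\<And>n i. cmod (analysis \<phi> (f n) i) \<le> K * w i" by blast
    show "(\<forall>n. analysis \<phi> (f n) \<in> lpw \<infinity> (recip w)) \<and>
      bdd_above (range (\<lambda>n. lpw_norm \<infinity> (recip w) (analysis \<phi> (f n))))"
      using lpw_infI[OF K] by (auto intro!: bdd_aboveI[of _ K])
  qed
  show ?thesis unfolding inf_seqs_def mem_Collect_eq dual 1 2 ..
qed

lemma inf_seqs_limit:
  assumes f: "f \<in> inf_seqs \<psi> (recip w)"
  shows "(\<lambda>n. analysis \<phi> (f n) i) \<longlonglongrightarrow> \<kappa> f i" "\<kappa> f \<in> Linf w"
proof -
  show lim: "(\<lambda>n. analysis \<phi> (f n) i) \<longlonglongrightarrow> \<kappa> f i" for i using f by (simp add: inf_seqs_iff)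
  obtain K where K: "\<And>n i. cmod (analysis \<phi> (f n) i) \<le> K * w i" using f by (auto simp: inf_seqs_iff)
  have "cmod (\<kappa> f i) \<le> K * w i" for i
    by (rule LIMSEQ_le_const2[OF tendsto_norm[OF lim]]) (use K in auto)
  then show "\<kappa> f \<in> Linf w" by (rule LinfI)
qed

lemma inf_seqs_app:
  assumes f: "f \<in> inf_seqs \<psi> (recip w)" and A: "schur_matrix w A B"
  shows "(\<lambda>n. mat_app A (analysis \<phi> (f n)) i) \<longlonglongrightarrow> mat_app A (\<kappa> f) i"
proof -
  interpret A: schur_matrix w A B by fact
  obtain K where K: "\<And>n i. cmod (analysis \<phi> (f n) i) \<le> K * w i" using f by (auto simp: inf_seqs_iff)
  show ?thesis by (rule A.app_Linf_tendsto[OF K inf_seqs_limit(1)[OF f]])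
qed

lemma inf_seqs_fixed: "f \<in> inf_seqs \<psi> (recip w) \<Longrightarrow> mat_app P (\<kappa> f) = \<kappa> f"
  by (rule ext, rule LIMSEQ_unique[OF inf_seqs_app[OF _ P.schur_matrix_axioms, unfolded P_analysis]
      inf_seqs_limit(1)])

lemma inf_seqs_of_limit:
  assumes K: "\<And>n i. cmod (analysis \<phi> (f n) i) \<le> K * w i" and lim: "\<And>i. (\<lambda>n. analysis \<phi> (f n) i) \<longlonglongrightarrow> c i"
  shows "f \<in> inf_seqs \<psi> (recip w)" "\<kappa> f = c"
proof -
  show k: "\<kappa> f = c" using lim by (auto simp: \<kappa>_def fun_eq_iff intro: limI)
  show "f \<in> inf_seqs \<psi> (recip w)" using K lim by (auto simp: inf_seqs_iff k)
qed

lemma inf_rel_eq: "inf_rel \<psi> (recip w) =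
    {(f, g). f \<in> inf_seqs \<psi> (recip w) \<and> g \<in> inf_seqs \<psi> (recip w) \<and> \<kappa> f = \<kappa> g}"
proof -
  have "(\<forall>i. (\<lambda>n. analysis \<phi> (f n - g n) i) \<longlonglongrightarrow> 0) \<longleftrightarrow> \<kappa> f = \<kappa> g"
    if f: "f \<in> inf_seqs \<psi> (recip w)" and g: "g \<in> inf_seqs \<psi> (recip w)" for f g
  proof -
    have l: "(\<lambda>n. analysis \<phi> (f n - g n) i) \<longlonglongrightarrow> \<kappa> f i - \<kappa> g i" for i
      unfolding analysis_diff by (intro tendsto_diff inf_seqs_limit f g)
    then have "(\<lambda>n. analysis \<phi> (f n - g n) i) \<longlonglongrightarrow> 0 \<longleftrightarrow> \<kappa> f i - \<kappa> g i = 0" for i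
      using LIMSEQ_unique by metis
    then show ?thesis by (simp add: fun_eq_iff)
  qed
  then show ?thesis unfolding inf_rel_def dual by auto
qed

lemma partial_inf_seqs:
  assumes c: "c \<in> Dinf"
  shows "partial c \<in> inf_seqs \<psi> (recip w)" "\<kappa> (partial c) = c"
proof -
  obtain K where K: "\<And>i. cmod (c i) \<le> K * w i" and Pc: "mat_app P c = c"
    using c by (auto simp: Dinf_def Linf_def)
  have tK: "cmod (trunc n c i) \<le> K * w i" for n i
    using K[of i] order_trans[OF norm_ge_zero K[of i]] by (simp add: trunc_def)
  have tl: "(\<lambda>n. trunc n c i) \<longlonglongrightarrow> c i" for i
    by (rule tendsto_eventually, rule eventually_mono[OF eventually_gt_at_top[of "to_nat i"]])
      (simp add: trunc_def)
  have "cmod (analysis \<phi> (partial c n) i) \<le> K * C * w i" for n i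
    unfolding analysis_partial by (rule P.app_Linf(3)[OF tK])
  moreover have "(\<lambda>n. analysis \<phi> (partial c n) i) \<longlonglongrightarrow> c i" for i
    using P.app_Linf_tendsto[OF tK tl, of i] by (simp add: analysis_partial Pc)
  ultimately show "partial c \<in> inf_seqs \<psi> (recip w)" "\<kappa> (partial c) = c"
    by (rule inf_seqs_of_limit)+
qed

lemma coorbit_inf_eq: "coorbit \<infinity> \<psi> (recip w) = seq_quotient (inf_seqs \<psi> (recip w)) (inf_rel \<psi> (recip w))
    (\<lambda>F. lpw_norm \<infinity> (recip w) (ext_analysis \<phi> F))"
  by (simp add: coorbit_def dual)

lemma coorbit_inf:
  shows "coef_model (coorbit \<infinity> \<psi> (recip w)) (ext_analysis \<phi>) Dinf"
    and "F \<in> carr (coorbit \<infinity> \<psi> (recip w)) \<Longrightarrow> rep_seq F \<in> inf_seqs \<psi> (recip w)"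
proof -
  have V_add: "(\<lambda>n. f n + g n) \<in> inf_seqs \<psi> (recip w) \<and> \<kappa> (\<lambda>n. f n + g n) = (\<lambda>i. \<kappa> f i + \<kappa> g i)"
    if f: "f \<in> inf_seqs \<psi> (recip w)" and g: "g \<in> inf_seqs \<psi> (recip w)" for f g
  proof -
    obtain K where K: "\<And>n i. cmod (analysis \<phi> (f n) i) \<le> K * w i" using f by (auto simp: inf_seqs_iff)
    obtain L where L: "\<And>n i. cmod (analysis \<phi> (g n) i) \<le> L * w i" using g by (auto simp: inf_seqs_iff)
    have "cmod (analysis \<phi> (f n + g n) i) \<le> (K + L) * w i" for n i
      using norm_triangle_ineq[of "analysis \<phi> (f n) i" "analysis \<phi> (g n) i"] K[of n i] L[of n i]
      by (simp add: analysis_add distrib_right)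
    moreover have "(\<lambda>n. analysis \<phi> (f n + g n) i) \<longlonglongrightarrow> \<kappa> f i + \<kappa> g i" for i
      unfolding analysis_add by (intro tendsto_add inf_seqs_limit f g)
    ultimately show ?thesis
      using inf_seqs_of_limit[of "\<lambda>n. f n + g n" "K + L" "\<lambda>i. \<kappa> f i + \<kappa> g i"] by simp
  qed
  have V_scale: "(\<lambda>n. a *\<^sub>C f n) \<in> inf_seqs \<psi> (recip w) \<and> \<kappa> (\<lambda>n. a *\<^sub>C f n) = (\<lambda>i. a * \<kappa> f i)"
    if f: "f \<in> inf_seqs \<psi> (recip w)" for f a
  proof -
    obtain K where K: "\<And>n i. cmod (analysis \<phi> (f n) i) \<le> K * w i" using f by (auto simp: inf_seqs_iff)
    have "cmod (analysis \<phi> (a *\<^sub>C f n) i) \<le> (cmod a * K) * w i" for n i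
      using mult_left_mono[OF K[of n i], of "cmod a"] by (simp add: analysis_scale norm_mult mult.assoc)
    moreover have "(\<lambda>n. analysis \<phi> (a *\<^sub>C f n) i) \<longlonglongrightarrow> a * \<kappa> f i" for i
      unfolding analysis_scale by (intro tendsto_mult_left inf_seqs_limit f)
    ultimately show ?thesis
      using inf_seqs_of_limit[of "\<lambda>n. a *\<^sub>C f n" "cmod a * K" "\<lambda>i. a * \<kappa> f i"] by simp
  qed
  have zero: "(\<lambda>n. 0) \<in> inf_seqs \<psi> (recip w) \<and> \<kappa> (\<lambda>n. 0) = (\<lambda>i. 0)"
    using inf_seqs_of_limit[of "\<lambda>n. 0" 0 "\<lambda>i. 0"] by (simp add: analysis_def)
  have image: "\<kappa> ` inf_seqs \<psi> (recip w) = Dinf"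
  proof
    show "\<kappa> ` inf_seqs \<psi> (recip w) \<subseteq> Dinf" using inf_seqs_limit(2) inf_seqs_fixed by (auto simp: Dinf_def)
    show "Dinf \<subseteq> \<kappa> ` inf_seqs \<psi> (recip w)" using partial_inf_seqs by (metis image_eqI subsetI)
  qed
  note m = seq_quotient_coef_model[where \<kappa> = \<kappa>, OF inf_rel_eq _ _ _ _ _ _ image, where \<nu> = "\<lambda>F. lpw_norm \<infinity> (recip w) (ext_analysis \<phi> F)", folded coorbit_inf_eq]
  show "coef_model (coorbit \<infinity> \<psi> (recip w)) (ext_analysis \<phi>) Dinf"
    unfolding ext_analysis_dual by (rule m(1)) (use zero V_add V_scale in auto)
  show "F \<in> carr (coorbit \<infinity> \<psi> (recip w)) \<Longrightarrow> rep_seq F \<in> inf_seqs \<psi> (recip w)"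
    by (rule m(2)) (use zero V_add V_scale in auto)
qed

lemma coorbit_inf_norm:
  assumes F: "F \<in> carr (coorbit \<infinity> \<psi> (recip w))"
  shows "cmod (ext_analysis \<phi> F i) \<le> vnorm (coorbit \<infinity> \<psi> (recip w)) F * w i"
    "0 \<le> vnorm (coorbit \<infinity> \<psi> (recip w)) F"
proof -
  have "ext_analysis \<phi> F \<in> Linf w"
    using coef_model.cf_mem[OF coorbit_inf(1) F] by (simp add: Dinf_def)
  then obtain K where "\<And>i. cmod (ext_analysis \<phi> F i) \<le> K * w i" by (auto simp: Linf_def)
  from lpw_inf[OF lpw_infI(1)[OF this]]
  show *: "cmod (ext_analysis \<phi> F i) \<le> vnorm (coorbit \<infinity> \<psi> (recip w)) F * w i" for i
    by (simp add: coorbit_inf_eq seq_quotient_def)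
  show "0 \<le> vnorm (coorbit \<infinity> \<psi> (recip w)) F"
    using order_trans[OF norm_ge_zero *[of undefined]] wpos[of undefined] by (simp add: zero_le_mult_iff)
qed

lemma coorbit_inf_frame_coefficients:
  assumes F: "F \<in> carr (coorbit \<infinity> \<psi> (recip w))"
  shows "ext_analysis \<psi> F = mat_app G (ext_analysis \<phi> F)"
  unfolding ext_analysis_dual ext_analysis_def[of \<psi>, abs_def]
  by (rule ext, rule limI[OF inf_seqs_app[OF coorbit_inf(2)[OF F] G.schur_matrix_axioms, unfolded G_analysis]])

text \<open>Dual frame elements serve as test vectors in \<open>\<H>\<^sup>\<infinity>\<close>.\<close>

lemma analysis_dual_frame_mem: "analysis \<phi> (\<phi> k) \<in> Dinf"
proof -
  have "herm (gram \<phi>)" unfolding herm_def gram_def by (metis cinner_commute)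
  then interpret D: schur_matrix w "gram \<phi>" C using schur_D by unfold_locales
  have "analysis \<phi> (\<phi> k) i = gram \<phi> i k" for i by (simp add: analysis_def gram_def)
  then have "cmod (analysis \<phi> (\<phi> k) i) \<le> C / w k * w i" for i using D.column_Linf[of i k] by simp
  then show ?thesis unfolding Dinf_def mem_Collect_eq by (intro conjI P_analysis LinfI)
qed

lemma analysis_frame_mem: "analysis \<phi> (\<psi> k) \<in> D1" "n1 w (analysis \<phi> (\<psi> k)) \<le> C * w k"
proof -
  have e: "analysis \<phi> (\<psi> k) = (\<lambda>i. P i k)" by (simp add: analysis_def P_def fun_eq_iff)
  show "analysis \<phi> (\<psi> k) \<in> D1" using P.column_L1[of k] P_analysis[of "\<psi> k"] by (simp add: D1_def e)
  show "n1 w (analysis \<phi> (\<psi> k)) \<le> C * w k" unfolding e by (rule P.column_n1)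
qed

text \<open>\<open>G\<close> maps the coefficients of \<open>\<phi> k\<close> to column \<open>k\<close> of the Hermitian matrix \<open>P\<close>, and \<open>P c = c\<close>.\<close>

lemma dual_pairing_coefficient:
  assumes c: "c \<in> D1"
  shows "(\<Sum>\<^sub>\<infinity>i. c i * cnj (mat_app G (analysis \<phi> (\<phi> k)) i)) = c k"
proof -
  have "c i * cnj (mat_app G (analysis \<phi> (\<phi> k)) i) = P k i * c i" for i
    unfolding G_analysis by (simp add: analysis_def P_def cinner_commute[symmetric])
  then have "(\<Sum>\<^sub>\<infinity>i. c i * cnj (mat_app G (analysis \<phi> (\<phi> k)) i)) = mat_app P c k"
    by (simp only: mat_app_def[of P])
  then show ?thesis using c by (simp add: D1_def)
qed

end

section \<open>Operators with kernels\<close>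

text \<open>The columns of \<open>P\<close> are coefficient sequences of frame elements and as such are fixed by \<open>P\<close>; since
  \<open>P\<close> is self-adjoint, this gives \<open>P P = P\<close> on \<open>L1 w\<close>.\<close>

lemma (in localised_pair) P_idempotent:
  assumes c: "c \<in> L1 w"
  shows "mat_app P (mat_app P c) = mat_app P c"
proof
  fix i
  define d where "d k = P k i" for k
  have dK: "cmod (d k) \<le> C / w i * w k" for k using P.column_Linf[of k i] by (simp add: d_def)
  have Pd: "mat_app P d = d" using P_analysis[of "\<psi> i"] by (simp add: d_def[abs_def] analysis_def P_def[abs_def])
  have "mat_app P (mat_app P c) i = (\<Sum>\<^sub>\<infinity>k. mat_app P c k * cnj (d k))"
    by (simp add: mat_app_def[of P "mat_app P c"] d_def P.cnj_A mult.commute)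
  also have "\<dots> = (\<Sum>\<^sub>\<infinity>k. c k * cnj (mat_app P d k))" by (rule P.app_dual[OF c dK, symmetric])
  also have "\<dots> = mat_app P c i" by (simp add: Pd) (simp add: mat_app_def d_def P.cnj_A mult.commute)
  finally show "mat_app P (mat_app P c) i = mat_app P c i" .
qed

locale kernel_pair =
  p1: localised_pair \<psi>1 \<phi>1 w1 C1 + p2: localised_pair \<psi>2 \<phi>2 w2 C2 +
  p: localised_pair "tensor_frame \<psi>1 \<psi>2" "tensor_frame \<phi>1 \<phi>2" "tensor_weight w1 w2" C
  for \<psi>1 \<phi>1 :: "'i::countable \<Rightarrow> 'a::chilbert_space" and w1 C1
    and \<psi>2 \<phi>2 :: "'j::countable \<Rightarrow> 'b::chilbert_space" and w2 C2 C
begin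

abbreviation "X1 \<equiv> coorbit 1 \<psi>1 w1"
abbreviation "X2 \<equiv> coorbit 1 \<psi>2 w2"
abbreviation "Y1 \<equiv> coorbit \<infinity> \<psi>1 (recip w1)"
abbreviation "Y2 \<equiv> coorbit \<infinity> \<psi>2 (recip w2)"
abbreviation "XT \<equiv> coorbit 1 (tensor_frame \<psi>1 \<psi>2) (tensor_weight w1 w2)"
abbreviation "YT \<equiv> coorbit \<infinity> (tensor_frame \<psi>1 \<psi>2) (recip (tensor_weight w1 w2))"
abbreviation "cf1 \<equiv> ext_analysis \<phi>1"
abbreviation "cf2 \<equiv> ext_analysis \<phi>2"
abbreviation "cfT \<equiv> ext_analysis (tensor_frame \<phi>1 \<phi>2)"

sublocale X1: coef_model X1 cf1 p1.D1 by (rule p1.coorbit1(1))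
sublocale X2: coef_model X2 cf2 p2.D1 by (rule p2.coorbit1(1))
sublocale Y1: coef_model Y1 cf1 p1.Dinf by (rule p1.coorbit_inf(1))
sublocale Y2: coef_model Y2 cf2 p2.Dinf by (rule p2.coorbit_inf(1))
sublocale XT: coef_model XT cfT p.D1 by (rule p.coorbit1(1))
sublocale YT: coef_model YT cfT p.Dinf by (rule p.coorbit_inf(1))

abbreviation "w \<equiv> tensor_weight w1 w2"

lemma w_pair: "w (i, j) = w1 i * w2 j" by (simp add: tensor_weight_def)

lemma P_tensor: "p.P (i, j) (i', j') = cnj (p1.P i i') * p2.P j j'"
  unfolding p.P_def by (simp add: p1.P_def p2.P_def tensor_frame_def cinner_tensor)

lemma G_tensor: "p.G (i, j) (i', j') = cnj (p1.G i i') * p2.G j j'"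
  unfolding p.G_def by (simp add: p1.G_def p2.G_def gram_def tensor_frame_def cinner_tensor)

lemma kernel_bounds:
  assumes k: "k \<in> L1 w" and a: "\<And>i. cmod (a i) \<le> A * w1 i" and b: "\<And>j. cmod (b j) \<le> B * w2 j"
  shows "(\<lambda>(i, j). cmod (k (i, j) * a i * b j)) summable_on UNIV"
    "(\<Sum>\<^sub>\<infinity>(i, j). cmod (k (i, j) * a i * b j)) \<le> A * B * n1 w k"
proof -
  have le: "cmod (k p * a (fst p) * b (snd p)) \<le> A * B * (cmod (k p) * w p)" for p
  proof -
    obtain i j where p: "p = (i, j)" by (cases p)
    have "cmod (a i) * cmod (b j) \<le> (A * w1 i) * (B * w2 j)"
      by (intro mult_mono a b order_trans[OF norm_ge_zero a] norm_ge_zero)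
    from mult_left_mono[OF this, of "cmod (k p)"] show ?thesis
      by (simp add: p w_pair norm_mult mult_ac)
  qed
  have s: "(\<lambda>p. A * B * (cmod (k p) * w p)) summable_on UNIV"
    using k by (intro summable_on_cmult_right) (simp add: L1_def)
  have 1: "(\<lambda>p. cmod (k p * a (fst p) * b (snd p))) summable_on UNIV"
    by (rule summable_on_comparison_test[OF s le]) simp
  then show "(\<lambda>(i, j). cmod (k (i, j) * a i * b j)) summable_on UNIV" by (simp add: case_prod_unfold)
  have "(\<Sum>\<^sub>\<infinity>p. cmod (k p * a (fst p) * b (snd p))) \<le> (\<Sum>\<^sub>\<infinity>p. A * B * (cmod (k p) * w p))"
    by (rule infsum_mono[OF 1 s le])
  then show "(\<Sum>\<^sub>\<infinity>(i, j). cmod (k (i, j) * a i * b j)) \<le> A * B * n1 w k"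
    by (simp add: case_prod_unfold infsum_cmult_right' n1_def)
qed

text \<open>An array applied to a sequence in its first index.\<close>

definition act :: "('i \<times> 'j \<Rightarrow> complex) \<Rightarrow> ('i \<Rightarrow> complex) \<Rightarrow> 'j \<Rightarrow> complex"
  where "act k a j = (\<Sum>\<^sub>\<infinity>i. k (i, j) * a i)"

lemma act_L1:
  assumes k: "k \<in> L1 w" and a: "\<And>i. cmod (a i) \<le> A * w1 i"
  shows "(\<lambda>i. k (i, j) * a i) summable_on UNIV" "act k a \<in> L1 w2" "n1 w2 (act k a) \<le> A * n1 w k"
proof -
  define g where "g j i = k (i, j) * a i * complex_of_real (w2 j)" for j i
  note kb = kernel_bounds[OF k a, of "\<lambda>j. complex_of_real (w2 j)" 1]
  have s: "(\<lambda>(i, j). cmod (g j i)) summable_on UNIV" and le: "(\<Sum>\<^sub>\<infinity>(i, j). cmod (g j i)) \<le> A * n1 w k"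
    using kb p2.w_pos by (auto simp: g_def less_imp_le)
  have s': "(\<lambda>(j, i). cmod (g j i)) summable_on UNIV"
    using s summable_on_swap[of "\<lambda>(i, j). cmod (g j i)" UNIV UNIV] by (simp add: case_prod_unfold)
  have sw: "(\<Sum>\<^sub>\<infinity>(j, i). cmod (g j i)) = (\<Sum>\<^sub>\<infinity>(i, j). cmod (g j i))"
    using double_sumD(8)[OF s'] double_sumD(8)[OF s] infsum_swap_banach[of "\<lambda>i j. cmod (g j i)" UNIV UNIV] s
    by simp
  have "(\<lambda>i. g j i * (1 / complex_of_real (w2 j))) summable_on UNIV"
    by (intro summable_on_cmult_left double_sumD(1)[OF s'])
  moreover have "g j i * (1 / complex_of_real (w2 j)) = k (i, j) * a i" for i
    using p2.w_pos[of j] by (simp add: g_def)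
  ultimately show "(\<lambda>i. k (i, j) * a i) summable_on UNIV" by simp
  have e: "cmod (act k a j) * w2 j = cmod (\<Sum>\<^sub>\<infinity>i. g j i)" for j
    using p2.w_pos[of j] by (simp add: act_def g_def infsum_cmult_left' norm_mult)
  show "act k a \<in> L1 w2" using double_sumD(4)[OF s'] by (simp add: L1_def e)
  show "n1 w2 (act k a) \<le> A * n1 w k" using double_sumD(5)[OF s'] le by (simp add: n1_def e sw)
qed

text \<open>Absolute summability allows the double sum to be evaluated in either order.\<close>

lemma act_pair:
  assumes k: "k \<in> L1 w" and a: "\<And>i. cmod (a i) \<le> A * w1 i" and b: "\<And>j. cmod (b j) \<le> B * w2 j"
  shows "(\<Sum>\<^sub>\<infinity>j. act k a j * b j) = (\<Sum>\<^sub>\<infinity>(i, j). k (i, j) * a i * b j)"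
    "(\<Sum>\<^sub>\<infinity>j. act k a j * b j) = (\<Sum>\<^sub>\<infinity>i. (\<Sum>\<^sub>\<infinity>j. k (i, j) * b j) * a i)"
proof -
  note s = kernel_bounds(1)[OF k a b]
  have "(\<Sum>\<^sub>\<infinity>j. act k a j * b j) = (\<Sum>\<^sub>\<infinity>j. \<Sum>\<^sub>\<infinity>i. k (i, j) * a i * b j)"
    by (simp add: act_def infsum_cmult_left')
  also have "\<dots> = (\<Sum>\<^sub>\<infinity>i. \<Sum>\<^sub>\<infinity>j. k (i, j) * a i * b j)" by (rule double_sumD(2)[OF s, symmetric])
  finally have e: "(\<Sum>\<^sub>\<infinity>j. act k a j * b j) = (\<Sum>\<^sub>\<infinity>i. \<Sum>\<^sub>\<infinity>j. k (i, j) * a i * b j)" .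
  then show "(\<Sum>\<^sub>\<infinity>j. act k a j * b j) = (\<Sum>\<^sub>\<infinity>(i, j). k (i, j) * a i * b j)"
    using double_sumD(3)[OF s] by simp
  have sw: "k (i, j) * a i * b j = k (i, j) * b j * a i" for i j by simp
  show "(\<Sum>\<^sub>\<infinity>j. act k a j * b j) = (\<Sum>\<^sub>\<infinity>i. (\<Sum>\<^sub>\<infinity>j. k (i, j) * b j) * a i)"
    unfolding e sw infsum_cmult_left' ..
qed

lemma row_L1: "k \<in> L1 w \<Longrightarrow> (\<lambda>j. k (i, j)) \<in> L1 w2"
  and row_sum: "k \<in> L1 w \<Longrightarrow> (\<lambda>i. w1 i * n1 w2 (\<lambda>j. k (i, j))) summable_on UNIV"
  and row_sum_eq: "k \<in> L1 w \<Longrightarrow> (\<Sum>\<^sub>\<infinity>i. w1 i * n1 w2 (\<lambda>j. k (i, j))) = n1 w k"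
proof -
  assume k: "k \<in> L1 w"
  define g where "g i j = k (i, j) * complex_of_real (w1 i) * complex_of_real (w2 j)" for i j
  have cg: "cmod (g i j) = w1 i * (cmod (k (i, j)) * w2 j)" for i j
    using p1.w_pos[of i] p2.w_pos[of j] by (simp add: g_def norm_mult)
  have s: "(\<lambda>(i, j). cmod (g i j)) summable_on UNIV"
    using k by (simp add: L1_def cg case_prod_unfold tensor_weight_def mult_ac)
  have "(\<lambda>j. cmod (k (i, j)) * w2 j) summable_on UNIV" for i
    using summable_on_cmult_right[OF double_sumD(6)[OF s, of i], of "1 / w1 i"] p1.w_pos[of i]
    by (simp add: cg)
  then show "(\<lambda>j. k (i, j)) \<in> L1 w2" for i by (simp add: L1_def)
  have e: "(\<Sum>\<^sub>\<infinity>j. cmod (g i j)) = w1 i * n1 w2 (\<lambda>j. k (i, j))" for i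
    by (simp add: cg n1_def infsum_cmult_right')
  show "(\<lambda>i. w1 i * n1 w2 (\<lambda>j. k (i, j))) summable_on UNIV" using double_sumD(7)[OF s] by (simp add: e)
  show "(\<Sum>\<^sub>\<infinity>i. w1 i * n1 w2 (\<lambda>j. k (i, j))) = n1 w k"
    using double_sumD(8)[OF s] by (simp add: e) (simp add: cg n1_def case_prod_unfold tensor_weight_def mult_ac)
qed

lemma P1_row_bound: "cmod (cnj (p1.P i i')) \<le> C1 / w1 i * w1 i'"
  using p1.P.column_Linf[of i' i] p1.P.A_sym[of i i'] by simp

lemma P2_row_bound: "cmod (p2.P j j') \<le> C2 / w2 j * w2 j'"
  using p2.P.column_Linf[of j' j] p2.P.A_sym[of j j'] by simp

text \<open>Writing out \<open>k = (cnj P1 \<otimes> P2) k\<close> shows that each row of \<open>k\<close> lies in the image of \<open>P2\<close>, hence is fixed by it.\<close>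

lemma row_fixed:
  assumes k: "k \<in> p.D1"
  shows "(\<lambda>j. k (i, j)) \<in> p2.D1"
proof -
  have kL: "k \<in> L1 w" and Pk: "mat_app p.P k = k" using k by (auto simp: p.D1_def)
  define v where "v = act k (\<lambda>i'. cnj (p1.P i i'))"
  have vL: "v \<in> L1 w2" unfolding v_def by (rule act_L1(2)[OF kL P1_row_bound])
  have "k (i, l) = mat_app p2.P v l" for l
  proof -
    have "k (i, l) = mat_app p.P k (i, l)" by (simp add: Pk)
    also have "\<dots> = (\<Sum>\<^sub>\<infinity>(i', j'). k (i', j') * cnj (p1.P i i') * p2.P l j')"
      unfolding mat_app_def by (intro infsum_cong) (auto simp: P_tensor)
    also have "\<dots> = (\<Sum>\<^sub>\<infinity>j'. v j' * p2.P l j')"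
      unfolding v_def by (rule act_pair(1)[OF kL P1_row_bound P2_row_bound, symmetric])
    finally show ?thesis by (simp add: mat_app_def mult.commute)
  qed
  then have "(\<lambda>j. k (i, j)) = mat_app p2.P v" by (rule ext)
  then show ?thesis
    using row_L1[OF kL, of i] p2.P_idempotent[OF vL] by (simp add: p2.D1_def)
qed

lemma act_D1:
  assumes k: "k \<in> p.D1" and a: "\<And>i. cmod (a i) \<le> A * w1 i"
  shows "act k a \<in> p2.D1"
proof -
  have kL: "k \<in> L1 w" using k by (simp add: p.D1_def)
  have "mat_app p2.P (act k a) j = act k a j" for j
  proof -
    have row: "(\<Sum>\<^sub>\<infinity>l. k (i, l) * p2.P j l) = k (i, j)" for i
      using row_fixed[OF k, of i] by (auto simp: p2.D1_def mat_app_def fun_eq_iff mult.commute)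
    have "mat_app p2.P (act k a) j = (\<Sum>\<^sub>\<infinity>l. act k a l * p2.P j l)"
      by (simp add: mat_app_def mult.commute)
    also have "\<dots> = (\<Sum>\<^sub>\<infinity>i. (\<Sum>\<^sub>\<infinity>l. k (i, l) * p2.P j l) * a i)"
      by (rule act_pair(2)[OF kL a P2_row_bound])
    finally show ?thesis by (simp add: row act_def)
  qed
  then show ?thesis using act_L1(2)[OF kL a] by (simp add: p2.D1_def fun_eq_iff)
qed

lemma Y1_bound: "h \<in> carr Y1 \<Longrightarrow> cmod (mat_app p1.G (cf1 h) i) \<le> vnorm Y1 h * C1 * w1 i"
  by (rule p1.G.app_Linf(3)[OF p1.coorbit_inf_norm(1)])

lemma Y2_bound: "h \<in> carr Y2 \<Longrightarrow> cmod (mat_app p2.G (cf2 h) i) \<le> vnorm Y2 h * C2 * w2 i"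
  by (rule p2.G.app_Linf(3)[OF p2.coorbit_inf_norm(1)])

definition kop :: "('i \<times> 'j \<Rightarrow> complex) \<Rightarrow> (nat \<Rightarrow> 'a) set \<Rightarrow> 'j \<Rightarrow> complex"
  where "kop k h = act k (mat_app p1.G (cf1 h))"

text \<open>The operator with kernel \<open>K\<close>, as an extensional function on its domain.\<close>

definition \<Phi> :: "(nat \<Rightarrow> ('a, 'b) htensor) set \<Rightarrow> (nat \<Rightarrow> 'a) set \<Rightarrow> (nat \<Rightarrow> 'b) set"
  where "\<Phi> K = (\<lambda>h\<in>carr Y1. X2.el (kop (cfT K) h))"

lemma kop_D1: "k \<in> p.D1 \<Longrightarrow> h \<in> carr Y1 \<Longrightarrow> kop k h \<in> p2.D1"
  unfolding kop_def by (rule act_D1[OF _ Y1_bound])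

lemma kop_norm: "k \<in> L1 w \<Longrightarrow> h \<in> carr Y1 \<Longrightarrow> n1 w2 (kop k h) \<le> vnorm Y1 h * C1 * n1 w k"
  unfolding kop_def by (rule act_L1(3)[OF _ Y1_bound])

lemma \<Phi>_carr: "K \<in> carr XT \<Longrightarrow> h \<in> carr Y1 \<Longrightarrow> \<Phi> K h \<in> carr X2"
  and cf_\<Phi>: "K \<in> carr XT \<Longrightarrow> h \<in> carr Y1 \<Longrightarrow> cf2 (\<Phi> K h) = kop (cfT K) h"
  by (simp_all add: \<Phi>_def X2.el_carr X2.cf_el kop_D1 XT.cf_mem)

lemma G1_add:
  assumes "h \<in> carr Y1" "h' \<in> carr Y1"
  shows "mat_app p1.G (cf1 (vadd Y1 h h')) i = mat_app p1.G (cf1 h) i + mat_app p1.G (cf1 h') i"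
  unfolding Y1.cf_add[OF assms] mat_app_def distrib_left
  by (intro infsum_add p1.G.app_Linf(2)[OF p1.coorbit_inf_norm(1)] assms)

lemma G1_scale: "h \<in> carr Y1 \<Longrightarrow> mat_app p1.G (cf1 (vscale Y1 a h)) i = a * mat_app p1.G (cf1 h) i"
  by (simp add: Y1.cf_scale mat_app_def mult.left_commute infsum_cmult_right')

lemma kop_add_arg:
  assumes k: "k \<in> L1 w" and h: "h \<in> carr Y1" "h' \<in> carr Y1"
  shows "kop k (vadd Y1 h h') = (\<lambda>j. kop k h j + kop k h' j)"
  unfolding kop_def act_def G1_add[OF h] distrib_left
  by (intro ext infsum_add act_L1(1)[OF k Y1_bound] h)

lemma kop_scale_arg: "h \<in> carr Y1 \<Longrightarrow> kop k (vscale Y1 a h) = (\<lambda>j. a * kop k h j)"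
  by (simp add: kop_def act_def G1_scale mult.left_commute infsum_cmult_right' fun_eq_iff)

lemma kop_add:
  assumes "k \<in> L1 w" "k' \<in> L1 w" and h: "h \<in> carr Y1"
  shows "kop (\<lambda>p. k p + k' p) h = (\<lambda>j. kop k h j + kop k' h j)"
  unfolding kop_def act_def distrib_right
  by (intro ext infsum_add act_L1(1)[OF _ Y1_bound] assms)

lemma kop_scale: "kop (\<lambda>p. a * k p) h = (\<lambda>j. a * kop k h j)"
  by (simp add: kop_def act_def mult.assoc infsum_cmult_right' fun_eq_iff)

abbreviation "BO \<equiv> bounded_ops Y1 X2"

lemma carr_BO: "T \<in> carr BO \<longleftrightarrow> T \<in> extensional (carr Y1) \<and> lin_map Y1 X2 T \<and>
    (\<exists>M. \<forall>h\<in>carr Y1. vnorm X2 (T h) \<le> M * vnorm Y1 h)"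
  by (simp add: bounded_ops_def)

lemma BO_value: "T \<in> carr BO \<Longrightarrow> h \<in> carr Y1 \<Longrightarrow> T h \<in> carr X2"
  by (auto simp: carr_BO lin_map_def)

lemma \<Phi>_bounded:
  assumes K: "K \<in> carr XT"
  shows "\<Phi> K \<in> carr BO"
proof -
  have kL: "cfT K \<in> L1 w" using XT.cf_mem[OF K] by (simp add: p.D1_def)
  have "lin_map Y1 X2 (\<Phi> K)"
    unfolding lin_map_def
  proof (intro conjI ballI allI)
    show "\<Phi> K \<in> carr Y1 \<rightarrow> carr X2" using \<Phi>_carr[OF K] by blast
    show "\<Phi> K (vadd Y1 x y) = vadd X2 (\<Phi> K x) (\<Phi> K y)" if "x \<in> carr Y1" "y \<in> carr Y1" for x y
      by (rule X2.cf_inject)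
        (simp_all add: \<Phi>_carr K that Y1.add_carr X2.add_carr X2.cf_add cf_\<Phi> kop_add_arg[OF kL])
    show "\<Phi> K (vscale Y1 c x) = vscale X2 c (\<Phi> K x)" if "x \<in> carr Y1" for x c
      by (rule X2.cf_inject)
        (simp_all add: \<Phi>_carr K that Y1.scale_carr X2.scale_carr X2.cf_scale cf_\<Phi> kop_scale_arg)
  qed
  moreover have "vnorm X2 (\<Phi> K h) \<le> (C1 * n1 w (cfT K)) * vnorm Y1 h" if h: "h \<in> carr Y1" for h
    using kop_norm[OF kL h] by (simp add: p2.coorbit1_norm \<Phi>_carr K h cf_\<Phi> mult_ac)
  ultimately show ?thesis unfolding carr_BO by (auto simp: \<Phi>_def)
qed

section \<open>The defining identity\<close>

lemma pairing1: "h \<in> carr Y1 \<Longrightarrow> f \<in> carr X1 \<Longrightarrow>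
    pairing \<psi>1 h f = (\<Sum>\<^sub>\<infinity>i. cf1 h i * cnj (mat_app p1.G (cf1 f) i))"
  by (simp add: pairing_def p1.dual p1.coorbit1_frame_coefficients)

lemma pairing2: "g \<in> carr X2 \<Longrightarrow> h \<in> carr Y2 \<Longrightarrow>
    pairing \<psi>2 g h = (\<Sum>\<^sub>\<infinity>j. cf2 g j * cnj (mat_app p2.G (cf2 h) j))"
  by (simp add: pairing_def p2.dual p2.coorbit_inf_frame_coefficients)

text \<open>The conjugation comes from the antilinearity of the tensor product in its first factor.\<close>

lemma tensor_app:
  assumes t: "\<And>i j. t (i, j) = cnj (a i) * b j"
    and A: "\<And>i j i' j'. A (i, j) (i', j') = cnj (A1 i i') * A2 j j'"
    and 1: "\<And>i. (\<lambda>i'. A1 i i' * a i') summable_on UNIV" and 2: "\<And>j. (\<lambda>j'. A2 j j' * b j') summable_on UNIV"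
  shows "mat_app A t (i, j) = cnj (mat_app A1 a i) * mat_app A2 b j"
proof -
  have "((\<lambda>i'. cnj (A1 i i' * a i')) has_sum cnj (mat_app A1 a i)) UNIV"
    unfolding has_sum_cnj_iff mat_app_def using 1 by simp
  moreover have "((\<lambda>j'. A2 j j' * b j') has_sum mat_app A2 b j) UNIV"
    unfolding mat_app_def using 2 by simp
  ultimately have "((\<lambda>q. cnj (A1 i (fst q) * a (fst q)) * (A2 j (snd q) * b (snd q))) has_sum
      cnj (mat_app A1 a i) * mat_app A2 b j) UNIV"
    by (rule has_sum_product)
  moreover have "A (i, j) q * t q = cnj (A1 i (fst q) * a (fst q)) * (A2 j (snd q) * b (snd q))" for q
    by (cases q) (simp add: A t mult_ac)
  ultimately show ?thesis by (simp add: mat_app_def[of A] infsumI)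
qed

lemma coorbit_tensor_coefficients:
  assumes f1: "f1 \<in> carr Y1" and f2: "f2 \<in> carr Y2"
  defines "F \<equiv> coorbit_tensor \<psi>1 \<psi>2 (recip w) f1 f2"
  shows "F \<in> carr YT" "cfT F (i, j) = cnj (cf1 f1 i) * cf2 f2 j"
proof -
  define t where "t q = cnj (cf1 f1 (fst q)) * cf2 f2 (snd q)" for q
  have "cmod (t q) \<le> vnorm Y1 f1 * vnorm Y2 f2 * w q" for q
  proof -
    obtain i j where q: "q = (i, j)" by (cases q)
    have "cmod (cf1 f1 i) * cmod (cf2 f2 j) \<le> (vnorm Y1 f1 * w1 i) * (vnorm Y2 f2 * w2 j)"
      by (intro mult_mono p1.coorbit_inf_norm(1)[OF f1] p2.coorbit_inf_norm(1)[OF f2]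
          order_trans[OF norm_ge_zero p1.coorbit_inf_norm(1)[OF f1]] norm_ge_zero)
    then show ?thesis by (simp add: q t_def norm_mult w_pair mult_ac)
  qed
  then have "t \<in> Linf w" by (rule LinfI)
  moreover have "mat_app p.P t (i, j) = t (i, j)" for i j
  proof -
    have "mat_app p.P t (i, j) = cnj (mat_app p1.P (cf1 f1) i) * mat_app p2.P (cf2 f2) j"
      by (rule tensor_app[where A = p.P, OF _ P_tensor])
        (simp_all add: t_def p1.P.app_Linf(2)[OF p1.coorbit_inf_norm(1)[OF f1]]
          p2.P.app_Linf(2)[OF p2.coorbit_inf_norm(1)[OF f2]])
    then show ?thesis using Y1.cf_mem[OF f1] Y2.cf_mem[OF f2] by (simp add: p1.Dinf_def p2.Dinf_def t_def)
  qed
  ultimately have tD: "t \<in> p.Dinf" by (auto simp: p.Dinf_def)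
  have "F \<in> carr YT \<and> (\<forall>i j. cfT F (i, j) = cnj (cf1 f1 i) * cf2 f2 j)"
    unfolding F_def coorbit_tensor_def p.dual p1.dual p2.dual
  proof (rule theI)
    show "YT.el t \<in> carr YT \<and> (\<forall>i j. cfT (YT.el t) (i, j) = cnj (cf1 f1 i) * cf2 f2 j)"
      using tD by (simp add: YT.el_carr YT.cf_el t_def)
    show "F' = YT.el t" if "F' \<in> carr YT \<and> (\<forall>i j. cfT F' (i, j) = cnj (cf1 f1 i) * cf2 f2 j)" for F'
      using that tD by (intro YT.cf_inject) (auto simp: YT.el_carr YT.cf_el t_def fun_eq_iff)
  qed
  then show "F \<in> carr YT" "cfT F (i, j) = cnj (cf1 f1 i) * cf2 f2 j" by auto
qed

text \<open>The Gram matrix of the tensor frame factorises on \<open>f1 \<otimes> f2\<close>. Summing over the first index gives the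
  operator with kernel \<open>K\<close>, applied to \<open>f1\<close>.\<close>

lemma kernel_pairing:
  assumes K: "K \<in> carr XT" and f1: "f1 \<in> carr Y1" and f2: "f2 \<in> carr Y2"
  shows "pairing (tensor_frame \<psi>1 \<psi>2) K (coorbit_tensor \<psi>1 \<psi>2 (recip w) f1 f2)
    = (\<Sum>\<^sub>\<infinity>j. kop (cfT K) f1 j * cnj (mat_app p2.G (cf2 f2) j))"
proof -
  note F = coorbit_tensor_coefficients[OF f1 f2]
  have kL: "cfT K \<in> L1 w" using XT.cf_mem[OF K] by (simp add: p.D1_def)
  have "mat_app p.G (cfT (coorbit_tensor \<psi>1 \<psi>2 (recip w) f1 f2)) (i, j)
      = cnj (mat_app p1.G (cf1 f1) i) * mat_app p2.G (cf2 f2) j" for i j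
    by (rule tensor_app[where A = p.G and a = "cf1 f1" and b = "cf2 f2", OF F(2) G_tensor])
      (rule p1.G.app_Linf(2)[OF p1.coorbit_inf_norm(1)[OF f1]] p2.G.app_Linf(2)[OF p2.coorbit_inf_norm(1)[OF f2]])+
  then have "pairing (tensor_frame \<psi>1 \<psi>2) K (coorbit_tensor \<psi>1 \<psi>2 (recip w) f1 f2)
      = (\<Sum>\<^sub>\<infinity>(i, j). cfT K (i, j) * mat_app p1.G (cf1 f1) i * cnj (mat_app p2.G (cf2 f2) j))"
    unfolding pairing_def p.dual p.coorbit_inf_frame_coefficients[OF F(1)]
    by (intro infsum_cong) (auto simp: mult_ac)
  also have "\<dots> = (\<Sum>\<^sub>\<infinity>j. kop (cfT K) f1 j * cnj (mat_app p2.G (cf2 f2) j))"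
    unfolding kop_def
    by (rule act_pair(1)[OF kL Y1_bound[OF f1], symmetric, of "\<lambda>j. cnj (mat_app p2.G (cf2 f2) j)"])
      (use Y2_bound[OF f2] in simp)
  finally show ?thesis .
qed

lemma kernel_of_\<Phi>: "K \<in> carr XT \<Longrightarrow> kernel_of \<psi>1 w1 \<psi>2 w2 K (\<Phi> K)"
  unfolding kernel_of_def by (simp add: kernel_pairing pairing2 \<Phi>_carr cf_\<Phi>)

text \<open>The dual frame elements of the second frame recover every coefficient of the value \<open>T f\<close>.\<close>

lemma kernel_of_unique:
  assumes K: "K \<in> carr XT" and T: "T \<in> carr BO" and ker: "kernel_of \<psi>1 w1 \<psi>2 w2 K T"
  shows "T = \<Phi> K"
proof (rule extensionalityI)
  show "T \<in> extensional (carr Y1)" using T by (simp add: carr_BO)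
  show "\<Phi> K \<in> extensional (carr Y1)" by (simp add: \<Phi>_def)
  fix f assume f: "f \<in> carr Y1"
  have "cf2 (T f) k = cf2 (\<Phi> K f) k" for k
  proof -
    define g where "g = Y2.el (analysis \<phi>2 (\<phi>2 k))"
    have g: "g \<in> carr Y2" "cf2 g = analysis \<phi>2 (\<phi>2 k)"
      using p2.analysis_dual_frame_mem by (simp_all add: g_def Y2.el_carr Y2.cf_el)
    have "pairing \<psi>2 (T f) g = pairing \<psi>2 (\<Phi> K f) g"
      using ker kernel_of_\<Phi>[OF K] f g(1) by (simp add: kernel_of_def)
    then show ?thesis
      using p2.dual_pairing_coefficient[OF X2.cf_mem[OF BO_value[OF T f]], of k]
        p2.dual_pairing_coefficient[OF X2.cf_mem[OF \<Phi>_carr[OF K f]], of k]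
      by (simp add: pairing2 BO_value[OF T f] \<Phi>_carr[OF K f] g)
  qed
  then show "T f = \<Phi> K f" by (intro X2.cf_inject BO_value[OF T] \<Phi>_carr[OF K] f ext)
qed

text \<open>The dual frame elements of the first frame recover the array from the operator: \<open>G1\<close> maps them to
  columns of \<open>P1\<close>, and the array is fixed by \<open>cnj P1 \<otimes> P2\<close>.\<close>

lemma \<Phi>_inject:
  assumes K: "K \<in> carr XT" and L: "L \<in> carr XT" and e: "\<Phi> K = \<Phi> L"
  shows "K = L"
proof -
  have rec: "cfT M (k, l) = (\<Sum>\<^sub>\<infinity>j. kop (cfT M) (Y1.el (analysis \<phi>1 (\<phi>1 k))) j * p2.P l j)"
    if M: "M \<in> carr XT" for M k l
  proof -
    have mL: "cfT M \<in> L1 w" and mP: "mat_app p.P (cfT M) = cfT M" using XT.cf_mem[OF M] by (auto simp: p.D1_def)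
    have G1: "mat_app p1.G (cf1 (Y1.el (analysis \<phi>1 (\<phi>1 k)))) = (\<lambda>i. cnj (p1.P k i))"
      unfolding Y1.cf_el[OF p1.analysis_dual_frame_mem] p1.G_analysis
      by (simp add: fun_eq_iff analysis_def p1.P_def cinner_commute[symmetric])
    have "cfT M (k, l) = mat_app p.P (cfT M) (k, l)" by (simp add: mP)
    also have "\<dots> = (\<Sum>\<^sub>\<infinity>(i, j). cfT M (i, j) * cnj (p1.P k i) * p2.P l j)"
      unfolding mat_app_def by (intro infsum_cong) (auto simp: P_tensor)
    also have "\<dots> = (\<Sum>\<^sub>\<infinity>j. act (cfT M) (\<lambda>i. cnj (p1.P k i)) j * p2.P l j)"
      by (rule act_pair(1)[OF mL P1_row_bound P2_row_bound, symmetric])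
    finally show ?thesis by (simp add: kop_def G1)
  qed
  have "kop (cfT K) h = kop (cfT L) h" if "h \<in> carr Y1" for h
    using cf_\<Phi>[OF K that] cf_\<Phi>[OF L that] e by simp
  then have "kop (cfT K) (Y1.el (analysis \<phi>1 (\<phi>1 k))) = kop (cfT L) (Y1.el (analysis \<phi>1 (\<phi>1 k)))" for k
    by (simp add: Y1.el_carr p1.analysis_dual_frame_mem)
  then have "cfT K (k, l) = cfT L (k, l)" for k l using rec[OF K] rec[OF L] by simp
  then show ?thesis by (intro XT.cf_inject K L) auto
qed

end

section \<open>Nuclear expansions\<close>

lemma has_sum_sub:
  fixes f g :: "'i \<Rightarrow> 'b::real_normed_vector"
  assumes "(f has_sum a) A" "(g has_sum b) A"
  shows "((\<lambda>i. f i - g i) has_sum (a - b)) A"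
  using has_sum_add[OF assms(1), of "\<lambda>i. - g i" "- b"] assms(2) by (simp add: has_sum_uminus)

lemma infsum_off_finite:
  fixes f :: "'i \<Rightarrow> 'b::real_normed_vector"
  assumes f: "f summable_on UNIV" and F: "finite F"
  shows "((\<lambda>i. if i \<in> F then 0 else f i) has_sum (infsum f UNIV - sum f F)) UNIV"
proof -
  have "((\<lambda>i. if i \<in> F then f i else 0) has_sum sum f F) UNIV"
    by (rule has_sum_finite_neutralI[OF F]) auto
  from has_sum_sub[OF has_sum_infsum[OF f] this]
  show ?thesis by (rule has_sum_cong[THEN iffD1, rotated]) auto
qed

lemma (in weight) L1_sum_n1_le:
  assumes "finite F" "\<And>r. r \<in> F \<Longrightarrow> c r \<in> L1 w"
  shows "(\<lambda>i. \<Sum>r\<in>F. c r i) \<in> L1 w \<and> n1 w (\<lambda>i. \<Sum>r\<in>F. c r i) \<le> (\<Sum>r\<in>F. n1 w (c r))"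
  using assms
proof (induction F rule: finite_induct)
  case (insert r F)
  then show ?case
    using L1_add[of "c r" "\<lambda>i. \<Sum>r\<in>F. c r i"] n1_add[of "c r" "\<lambda>i. \<Sum>r\<in>F. c r i"] by fastforce
qed (simp add: L1_def n1_def)

context kernel_pair
begin

text \<open>The Gram matrix can be moved to the other argument of the pairing.\<close>

lemma pairing_dual:
  assumes h: "h \<in> carr Y1" and f: "f \<in> carr X1"
  shows "pairing \<psi>1 h f = (\<Sum>\<^sub>\<infinity>i. cnj (cf1 f i) * mat_app p1.G (cf1 h) i)"
    "cmod (pairing \<psi>1 h f) \<le> vnorm Y1 h * C1 * vnorm X1 f"
proof -
  have fL: "cf1 f \<in> L1 w1" using X1.cf_mem[OF f] by (simp add: p1.D1_def)
  have "(\<Sum>\<^sub>\<infinity>i. cnj (cf1 f i * cnj (mat_app p1.G (cf1 h) i)))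
      = (\<Sum>\<^sub>\<infinity>i. cnj (mat_app p1.G (cf1 f) i * cnj (cf1 h i)))"
    unfolding infsum_cnj p1.G.app_dual[OF fL p1.coorbit_inf_norm(1)[OF h]] ..
  then show e: "pairing \<psi>1 h f = (\<Sum>\<^sub>\<infinity>i. cnj (cf1 f i) * mat_app p1.G (cf1 h) i)"
    by (simp add: pairing1[OF h f] mult.commute)
  have "(\<lambda>i. cnj (cf1 f i)) \<in> L1 w1" "n1 w1 (\<lambda>i. cnj (cf1 f i)) = vnorm X1 f"
    using fL by (simp_all add: L1_def n1_def p1.coorbit1_norm[OF f])
  then show "cmod (pairing \<psi>1 h f) \<le> vnorm Y1 h * C1 * vnorm X1 f"
    unfolding e using p1.L1_Linf_summable(3)[OF _ Y1_bound[OF h]] by metis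
qed

lemma vsum_BO:
  assumes F: "finite F" and v: "\<And>r. r \<in> F \<Longrightarrow> v r h \<in> carr X2" and h: "h \<in> carr Y1"
  shows "vsum BO v F h \<in> carr X2 \<and> cf2 (vsum BO v F h) = (\<lambda>j. \<Sum>r\<in>F. cf2 (v r h) j)"
proof -
  have "foldr (\<lambda>r. vadd BO (v r)) l (vzero BO) h \<in> carr X2 \<and>
      cf2 (foldr (\<lambda>r. vadd BO (v r)) l (vzero BO) h) = (\<lambda>j. \<Sum>r\<leftarrow>l. cf2 (v r h) j)"
    if "\<And>r. r \<in> set l \<Longrightarrow> v r h \<in> carr X2" for l
    using that
  proof (induction l)
    case Nil
    then show ?case by (simp add: bounded_ops_def h X2.zero_carr X2.cf_zero)
  next
    case (Cons r l)
    then have IH: "foldr (\<lambda>r. vadd BO (v r)) l (vzero BO) h \<in> carr X2"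
      "cf2 (foldr (\<lambda>r. vadd BO (v r)) l (vzero BO) h) = (\<lambda>j. \<Sum>r\<leftarrow>l. cf2 (v r h) j)" and r: "v r h \<in> carr X2"
      by auto
    have "foldr (\<lambda>r. vadd BO (v r)) (r # l) (vzero BO) h
        = vadd X2 (v r h) (foldr (\<lambda>r. vadd BO (v r)) l (vzero BO) h)"
      by (simp add: bounded_ops_def[of Y1 X2] h)
    then show ?case by (simp add: X2.add_carr X2.cf_add IH r)
  qed
  from this[of "sorted_list_of_set F"] show ?thesis
    using F v by (simp add: vsum_def sum_list_distinct_conv_sum_set)
qed

lemma remainder_BO:
  assumes F: "finite F" and v: "\<And>r. r \<in> F \<Longrightarrow> v r h \<in> carr X2" and h: "h \<in> carr Y1" and T: "T h \<in> carr X2"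
  defines "D \<equiv> vadd BO T (vscale BO (- 1) (vsum BO v F))"
  shows "D h \<in> carr X2" "cf2 (D h) = (\<lambda>j. cf2 (T h) j - (\<Sum>r\<in>F. cf2 (v r h) j))"
proof -
  note s = vsum_BO[where v = v and h = h, OF F v h]
  have D: "D h = vadd X2 (T h) (vscale X2 (- 1) (vsum BO v F h))"
    unfolding D_def by (subst (1 2) bounded_ops_def) (simp add: h)
  show "D h \<in> carr X2" "cf2 (D h) = (\<lambda>j. cf2 (T h) j - (\<Sum>r\<in>F. cf2 (v r h) j))"
    unfolding D using s T by (simp_all add: X2.add_carr X2.scale_carr X2.cf_add X2.cf_scale)
qed

lemma vnorm_BO_le:
  assumes "0 \<le> M" "\<And>h. h \<in> carr Y1 \<Longrightarrow> vnorm X2 (D h) \<le> M * vnorm Y1 h"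
  shows "vnorm BO D \<le> M"
proof -
  have "Inf {M. 0 \<le> M \<and> (\<forall>x\<in>carr Y1. vnorm X2 (D x) \<le> M * vnorm Y1 x)} \<le> M"
    by (rule cInf_lower) (use assms in \<open>auto intro: bdd_belowI[of _ 0]\<close>)
  then show ?thesis by (simp add: bounded_ops_def)
qed

text \<open>Boundedness of \<open>D\<close> has to be supplied because the infimum of the empty set, which would define the norm
  of an unbounded map, is an arbitrary number.\<close>

lemma vnorm_BO_less:
  assumes M: "0 \<le> M" "\<And>h. h \<in> carr Y1 \<Longrightarrow> vnorm X2 (D h) \<le> M * vnorm Y1 h"
    and e: "vnorm BO D < e" and h: "h \<in> carr Y1"
  shows "vnorm X2 (D h) \<le> e * vnorm Y1 h"
proof -
  have "Inf {M. 0 \<le> M \<and> (\<forall>x\<in>carr Y1. vnorm X2 (D x) \<le> M * vnorm Y1 x)} < e"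
    using e by (simp add: bounded_ops_def)
  moreover have "{M. 0 \<le> M \<and> (\<forall>x\<in>carr Y1. vnorm X2 (D x) \<le> M * vnorm Y1 x)} \<noteq> {}" using M by blast
  ultimately obtain M' where M': "vnorm X2 (D h) \<le> M' * vnorm Y1 h" "M' < e"
    using cInf_lessD h by (metis (mono_tags, lifting) mem_Collect_eq)
  then show ?thesis
    using mult_right_mono[of M' e "vnorm Y1 h"] p1.coorbit_inf_norm(2)[OF h] by linarith
qed

definition rank_one_op :: "(nat \<Rightarrow> 'a) set \<Rightarrow> (nat \<Rightarrow> 'b) set \<Rightarrow> (nat \<Rightarrow> 'a) set \<Rightarrow> (nat \<Rightarrow> 'b) set"
  where "rank_one_op f g = (\<lambda>h\<in>carr Y1. vscale X2 (pairing \<psi>1 h f) g)"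

lemma rank_one_op:
  assumes "h \<in> carr Y1" "g \<in> carr X2"
  shows "rank_one_op f g h \<in> carr X2" "cf2 (rank_one_op f g h) = (\<lambda>j. pairing \<psi>1 h f * cf2 g j)"
  using assms by (simp_all add: rank_one_op_def X2.scale_carr X2.cf_scale)

lemma expandable_alt: "expandable \<psi>1 w1 \<psi>2 w2 T \<longleftrightarrow> (\<exists>(R::nat set) f g.
    (\<forall>r\<in>R. f r \<in> carr X1 \<and> g r \<in> carr X2) \<and> has_vsum BO (\<lambda>r. rank_one_op (f r) (g r)) R T \<and>
    (\<lambda>r. vnorm X1 (f r) * vnorm X2 (g r)) summable_on R)"
  by (simp add: expandable_def rank_one_op_def)

text \<open>The expansion uses \<open>\<psi>1 i\<close> and the row \<open>i\<close> of the array, for \<open>\<langle>h, \<psi>1 i\<rangle> = (G1 h) i\<close>. Removing finitely many terms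
  amounts to deleting the corresponding rows, so the remainder is again an operator with a kernel, and
  its norm is controlled by the sum of the remaining rows.\<close>

lemma expandable_\<Phi>:
  assumes K: "K \<in> carr XT"
  shows "expandable \<psi>1 w1 \<psi>2 w2 (\<Phi> K)"
proof -
  define k where "k = cfT K"
  have kD: "k \<in> p.D1" and kL: "k \<in> L1 w" using XT.cf_mem[OF K] by (auto simp: k_def p.D1_def)
  define R where "R = range (to_nat :: 'i \<Rightarrow> nat)"
  define f where "f r = X1.el (analysis \<phi>1 (\<psi>1 (from_nat r)))" for r
  define g where "g r = X2.el (\<lambda>j. k (from_nat r, j))" for r
  have f: "f r \<in> carr X1" "cf1 (f r) = analysis \<phi>1 (\<psi>1 (from_nat r))" for r
    using p1.analysis_frame_mem(1) by (simp_all add: f_def X1.el_carr X1.cf_el)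
  have g: "g r \<in> carr X2" "cf2 (g r) = (\<lambda>j. k (from_nat r, j))" for r
    using row_fixed[OF kD] by (simp_all add: g_def X2.el_carr X2.cf_el)
  have pair: "pairing \<psi>1 h (f r) = mat_app p1.G (cf1 h) (from_nat r)" if h: "h \<in> carr Y1" for h r
  proof -
    have "cf1 h i * cnj (mat_app p1.G (cf1 (f r)) i) = p1.G (from_nat r) i * cf1 h i" for i
      unfolding f p1.G_analysis
      by (simp add: analysis_def p1.G_def gram_def cinner_commute[symmetric])
    then show ?thesis unfolding pairing1[OF h f(1)] by (simp only: mat_app_def[of p1.G "cf1 h"])
  qed
  define a where "a i = w1 i * n1 w2 (\<lambda>j. k (i, j))" for i
  have a: "a summable_on UNIV" "infsum a UNIV = n1 w k"
    unfolding a_def[abs_def] by (rule row_sum[OF kL], rule row_sum_eq[OF kL])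
  have rest: "vnorm X2 ((vadd BO (\<Phi> K) (vscale BO (- 1) (vsum BO (\<lambda>r. rank_one_op (f r) (g r)) (to_nat ` F)))) h)
      \<le> C1 * (infsum a UNIV - sum a F) * vnorm Y1 h" (is "vnorm X2 (?D h) \<le> _")
    if F: "finite F" and h: "h \<in> carr Y1" for F :: "'i set" and h
  proof -
    \<comment> \<open>The array with the rows in \<open>F\<close> deleted.\<close>
    define k' where "k' p = (if fst p \<in> F then 0 else k p)" for p
    have k'L: "k' \<in> L1 w"
      unfolding L1_def mem_Collect_eq
      by (rule summable_on_comparison_test[of "\<lambda>p. cmod (k p) * w p"])
        (use kL p.w_pos in \<open>auto simp: L1_def k'_def less_imp_le\<close>)
    have "n1 w k' = (\<Sum>\<^sub>\<infinity>i. if i \<in> F then 0 else a i)"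
      unfolding row_sum_eq[OF k'L, symmetric] by (rule infsum_cong) (simp add: k'_def a_def n1_def)
    also have "\<dots> = infsum a UNIV - sum a F" by (rule infsumI[OF infsum_off_finite[OF a(1) F]])
    finally have n: "n1 w k' = infsum a UNIV - sum a F" .
    note rem = remainder_BO[of "to_nat ` F" "\<lambda>r. rank_one_op (f r) (g r)" h "\<Phi> K",
        OF finite_imageI[OF F] rank_one_op(1)[OF h g(1)] h \<Phi>_carr[OF K h]]
    have "cf2 (?D h) = kop k' h"
    proof
      fix j
      define q where "q i = k (i, j) * mat_app p1.G (cf1 h) i" for i
      have s: "q summable_on UNIV" unfolding q_def by (rule act_L1(1)[OF kL Y1_bound[OF h]])
      have "cf2 (?D h) j = infsum q UNIV - sum q F"
        unfolding rem(2) cf_\<Phi>[OF K h] k_def[symmetric] rank_one_op(2)[OF h g(1)] pair[OF h] g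
        by (simp add: sum.reindex inj_on_subset[OF inj_to_nat] kop_def act_def q_def[abs_def] mult.commute)
      also have "\<dots> = (\<Sum>\<^sub>\<infinity>i. if i \<in> F then 0 else q i)"
        by (rule infsumI[OF infsum_off_finite[OF s F], symmetric])
      also have "\<dots> = kop k' h j"
        unfolding kop_def act_def by (rule infsum_cong) (simp add: k'_def q_def)
      finally show "cf2 (?D h) j = kop k' h j" .
    qed
    then have "vnorm X2 (?D h) = n1 w2 (kop k' h)" using p2.coorbit1_norm[OF rem(1)] by simp
    then show ?thesis using kop_norm[OF k'L h] by (simp add: n mult_ac)
  qed
  have C1: "C1 \<ge> 0" by (rule p1.P.C_nonneg)
  show ?thesis
    unfolding expandable_alt
  proof (intro exI[of _ R] exI[of _ f] exI[of _ g] conjI ballI f(1) g(1))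
    show "has_vsum BO (\<lambda>r. rank_one_op (f r) (g r)) R (\<Phi> K)"
      unfolding has_vsum_def
    proof (intro allI impI)
      fix e :: real assume e: "e > 0"
      \<comment> \<open>Chosen such that \<open>C1 * d \<le> e/2\<close>, also for \<open>C1 = 0\<close>.\<close>
      define d where "d = e / (2 * (C1 + 1))"
      have d: "d > 0" using e C1 by (simp add: d_def)
      have "(sum a \<longlongrightarrow> infsum a UNIV) (finite_subsets_at_top UNIV)" by (rule infsum_tendsto[OF a(1)])
      then have "\<forall>\<^sub>F F in finite_subsets_at_top UNIV. dist (sum a F) (infsum a UNIV) < d"
        using d by (simp add: tendsto_iff)
      then obtain F0 where F0: "finite F0" "\<And>F. finite F \<Longrightarrow> F0 \<subseteq> F \<Longrightarrow> dist (sum a F) (infsum a UNIV) < d"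
        by (auto simp: eventually_finite_subsets_at_top)
      show "\<exists>F0. finite F0 \<and> F0 \<subseteq> R \<and> (\<forall>F. finite F \<and> F0 \<subseteq> F \<and> F \<subseteq> R \<longrightarrow>
          vnorm BO (vadd BO (\<Phi> K) (vscale BO (- 1) (vsum BO (\<lambda>r. rank_one_op (f r) (g r)) F))) < e)"
      proof (intro exI[of _ "to_nat ` F0"] conjI allI impI)
        show "finite (to_nat ` F0)" "to_nat ` F0 \<subseteq> R" using F0 by (auto simp: R_def)
        fix F assume F: "finite F \<and> to_nat ` F0 \<subseteq> F \<and> F \<subseteq> R"
        define I where "I = {i :: 'i. to_nat i \<in> F}"
        have I: "F = to_nat ` I" using F by (auto simp: I_def R_def)
        have fin: "finite I" using F unfolding I by (metis finite_imageD inj_on_subset[OF inj_to_nat] subset_UNIV)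
        have "F0 \<subseteq> I" using F by (auto simp: I_def)
        then have "infsum a UNIV - sum a I \<le> d" using F0(2)[OF fin] by (simp add: dist_real_def)
        then have "C1 * (infsum a UNIV - sum a I) \<le> C1 * d" using C1 by (rule mult_left_mono)
        also have "\<dots> \<le> e / 2" using C1 e by (simp add: d_def field_simps)
        finally have le: "C1 * (infsum a UNIV - sum a I) \<le> e / 2" .
        have "vnorm BO (vadd BO (\<Phi> K) (vscale BO (- 1) (vsum BO (\<lambda>r. rank_one_op (f r) (g r)) F))) \<le> e / 2"
          unfolding I
        proof (rule vnorm_BO_le)
          fix h assume h: "h \<in> carr Y1"
          show "vnorm X2 ((vadd BO (\<Phi> K) (vscale BO (- 1) (vsum BO (\<lambda>r. rank_one_op (f r) (g r)) (to_nat ` I)))) h)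
              \<le> e / 2 * vnorm Y1 h"
            using rest[OF fin h] mult_right_mono[OF le p1.coorbit_inf_norm(2)[OF h]] by (rule order_trans)
        qed (use e in simp)
        then show "vnorm BO (vadd BO (\<Phi> K) (vscale BO (- 1) (vsum BO (\<lambda>r. rank_one_op (f r) (g r)) F))) < e"
          using e by simp
      qed
    qed
    have "(\<lambda>i :: 'i. vnorm X1 (f (to_nat i)) * vnorm X2 (g (to_nat i))) summable_on UNIV"
    proof (rule summable_on_comparison_test)
      show "(\<lambda>i. C1 * a i) summable_on UNIV" by (intro summable_on_cmult_right a)
      fix i :: 'i
      have 1: "vnorm X1 (f (to_nat i)) = n1 w1 (analysis \<phi>1 (\<psi>1 i))"
        and 2: "vnorm X2 (g (to_nat i)) = n1 w2 (\<lambda>j. k (i, j))"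
        by (simp_all add: p1.coorbit1_norm[OF f(1)] p2.coorbit1_norm[OF g(1)] f(2) g(2))
      show "vnorm X1 (f (to_nat i)) * vnorm X2 (g (to_nat i)) \<le> C1 * a i"
        using mult_right_mono[OF p1.analysis_frame_mem(2) p2.n1_nonneg] by (simp add: 1 2 a_def mult.assoc)
      show "0 \<le> vnorm X1 (f (to_nat i)) * vnorm X2 (g (to_nat i))"
        by (simp add: 1 2 p1.n1_nonneg p2.n1_nonneg)
    qed
    then show "(\<lambda>r. vnorm X1 (f r) * vnorm X2 (g r)) summable_on R"
      unfolding R_def summable_on_reindex[OF inj_to_nat] o_def .
  qed
qed

text \<open>Convergence in operator norm implies convergence of each coefficient of each value.\<close>

lemma expansion_coefficients:
  assumes T: "T \<in> carr BO" and fg: "\<And>r. r \<in> R \<Longrightarrow> f r \<in> carr X1" "\<And>r. r \<in> R \<Longrightarrow> g r \<in> carr X2"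
    and sum: "has_vsum BO (\<lambda>r. rank_one_op (f r) (g r)) R T" and h: "h \<in> carr Y1"
  shows "((\<lambda>r. pairing \<psi>1 h (f r) * cf2 (g r) j) has_sum cf2 (T h) j) R"
  unfolding has_sum_def tendsto_iff
proof (intro allI impI)
  fix e :: real assume e: "e > 0"
  \<comment> \<open>An operator of norm below \<open>d\<close> moves coefficient \<open>j\<close> of its value at \<open>h\<close> by less than \<open>e\<close>.\<close>
  define d where "d = e * w2 j / (vnorm Y1 h + 1)"
  have vh: "vnorm Y1 h \<ge> 0" by (rule p1.coorbit_inf_norm(2)[OF h])
  have d: "d > 0" using e p2.w_pos[of j] vh by (simp add: d_def)
  have C1: "C1 \<ge> 0" by (rule p1.P.C_nonneg)
  obtain MT where MT: "\<And>x. x \<in> carr Y1 \<Longrightarrow> vnorm X2 (T x) \<le> MT * vnorm Y1 x" using T by (auto simp: carr_BO)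
  let ?D = "\<lambda>F. vadd BO T (vscale BO (- 1) (vsum BO (\<lambda>r. rank_one_op (f r) (g r)) F))"
  obtain F0 where F0: "finite F0" "F0 \<subseteq> R"
    "\<And>F. finite F \<Longrightarrow> F0 \<subseteq> F \<Longrightarrow> F \<subseteq> R \<Longrightarrow> vnorm BO (?D F) < d"
    using sum d unfolding has_vsum_def by meson
  have "dist (\<Sum>r\<in>F. pairing \<psi>1 h (f r) * cf2 (g r) j) (cf2 (T h) j) < e"
    if F: "finite F" "F0 \<subseteq> F" "F \<subseteq> R" for F
  proof -
    have rem: "?D F x \<in> carr X2" "cf2 (?D F x) = (\<lambda>j. cf2 (T x) j - (\<Sum>r\<in>F. pairing \<psi>1 x (f r) * cf2 (g r) j))"
      if x: "x \<in> carr Y1" for x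
    proof -
      note r = remainder_BO[of F "\<lambda>r. rank_one_op (f r) (g r)" x T, OF F(1) _ x BO_value[OF T x]]
      have v: "rank_one_op (f r) (g r) x \<in> carr X2" if "r \<in> F" for r
        using that F fg by (intro rank_one_op x) auto
      show "?D F x \<in> carr X2" by (rule r(1)[OF v])
      have eq: "(\<Sum>r\<in>F. cf2 (rank_one_op (f r) (g r) x) j) = (\<Sum>r\<in>F. pairing \<psi>1 x (f r) * cf2 (g r) j)" for j
        using F fg by (intro sum.cong refl) (auto simp: rank_one_op(2)[OF x])
      show "cf2 (?D F x) = (\<lambda>j. cf2 (T x) j - (\<Sum>r\<in>F. pairing \<psi>1 x (f r) * cf2 (g r) j))"
        using r(2)[OF v] unfolding eq .
    qed
    \<comment> \<open>Some bound of the remainder. The given bound \<open>MT\<close> of \<open>T\<close> may be negative if the domain is trivial.\<close>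
    define M where "M = max MT 0 + (\<Sum>r\<in>F. C1 * vnorm X1 (f r) * vnorm X2 (g r))"
    have nn: "0 \<le> C1 * vnorm X1 (f r) * vnorm X2 (g r)" if "r \<in> F" for r
    proof -
      have "r \<in> R" using that F by blast
      then show ?thesis using C1 fg[of r]
        by (simp add: p1.coorbit1_norm p2.coorbit1_norm p1.n1_nonneg p2.n1_nonneg)
    qed
    have "vnorm X2 (?D F h) \<le> d * vnorm Y1 h"
    proof (rule vnorm_BO_less[OF _ _ F0(3)[OF F] h])
      show "0 \<le> M" unfolding M_def using nn by (intro add_nonneg_nonneg sum_nonneg) auto
      fix x assume x: "x \<in> carr Y1"
      have TL: "cf2 (T x) \<in> L1 w2" using X2.cf_mem[OF BO_value[OF T x]] by (simp add: p2.D1_def)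
      have gL: "(\<lambda>j. pairing \<psi>1 x (f r) * cf2 (g r) j) \<in> L1 w2" if "r \<in> F" for r
        using X2.cf_mem[OF fg(2)] that F by (intro p2.L1_scale) (auto simp: p2.D1_def)
      note sL = p2.L1_sum_n1_le[of F "\<lambda>r j. pairing \<psi>1 x (f r) * cf2 (g r) j", OF F(1) gL]
      have vx: "vnorm Y1 x \<ge> 0" by (rule p1.coorbit_inf_norm(2)[OF x])
      have "vnorm X2 (?D F x) = n1 w2 (\<lambda>j. cf2 (T x) j - (\<Sum>r\<in>F. pairing \<psi>1 x (f r) * cf2 (g r) j))"
        using p2.coorbit1_norm[OF rem(1)[OF x]] by (simp add: rem(2)[OF x])
      also have "\<dots> \<le> n1 w2 (cf2 (T x)) + n1 w2 (\<lambda>j. \<Sum>r\<in>F. pairing \<psi>1 x (f r) * cf2 (g r) j)"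
        using p2.n1_add[OF TL p2.L1_scale[OF conjunct1[OF sL], of "- 1"]]
          p2.n1_scale[of "- 1" "\<lambda>j. \<Sum>r\<in>F. pairing \<psi>1 x (f r) * cf2 (g r) j"] by simp
      also have "\<dots> \<le> max MT 0 * vnorm Y1 x + (\<Sum>r\<in>F. (C1 * vnorm X1 (f r) * vnorm X2 (g r)) * vnorm Y1 x)"
      proof (rule add_mono)
        have "MT * vnorm Y1 x \<le> max MT 0 * vnorm Y1 x" using vx by (intro mult_right_mono) auto
        then show "n1 w2 (cf2 (T x)) \<le> max MT 0 * vnorm Y1 x"
          using MT[OF x] by (simp add: p2.coorbit1_norm[OF BO_value[OF T x]])
        have "(\<Sum>r\<in>F. n1 w2 (\<lambda>j. pairing \<psi>1 x (f r) * cf2 (g r) j))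
            \<le> (\<Sum>r\<in>F. (C1 * vnorm X1 (f r) * vnorm X2 (g r)) * vnorm Y1 x)"
        proof (rule sum_mono)
          fix r assume "r \<in> F"
          then have r: "f r \<in> carr X1" "g r \<in> carr X2" using F fg by auto
          show "n1 w2 (\<lambda>j. pairing \<psi>1 x (f r) * cf2 (g r) j) \<le> (C1 * vnorm X1 (f r) * vnorm X2 (g r)) * vnorm Y1 x"
            using mult_right_mono[OF pairing_dual(2)[OF x r(1)] p2.n1_nonneg[of "cf2 (g r)"]]
            unfolding p2.n1_scale p2.coorbit1_norm[OF r(2)] by (simp add: mult_ac)
        qed
        then show "n1 w2 (\<lambda>j. \<Sum>r\<in>F. pairing \<psi>1 x (f r) * cf2 (g r) j)
            \<le> (\<Sum>r\<in>F. (C1 * vnorm X1 (f r) * vnorm X2 (g r)) * vnorm Y1 x)"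
          using sL by linarith
      qed
      also have "\<dots> = M * vnorm Y1 x" by (simp add: M_def distrib_right sum_distrib_right)
      finally show "vnorm X2 (?D F x) \<le> M * vnorm Y1 x" .
    qed
    moreover have "cmod (cf2 (?D F h) j) * w2 j \<le> vnorm X2 (?D F h)"
      unfolding p2.coorbit1_norm[OF rem(1)[OF h]]
      using X2.cf_mem[OF rem(1)[OF h]] by (intro p2.n1_entry) (simp add: p2.D1_def)
    moreover have "d * vnorm Y1 h < e * w2 j"
    proof -
      have "vnorm Y1 h / (vnorm Y1 h + 1) < 1" using vh by simp
      then have "e * w2 j * (vnorm Y1 h / (vnorm Y1 h + 1)) < e * w2 j * 1"
        using e p2.w_pos[of j] by (intro mult_strict_left_mono) auto
      then show ?thesis by (simp add: d_def)
    qed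
    ultimately have "cmod (cf2 (?D F h) j) * w2 j < e * w2 j" by linarith
    then have "cmod (cf2 (?D F h) j) < e" using p2.w_pos[of j] by simp
    then show ?thesis by (simp add: rem(2)[OF h] dist_norm norm_minus_commute)
  qed
  then show "\<forall>\<^sub>F F in finite_subsets_at_top R. dist (\<Sum>r\<in>F. pairing \<psi>1 h (f r) * cf2 (g r) j) (cf2 (T h) j) < e"
    unfolding eventually_finite_subsets_at_top using F0(1,2) by blast
qed

text \<open>The array of a nuclear expansion. The summability of \<open>\<parallel>c r\<parallel> \<parallel>d r\<parallel>\<close> dominates every double sum that has to be
  reordered.\<close>

lemma nuclear_kernel:
  fixes c :: "nat \<Rightarrow> 'i \<Rightarrow> complex" and d :: "nat \<Rightarrow> 'j \<Rightarrow> complex"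
  assumes c: "\<And>r. c r \<in> p1.D1" and d: "\<And>r. d r \<in> p2.D1"
    and s: "(\<lambda>r. n1 w1 (c r) * n1 w2 (d r)) summable_on UNIV"
  defines "k \<equiv> \<lambda>p. \<Sum>\<^sub>\<infinity>r. cnj (c r (fst p)) * d r (snd p)"
  shows "k \<in> p.D1"
    and "h \<in> carr Y1 \<Longrightarrow> kop k h j = (\<Sum>\<^sub>\<infinity>r. (\<Sum>\<^sub>\<infinity>i. cnj (c r i) * mat_app p1.G (cf1 h) i) * d r j)"
proof -
  have cL: "c r \<in> L1 w1" "mat_app p1.P (c r) = c r" for r using c[of r] by (auto simp: p1.D1_def)
  have dL: "d r \<in> L1 w2" "mat_app p2.P (d r) = d r" for r using d[of r] by (auto simp: p2.D1_def)
  define u where "u p r = cnj (c r (fst p)) * d r (snd p)" for p r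
  define g where "g p r = u p r * complex_of_real (w p)" for p r
  have finite_le: "(\<Sum>i\<in>F. cmod (c r i) * w1 i) \<le> n1 w1 (c r)" if "finite F" for F r
    unfolding n1_def using cL(1)[of r] that p1.w_pos
    by (intro finite_sum_le_infsum) (auto simp: L1_def less_imp_le)
  have finite_le2: "(\<Sum>j\<in>F. cmod (d r j) * w2 j) \<le> n1 w2 (d r)" if "finite F" for F r
    unfolding n1_def using dL(1)[of r] that p2.w_pos
    by (intro finite_sum_le_infsum) (auto simp: L1_def less_imp_le)
  have le: "(\<Sum>p\<in>F. cmod (g p r)) \<le> n1 w1 (c r) * n1 w2 (d r)" if F: "finite F" for F r
  proof -
    define F1 where "F1 = fst ` F"
    define F2 where "F2 = snd ` F"
    have FF: "finite F1" "finite F2" "F \<subseteq> F1 \<times> F2" using F by (force simp: F1_def F2_def)+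
    have "(\<Sum>p\<in>F. cmod (g p r)) \<le> (\<Sum>p\<in>F1 \<times> F2. cmod (g p r))" by (rule sum_mono2) (use FF in auto)
    also have "\<dots> = (\<Sum>i\<in>F1. cmod (c r i) * w1 i) * (\<Sum>j\<in>F2. cmod (d r j) * w2 j)"
      unfolding sum_product sum.cartesian_product using p1.w_pos p2.w_pos
      by (intro sum.cong) (auto simp: g_def u_def w_pair norm_mult less_imp_le mult_ac)
    also have "\<dots> \<le> n1 w1 (c r) * n1 w2 (d r)"
      using p1.w_pos p2.w_pos
      by (intro mult_mono finite_le finite_le2 FF p1.n1_nonneg sum_nonneg) (auto simp: less_imp_le)
    finally show ?thesis .
  qed
  have gs: "(\<lambda>(p, r). cmod (g p r)) summable_on UNIV" by (rule double_sumI(1)[OF le s])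
  have k: "k p = (\<Sum>\<^sub>\<infinity>r. u p r)" for p by (simp add: k_def u_def)
  have "cmod (k p) * w p = cmod (\<Sum>\<^sub>\<infinity>r. g p r)" for p
    using p.w_pos[of p] by (simp add: k g_def infsum_cmult_left' norm_mult)
  then have kL: "k \<in> L1 w" using double_sumD(4)[OF gs] by (simp add: L1_def)
  have "mat_app p.P k p = k p" for p
  proof -
    obtain i j where p: "p = (i, j)" by (cases p)
    have us: "(\<lambda>(q, r). cmod (p.P p q * u q r)) summable_on UNIV"
    proof (rule summable_on_comparison_test)
      show "(\<lambda>x. C / w p * (case x of (q, r) \<Rightarrow> cmod (g q r))) summable_on UNIV"
        by (intro summable_on_cmult_right gs)
      fix x :: "('i \<times> 'j) \<times> nat"
      obtain q r where x: "x = (q, r)" by (cases x)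
      have "cmod (p.P p q) \<le> C / w p * w q"
        using p.P.column_Linf[of q p] p.P.A_sym[of p q] by simp
      from mult_right_mono[OF this, of "cmod (u q r)"]
      show "(case x of (q, r) \<Rightarrow> cmod (p.P p q * u q r)) \<le> C / w p * (case x of (q, r) \<Rightarrow> cmod (g q r))"
        using p.w_pos[of q] by (simp add: x g_def norm_mult mult_ac)
    qed auto
    have "mat_app p.P k p = (\<Sum>\<^sub>\<infinity>q. \<Sum>\<^sub>\<infinity>r. p.P p q * u q r)"
      by (simp add: mat_app_def k infsum_cmult_right')
    also have "\<dots> = (\<Sum>\<^sub>\<infinity>r. \<Sum>\<^sub>\<infinity>q. p.P p q * u q r)" by (rule double_sumD(2)[OF us])
    also have "\<dots> = (\<Sum>\<^sub>\<infinity>r. u p r)"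
    proof (rule infsum_cong)
      fix r
      have "mat_app p.P (\<lambda>q. u q r) (i, j) = cnj (mat_app p1.P (c r) i) * mat_app p2.P (d r) j"
        by (rule tensor_app[where A = p.P, OF _ P_tensor])
          (simp_all add: u_def p1.P.app_L1(1)[OF cL(1)] p2.P.app_L1(1)[OF dL(1)])
      then show "(\<Sum>\<^sub>\<infinity>q. p.P p q * u q r) = u p r" by (simp add: mat_app_def[of p.P] p cL dL u_def)
    qed
    finally show ?thesis by (simp add: k)
  qed
  then show "k \<in> p.D1" using kL by (simp add: p.D1_def fun_eq_iff)
  assume h: "h \<in> carr Y1"
  define A where "A = mat_app p1.G (cf1 h)"
  define H where "H = vnorm Y1 h * C1"
  have A: "cmod (A i) \<le> H * w1 i" for i unfolding A_def H_def by (rule Y1_bound[OF h])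
  have H: "H \<ge> 0" unfolding H_def using p1.coorbit_inf_norm(2)[OF h] p1.P.C_nonneg by simp
  have "(\<Sum>i\<in>F. cmod (cnj (c r i) * d r j * A i)) \<le> H / w2 j * (n1 w1 (c r) * n1 w2 (d r))" if F: "finite F" for F r
  proof -
    have "(\<Sum>i\<in>F. cmod (cnj (c r i) * d r j * A i)) \<le> (\<Sum>i\<in>F. cmod (d r j) * H * (cmod (c r i) * w1 i))"
    proof (rule sum_mono)
      fix i
      have "cmod (c r i) * cmod (d r j) * cmod (A i) \<le> cmod (c r i) * cmod (d r j) * (H * w1 i)"
        by (intro mult_left_mono A) auto
      then show "cmod (cnj (c r i) * d r j * A i) \<le> cmod (d r j) * H * (cmod (c r i) * w1 i)"
        by (simp add: norm_mult mult_ac)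
    qed
    also have "\<dots> \<le> cmod (d r j) * H * n1 w1 (c r)"
      unfolding sum_distrib_left[symmetric] using H by (intro mult_left_mono finite_le F) auto
    also have "\<dots> \<le> (n1 w2 (d r) / w2 j) * H * n1 w1 (c r)"
      using p2.n1_entry[OF dL(1), of r j] p2.w_pos[of j] H p1.n1_nonneg
      by (intro mult_right_mono) (auto simp: field_simps)
    finally show ?thesis by (simp add: mult_ac)
  qed
  from double_sumI(1)[OF this summable_on_cmult_right[OF s]]
  have sw: "(\<Sum>\<^sub>\<infinity>i. \<Sum>\<^sub>\<infinity>r. cnj (c r i) * d r j * A i) = (\<Sum>\<^sub>\<infinity>r. \<Sum>\<^sub>\<infinity>i. cnj (c r i) * d r j * A i)"
    by (rule double_sumD(2))
  have "kop k h j = (\<Sum>\<^sub>\<infinity>i. \<Sum>\<^sub>\<infinity>r. cnj (c r i) * d r j * A i)"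
    by (simp add: kop_def act_def A_def k u_def infsum_cmult_left')
  also have "\<dots> = (\<Sum>\<^sub>\<infinity>r. (\<Sum>\<^sub>\<infinity>i. cnj (c r i) * A i) * d r j)"
    unfolding sw infsum_cmult_left'[symmetric] by (simp add: mult_ac)
  finally show "kop k h j = (\<Sum>\<^sub>\<infinity>r. (\<Sum>\<^sub>\<infinity>i. cnj (c r i) * mat_app p1.G (cf1 h) i) * d r j)"
    by (simp add: A_def)
qed

text \<open>The expansion is extended by zero to all of \<open>nat\<close>, which changes neither the array nor the operator.\<close>

lemma \<Phi>_surjective:
  assumes T: "T \<in> carr BO" and ex: "expandable \<psi>1 w1 \<psi>2 w2 T"
  shows "\<exists>K\<in>carr XT. \<Phi> K = T"
proof -
  obtain R :: "nat set" and f g where fg: "\<And>r. r \<in> R \<Longrightarrow> f r \<in> carr X1" "\<And>r. r \<in> R \<Longrightarrow> g r \<in> carr X2"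
    and sum: "has_vsum BO (\<lambda>r. rank_one_op (f r) (g r)) R T"
    and s: "(\<lambda>r. vnorm X1 (f r) * vnorm X2 (g r)) summable_on R"
    using ex unfolding expandable_alt by blast
  define c where "c r = (if r \<in> R then cf1 (f r) else (\<lambda>i. 0))" for r
  define d where "d r = (if r \<in> R then cf2 (g r) else (\<lambda>i. 0))" for r
  have c: "c r \<in> p1.D1" for r
    using X1.cf_mem[OF fg(1)] X1.cf_mem[OF X1.zero_carr] by (simp add: c_def X1.cf_zero)
  have d: "d r \<in> p2.D1" for r
    using X2.cf_mem[OF fg(2)] X2.cf_mem[OF X2.zero_carr] by (simp add: d_def X2.cf_zero)
  have s': "(\<lambda>r. n1 w1 (c r) * n1 w2 (d r)) summable_on UNIV"
    by (rule summable_on_cong_neutral[THEN iffD1, OF _ _ _ s])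
      (auto simp: c_def d_def p1.coorbit1_norm fg p2.coorbit1_norm n1_def)
  define k where "k p = (\<Sum>\<^sub>\<infinity>r. cnj (c r (fst p)) * d r (snd p))" for p
  have kD: "k \<in> p.D1"
    and kop: "h \<in> carr Y1 \<Longrightarrow> kop k h j = (\<Sum>\<^sub>\<infinity>r. (\<Sum>\<^sub>\<infinity>i. cnj (c r i) * mat_app p1.G (cf1 h) i) * d r j)" for h j
    unfolding k_def[abs_def] using nuclear_kernel[OF c d s'] by blast+
  define K where "K = XT.el k"
  have K: "K \<in> carr XT" "cfT K = k" using kD by (simp_all add: K_def XT.el_carr XT.cf_el)
  have "\<Phi> K = T"
  proof (rule extensionalityI)
    show "T \<in> extensional (carr Y1)" using T by (simp add: carr_BO)
    show "\<Phi> K \<in> extensional (carr Y1)" by (simp add: \<Phi>_def)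
    fix h assume h: "h \<in> carr Y1"
    have "cf2 (\<Phi> K h) j = cf2 (T h) j" for j
    proof -
      have "cf2 (\<Phi> K h) j = (\<Sum>\<^sub>\<infinity>r. (\<Sum>\<^sub>\<infinity>i. cnj (c r i) * mat_app p1.G (cf1 h) i) * d r j)"
        by (simp add: cf_\<Phi>[OF K(1) h] K(2) kop[OF h])
      also have "\<dots> = (\<Sum>\<^sub>\<infinity>r\<in>R. pairing \<psi>1 h (f r) * cf2 (g r) j)"
        by (rule infsum_cong_neutral) (auto simp: c_def d_def pairing_dual(1)[OF h fg(1)])
      also have "\<dots> = cf2 (T h) j" by (rule infsumI[OF expansion_coefficients[OF T fg sum h]])
      finally show ?thesis .
    qed
    then show "\<Phi> K h = T h" by (intro X2.cf_inject BO_value[OF T] \<Phi>_carr[OF K(1)] h ext)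
  qed
  then show ?thesis using K(1) by blast
qed

lemma carr_nuclear: "carr (nuclear_ops \<psi>1 w1 \<psi>2 w2) = {T \<in> carr BO. expandable \<psi>1 w1 \<psi>2 w2 T}"
  by (simp add: nuclear_ops_def Let_def)

lemma \<Phi>_nuclear: "K \<in> carr XT \<Longrightarrow> \<Phi> K \<in> carr (nuclear_ops \<psi>1 w1 \<psi>2 w2)"
  by (simp add: carr_nuclear \<Phi>_bounded expandable_\<Phi>)

lemma \<Phi>_iso: "lin_iso XT (nuclear_ops \<psi>1 w1 \<psi>2 w2) \<Phi>"
proof -
  have L: "cfT K \<in> L1 w" if "K \<in> carr XT" for K using XT.cf_mem[OF that] by (simp add: p.D1_def)
  have "\<Phi> (vadd XT K M) = (\<lambda>h\<in>carr Y1. vadd X2 (\<Phi> K h) (\<Phi> M h))" if KM: "K \<in> carr XT" "M \<in> carr XT" for K M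
  proof (rule extensionalityI)
    fix h assume h: "h \<in> carr Y1"
    have "\<Phi> (vadd XT K M) h = vadd X2 (\<Phi> K h) (\<Phi> M h)"
      by (rule X2.cf_inject) (simp_all add: \<Phi>_carr KM h XT.add_carr X2.add_carr X2.cf_add cf_\<Phi> XT.cf_add kop_add L)
    then show "\<Phi> (vadd XT K M) h = (\<lambda>h\<in>carr Y1. vadd X2 (\<Phi> K h) (\<Phi> M h)) h" using h by simp
  qed (auto simp: \<Phi>_def)
  moreover have "\<Phi> (vscale XT a K) = (\<lambda>h\<in>carr Y1. vscale X2 a (\<Phi> K h))" if K: "K \<in> carr XT" for K a
  proof (rule extensionalityI)
    fix h assume h: "h \<in> carr Y1"
    have "\<Phi> (vscale XT a K) h = vscale X2 a (\<Phi> K h)"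
      by (rule X2.cf_inject) (simp_all add: \<Phi>_carr K h XT.scale_carr X2.scale_carr X2.cf_scale cf_\<Phi> XT.cf_scale kop_scale)
    then show "\<Phi> (vscale XT a K) h = (\<lambda>h\<in>carr Y1. vscale X2 a (\<Phi> K h)) h" using h by simp
  qed (auto simp: \<Phi>_def)
  ultimately have "lin_map XT (nuclear_ops \<psi>1 w1 \<psi>2 w2) \<Phi>"
    unfolding lin_map_def using \<Phi>_nuclear by (auto simp: nuclear_ops_def Let_def bounded_ops_def)
  moreover have "bij_betw \<Phi> (carr XT) (carr (nuclear_ops \<psi>1 w1 \<psi>2 w2))"
  proof (rule bij_betwI')
    show "\<Phi> K = \<Phi> M \<longleftrightarrow> K = M" if "K \<in> carr XT" "M \<in> carr XT" for K M using \<Phi>_inject that by blast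
    show "\<Phi> K \<in> carr (nuclear_ops \<psi>1 w1 \<psi>2 w2)" if "K \<in> carr XT" for K using that by (rule \<Phi>_nuclear)
    show "\<exists>K\<in>carr XT. T = \<Phi> K" if "T \<in> carr (nuclear_ops \<psi>1 w1 \<psi>2 w2)" for T
      using \<Phi>_surjective[of T] that by (auto simp: carr_nuclear)
  qed
  ultimately show ?thesis by (simp add: lin_iso_def)
qed

end

theorem theorem4p3:
  fixes \<psi>1 :: "'i::countable \<Rightarrow> 'a::{chilbert_space, second_countable_topology}"
    and \<psi>2 :: "'j::countable \<Rightarrow> 'b::{chilbert_space, second_countable_topology}"
    and w1 :: "'i \<Rightarrow> real" and w2 :: "'j \<Rightarrow> real"
    and \<A>1 :: "'i matrix set" and N1 :: "'i matrix \<Rightarrow> real"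
    and \<A>2 :: "'j matrix set" and N2 :: "'j matrix \<Rightarrow> real"
  assumes "spectral_matrix_algebra \<A>1 N1" and "spectral_matrix_algebra \<A>2 N2"
    and "localised_frame \<A>1 \<psi>1" and "localised_frame \<A>2 \<psi>2"
    and "admissible_weight \<A>1 w1" and "admissible_weight \<A>2 w2"
  defines "H11 \<equiv> coorbit 1 (tensor_frame \<psi>1 \<psi>2) (tensor_weight w1 w2)"
    and "\<B> \<equiv> nuclear_ops \<psi>1 w1 \<psi>2 w2"
  shows "(\<exists>\<Phi>. lin_iso H11 \<B> \<Phi> \<and> (\<forall>K\<in>carr H11. kernel_of \<psi>1 w1 \<psi>2 w2 K (\<Phi> K)))
    \<and> (\<forall>K\<in>carr H11. \<exists>!T. T \<in> carr \<B> \<and> kernel_of \<psi>1 w1 \<psi>2 w2 K T)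
    \<and> (\<forall>T\<in>carr \<B>. \<exists>!K. K \<in> carr H11 \<and> kernel_of \<psi>1 w1 \<psi>2 w2 K T)"
proof -
  obtain C1 where l1: "localised_pair \<psi>1 (canonical_dual \<psi>1) w1 C1"
    using localised_pair_of_frame assms(1,3,5) by blast
  obtain C2 where l2: "localised_pair \<psi>2 (canonical_dual \<psi>2) w2 C2"
    using localised_pair_of_frame assms(2,4,6) by blast
  have "frame \<psi>1" "frame \<psi>2" using assms(3,4) by (auto simp: localised_frame_def)
  then have l: "localised_pair (tensor_frame \<psi>1 \<psi>2) (tensor_frame (canonical_dual \<psi>1) (canonical_dual \<psi>2))
      (tensor_weight w1 w2) (C1 * C2)"
    using localised_pair_tensor l1 l2 by blast
  interpret kernel_pair \<psi>1 "canonical_dual \<psi>1" w1 C1 \<psi>2 "canonical_dual \<psi>2" w2 C2 "C1 * C2"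
    using l1 l2 l by (rule kernel_pair.intro)
  have surj: "\<exists>K\<in>carr H11. T = \<Phi> K" if "T \<in> carr \<B>" for T
    using that \<Phi>_surjective[of T] by (auto simp: \<B>_def H11_def carr_nuclear)
  have unique: "T = \<Phi> K" if "K \<in> carr H11" "T \<in> carr \<B>" "kernel_of \<psi>1 w1 \<psi>2 w2 K T" for K T
    using that by (intro kernel_of_unique) (auto simp: \<B>_def H11_def carr_nuclear)
  have ker: "kernel_of \<psi>1 w1 \<psi>2 w2 K (\<Phi> K)" and mem: "\<Phi> K \<in> carr \<B>" if "K \<in> carr H11" for K
    using that by (simp_all add: H11_def \<B>_def kernel_of_\<Phi> \<Phi>_nuclear)
  have inj: "K = L" if "K \<in> carr H11" "L \<in> carr H11" "\<Phi> K = \<Phi> L" for K L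
    using that by (intro \<Phi>_inject) (simp_all add: H11_def)
  show ?thesis
  proof (intro conjI ballI)
    show "\<exists>\<Phi>. lin_iso H11 \<B> \<Phi> \<and> (\<forall>K\<in>carr H11. kernel_of \<psi>1 w1 \<psi>2 w2 K (\<Phi> K))"
      using \<Phi>_iso ker unfolding H11_def \<B>_def by blast
    show "\<exists>!T. T \<in> carr \<B> \<and> kernel_of \<psi>1 w1 \<psi>2 w2 K T" if K: "K \<in> carr H11" for K
      using ker[OF K] mem[OF K] unique[OF K] by blast
    show "\<exists>!K. K \<in> carr H11 \<and> kernel_of \<psi>1 w1 \<psi>2 w2 K T" if T: "T \<in> carr \<B>" for T
    proof -
      obtain K where K: "K \<in> carr H11" "T = \<Phi> K" using surj[OF T] by blast
      show ?thesis
      proof (rule ex1I[of _ K])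
        show "K \<in> carr H11 \<and> kernel_of \<psi>1 w1 \<psi>2 w2 K T" using K ker by simp
        show "L = K" if "L \<in> carr H11 \<and> kernel_of \<psi>1 w1 \<psi>2 w2 L T" for L
          using that unique[of L T] T K inj[of L K] by simp
      qed
    qed
  qed
qed

end
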